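(* Suppose that $\hat f_0$ is bounded, the support of $f_0$ is also bounded, and that $f_0/\hat f_0\le c_0^2<\infty$ for some constant $c_0$. Then, as $n\to\infty$, $$\sqrt{n}\,\bigl(T(\hat f_n)-T(\hat f_0)\bigr)\Rightarrow\sigma Z,$$ where $Z$ is a standard normal random variable and $$\sigma^2=\operatorname{var}_{f_0}\bigl(\log(\hat f_0(X))\bigr)=\operatorname{var}_{\hat f_0}\bigl(\log(\hat f_0(X))\bigr).$$
   Context: Let $f_0$ be a probability density on $[0,\infty)$ (not necessarily decreasing) with c.d.f. $F_0$. Let $\widehat F_0$ be the least concave majorant of $F_0$ and $\hat f_0$ its left derivative (the Kullback--Leibler projection of $f_0$ onto decreasing densities). $X_1,\dots,X_n$ are i.i.d. with density $f_0$, $\mathbb{F}_n$ is their empirical distribution function, and $\hat f_n$ is the Grenander estimator, i.e. the maximizer of $\int\log g\,d\mathbb{F}_n$ over decreasing densities $g$ on $[0,\infty)$, equivalently the left derivative of the least concave majorant of $\mathbb{F}_n$. The entropy functional is $T(f)=\int_0^\infty f(x)\log f(x)\,dx$. For a density $h$, $\operatorname{var}_h(\varphi(X))$ denotes the variance of $\varphi(X)$ when $X$ has density $h$. $\Rightarrow$ denotes convergence in distribution. *)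

theory Defs
  imports "HOL-Probability.Probability"
begin

definition halfline_density :: "(real \<Rightarrow> real) \<Rightarrow> bool" where
  "halfline_density f \<longleftrightarrow>
     f \<in> borel_measurable borel \<and> (\<forall>x. 0 \<le> f x) \<and> (\<forall>x<0. f x = 0) \<and>
     (\<integral>\<^sup>+x. ennreal (f x) \<partial>lborel) = 1"

(* Monotonicity is required on the open half-line only, so that decreasing densities that are
   unbounded near 0 are included; the value at the single point 0 is immaterial. *)
definition decreasing_density :: "(real \<Rightarrow> real) \<Rightarrow> bool" where
  "decreasing_density g \<longleftrightarrow> halfline_density g \<and> antimono_on {0<..} g"

definition law_of_density :: "(real \<Rightarrow> real) \<Rightarrow> real measure" where
  "law_of_density f = density lborel (\<lambda>x. ennreal (f x))"

definition variance_under :: "(real \<Rightarrow> real) \<Rightarrow> (real \<Rightarrow> real) \<Rightarrow> real" where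
  "variance_under h \<phi> = prob_space.variance (law_of_density h) \<phi>"

(* With ln 0 = 0 for type real, the integrand is 0 where f vanishes, as usual. *)
definition entropy_functional :: "(real \<Rightarrow> real) \<Rightarrow> real" where
  "entropy_functional f = (LINT x:{0..}|lborel. f x * ln (f x))"

(* Only the values at x >= 0 are meaningful. *)
definition least_concave_majorant :: "(real \<Rightarrow> real) \<Rightarrow> real \<Rightarrow> real" where
  "least_concave_majorant F x =
     Inf {G x | G. concave_on {0..} G \<and> (\<forall>y\<ge>0. F y \<le> G y)}"

definition left_derivative :: "(real \<Rightarrow> real) \<Rightarrow> real \<Rightarrow> real" where
  "left_derivative G x = (THE D. (G has_real_derivative D) (at_left x))"

(* No left derivative is available at the end point 0; the function is set to 0 there. *)
definition decreasing_projection :: "(real \<Rightarrow> real) \<Rightarrow> real \<Rightarrow> real" where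
  "decreasing_projection f x =
     (if 0 < x then left_derivative (least_concave_majorant (cdf (law_of_density f))) x else 0)"

(* log 0 = -\<infinity>: a density vanishing at an observation has log-likelihood -\<infinity>. *)
definition elog :: "real \<Rightarrow> ereal" where
  "elog t = (if 0 < t then ereal (ln t) else -\<infinity>)"

(* The integral of log g with respect to the empirical distribution of x 0, ..., x (n - 1). *)
definition empirical_loglik :: "(nat \<Rightarrow> real) \<Rightarrow> nat \<Rightarrow> (real \<Rightarrow> real) \<Rightarrow> ereal" where
  "empirical_loglik x n g = (\<Sum>i<n. elog (g (x i))) / ereal (real n)"

(* For n >= 1 and positive observations (which holds almost surely) a maximizer exists and is
   unique up to its value at 0, so arg_max makes no essential choice. *)
definition grenander :: "(nat \<Rightarrow> real) \<Rightarrow> nat \<Rightarrow> real \<Rightarrow> real" where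
  "grenander x n = arg_max (empirical_loglik x n) decreasing_density"

end

theory Submission
  imports Defs "HOL-Real_Asymp.Real_Asymp"
begin

text \<open>
  By the characterization of the Grenander estimator as the slope of a least concave majorant, the
  value \<open>max_loglik\<close> of the log-likelihood at its maximum equals \<open>T(f^_n)\<close>, and
  \<open>T(f^_0)\<close> is the mean of \<open>ln f^_0\<close> under \<open>f_0\<close>: the majorant touches the distribution
  function wherever its slope changes, so the slope has the same law under a distribution and under
  its projection. Hence \<open>T(f^_n) - T(f^_0)\<close> is the centred empirical mean of \<open>ln f^_0\<close>, to
  which the central limit theorem applies, plus the excess
  \<open>K_n = \<integral> ln (f^_n / f^_0) dF_n \<ge> 0\<close>, which has to be \<open>o(1 / sqrt n)\<close> in probability.

  By concavity of the logarithm \<open>K_n \<le> 2 \<integral> h dF_n\<close> with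
  \<open>h = ln ((f^_n + f^_0) / (2 f^_0))\<close>, and \<open>\<integral> g / f^_0 dF_0 \<le> 1\<close> for decreasing densities \<open>g\<close>
  gives \<open>\<integral> h dF_0 \<le> - D\<close> and \<open>\<integral> h\<^sup>2 dF_0 \<le> 8 D\<close> for a Hellinger-type distance \<open>D\<close>. After
  truncating \<open>f^_0\<close> at \<open>n powr (-2)\<close>, which no observation notices with high probability, \<open>h\<close>
  is a difference of two decreasing functions with range \<open>O(ln n)\<close>. Decomposing \<open>h\<close> over dyadic
  quantile cells of \<open>F_0\<close>, the coarse scales of \<open>\<integral> h d(F_n - F_0)\<close> are absorbed by \<open>D\<close>, and
  the fine ones are bounded by the range of \<open>h\<close> times the largest cell deviation, which fourth
  moments make smaller than \<open>n powr (-1/2)\<close> by a power of \<open>n\<close>.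
\<close>

section \<open>Concave functions, monotone functions and level sets\<close>

text \<open>One inequality serves twice: for the hull slope \<open>g\<close> of a distribution and a
  decreasing density \<open>\<psi>\<close>, the integral of \<open>\<psi> / g\<close> under that
  distribution is at most 1, once \<open>g\<close> is truncated away from 0. Under the empirical
  measure it is the first-order condition that makes the hull slope the maximum likelihood
  estimator. Under \<open>F_0\<close> it bounds the mean of the likelihood ratio although
  \<open>f_0\<close> itself need not be decreasing.

  The exponents balance as follows. With 2^k of order n^(1/4) the coarse scales cost 2^k / n, of
  order n^(-3/4). At a finer scale every cell deviation is at most eta + S / eta^3, where S is the
  sum of their fourth powers, with mean at most 3 / (2^k n^2) + 1 / n^3. So eta and n^(-9/4) / eta^3
  must both beat n^(-1/2) by a power of n, which absorbs the factor (ln n)^2 coming from the number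
  of scales and the range of \<open>h\<close>.

  A separate obstacle is that \<open>T\<close> of an \<open>arg_max\<close> must be measurable in
  the sample. This comes from continuity of the maximal likelihood in the logarithms of the
  observations.\<close>

lemma concave_on_slopes:
  fixes H :: "real \<Rightarrow> real"
  assumes "concave_on {0..} H" "0 \<le> x" "x < y" "y < z"
  shows "(H z - H x) / (z - x) \<le> (H y - H x) / (y - x)"
    and "(H z - H y) / (z - y) \<le> (H z - H x) / (z - x)"
proof -
  have c: "convex_on {0..} (\<lambda>x. - H x)"
    using assms(1) by (simp add: concave_on_def)
  have m: "x \<in> {0..}" "z \<in> {0..}" using assms by auto
  have "(H z - H x) / (z - x) \<le> (H y - H x) / (y - x)
      \<and> (H z - H y) / (z - y) \<le> (H z - H x) / (z - x)"
    using convex_on_slope_le[OF c m assms(3,4)] assms(3,4)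
    by (simp add: divide_simps) (simp add: algebra_simps)
  then show "(H z - H x) / (z - x) \<le> (H y - H x) / (y - x)"
    and "(H z - H y) / (z - y) \<le> (H z - H x) / (z - x)" by auto
qed

text \<open>The backward difference quotients at \<open>x\<close> decrease as \<open>y\<close> tends
  to \<open>x\<close> from the left and are bounded below by every forward slope. Hence the
  one-sided limit exists and equals their infimum. The three conclusions express just this, and all
  later facts about the slope come from them.\<close>

lemma left_derivative_concave:
  fixes H :: "real \<Rightarrow> real"
  assumes H: "concave_on {0..} H" and x: "0 < x"
  shows left_derivative_le_slope: "\<And>y. 0 \<le> y \<Longrightarrow> y < x \<Longrightarrow> left_derivative H x \<le> (H x - H y) / (x - y)"
    and slope_le_left_derivative: "\<And>z. x < z \<Longrightarrow> (H z - H x) / (z - x) \<le> left_derivative H x"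
    and left_derivative_greatest:
      "\<And>c. (\<And>y. 0 \<le> y \<Longrightarrow> y < x \<Longrightarrow> c \<le> (H x - H y) / (x - y)) \<Longrightarrow> c \<le> left_derivative H x"
proof -
  define q where "q y = (H x - H y) / (x - y)" for y
  define D where "D = Inf (q ` {0..<x})"
  have lb: "(H z - H x) / (z - x) \<le> q y" if "0 \<le> y" "y < x" "x < z" for y z
    using concave_on_slopes[OF H that] unfolding q_def by linarith
  have ne: "q ` {0..<x} \<noteq> {}" using x by auto
  have bdd: "bdd_below (q ` {0..<x})"
    by (rule bdd_belowI[of _ "(H (x+1) - H x) / (x + 1 - x)"]) (use lb[of _ "x + 1"] in auto)
  have Dle: "D \<le> q y" if "0 \<le> y" "y < x" for y
    unfolding D_def using that bdd by (intro cInf_lower) auto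
  have Dge: "c \<le> D" if "\<And>y. 0 \<le> y \<Longrightarrow> y < x \<Longrightarrow> c \<le> q y" for c
    unfolding D_def using that ne by (intro cInf_greatest) auto
  have anti: "q y \<le> q y0" if "0 \<le> y0" "y0 \<le> y" "y < x" for y y0
    using concave_on_slopes(2)[OF H, of y0 y x] that unfolding q_def by (cases "y0 = y") auto
  have "(q \<longlongrightarrow> D) (at_left x)"
  proof (rule decreasing_tendsto)
    show "\<forall>\<^sub>F y in at_left x. D \<le> q y"
      using eventually_at_left_real[OF x] by eventually_elim (auto intro: Dle)
  next
    fix c assume "D < c"
    then obtain y0 where y0: "0 \<le> y0" "y0 < x" "q y0 < c"
      unfolding D_def using cInf_lessD[OF ne] by fastforce
    show "\<forall>\<^sub>F y in at_left x. q y < c"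
      using eventually_at_left_real[OF y0(2)]
    proof eventually_elim
      case (elim y)
      then show ?case using anti[of y0 y] y0 by simp
    qed
  qed
  moreover have "q = (\<lambda>y. (H y - H x) / (y - x))"
    unfolding q_def by (auto simp: fun_eq_iff divide_simps) (simp add: algebra_simps)
  ultimately have der: "(H has_real_derivative D) (at_left x)"
    by (simp add: has_field_derivative_iff)
  have "left_derivative H x = D"
    unfolding left_derivative_def
  proof (rule the_equality)
    show "(H has_real_derivative D) (at_left x)" by (rule der)
  next
    fix D' assume "(H has_real_derivative D') (at_left x)"
    then show "D' = D"
      using der by (auto simp: has_field_derivative_iff intro: tendsto_unique[rotated])
  qed
  then show "\<And>y. 0 \<le> y \<Longrightarrow> y < x \<Longrightarrow> left_derivative H x \<le> (H x - H y) / (x - y)"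
    and "\<And>z. x < z \<Longrightarrow> (H z - H x) / (z - x) \<le> left_derivative H x"
    and "\<And>c. (\<And>y. 0 \<le> y \<Longrightarrow> y < x \<Longrightarrow> c \<le> (H x - H y) / (x - y)) \<Longrightarrow> c \<le> left_derivative H x"
    using Dle Dge lb unfolding q_def by auto
qed

lemma measurable_antimono_on_pos:
  fixes g :: "real \<Rightarrow> real"
  assumes "antimono_on {0<..} g" "\<And>x. x \<le> 0 \<Longrightarrow> g x = c x" "c \<in> borel_measurable borel"
  shows "g \<in> borel_measurable borel"
proof -
  have "mono_on {0<..} (\<lambda>x. - g x)"
    using assms(1) by (auto simp: monotone_on_def)
  then have "(\<lambda>x. - g x) \<in> borel_measurable (restrict_space borel {0<..})"
    by (rule borel_measurable_mono_on_fnc)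
  then have "(\<lambda>x. - (- g x)) \<in> borel_measurable (restrict_space borel {0<..})"
    by (rule borel_measurable_uminus)
  then have "(\<lambda>x. if x \<in> {0<..} then g x else c x) \<in> borel_measurable borel"
    using assms(3) by (subst measurable_If_restrict_space_iff) (auto simp: greaterThan_def intro: measurable_restrict_space1)
  moreover have "(\<lambda>x. if x \<in> {0<..} then g x else c x) = g"
    using assms(2) by (auto simp: fun_eq_iff)
  ultimately show ?thesis by simp
qed

text \<open>Increments of \<open>K\<close> over \<open>N\<close> equal pieces are dominated by a telescoping sum divided by \<open>N\<close>.\<close>

lemma eq_of_second_order_increments:
  fixes K g :: "real \<Rightarrow> real"
  assumes K: "\<And>s t. a \<le> s \<Longrightarrow> s < t \<Longrightarrow> t \<le> b \<Longrightarrow> \<bar>K t - K s\<bar> \<le> (g s - g t) * (t - s)"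
    and ab: "a < b"
  shows "K b = K a"
proof -
  define C where "C = (g a - g b) * (b - a)"
  have "\<bar>K b - K a\<bar> \<le> C / real (Suc n)" for n
  proof -
    define N where "N = Suc n"
    define d where "d = (b - a) / real N"
    define t where "t i = a + real i * d" for i :: nat
    have N: "real N > 0" unfolding N_def by simp
    have d: "d > 0" unfolding d_def using ab N by simp
    have Nd: "real N * d = b - a" unfolding d_def using N by simp
    have t: "t 0 = a" "t N = b" by (auto simp: t_def Nd)
    have tb: "t i \<le> b" if "i \<le> N" for i
    proof -
      have "real i * d \<le> real N * d" using that d by (intro mult_right_mono) auto
      then show ?thesis unfolding t_def Nd by simp
    qed
    have dt: "t (Suc i) - t i = d" for i by (simp add: t_def algebra_simps)
    have at: "a \<le> t i" for i using d by (simp add: t_def)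
    have "\<bar>K b - K a\<bar> = \<bar>\<Sum>i<N. K (t (Suc i)) - K (t i)\<bar>"
      by (subst sum_lessThan_telescope) (simp add: t)
    also have "\<dots> \<le> (\<Sum>i<N. \<bar>K (t (Suc i)) - K (t i)\<bar>)" by (rule sum_abs)
    also have "\<dots> \<le> (\<Sum>i<N. (g (t i) - g (t (Suc i))) * d)"
    proof (rule sum_mono)
      fix i assume "i \<in> {..<N}"
      then show "\<bar>K (t (Suc i)) - K (t i)\<bar> \<le> (g (t i) - g (t (Suc i))) * d"
        using K[of "t i" "t (Suc i)"] at[of i] dt[of i] d tb[of "Suc i"] by simp
    qed
    also have "\<dots> = (g a - g b) * d"
      using sum_lessThan_telescope'[of "\<lambda>i. g (t i)" N]
      by (simp add: sum_distrib_right[symmetric] t)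
    also have "\<dots> = C / real (Suc n)" by (simp add: C_def d_def N_def)
    finally show ?thesis .
  qed
  moreover have "(\<lambda>n. C / real (Suc n)) \<longlonglongrightarrow> 0"
    by (rule LIMSEQ_Suc) (rule lim_const_over_n)
  ultimately have "\<bar>K b - K a\<bar> \<le> 0"
    by (intro LIMSEQ_le_const) auto
  then show ?thesis by simp
qed

text \<open>Fubini for the region under the graph of \<open>f\<close>. The condition
  \<open>0 < t\<close> accounts for negative values of \<open>f\<close>, which
  \<open>ennreal\<close> truncates to 0.\<close>

lemma nn_integral_layer_cake:
  fixes f :: "'a \<Rightarrow> real" and w :: "'a \<Rightarrow> ennreal"
  assumes "sigma_finite_measure M" and [measurable]: "f \<in> borel_measurable M" "w \<in> borel_measurable M"
  shows "(\<integral>\<^sup>+x. w x * ennreal (f x) \<partial>M)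
    = (\<integral>\<^sup>+t. (\<integral>\<^sup>+x. w x * indicator {x. 0 < t \<and> t < f x} x \<partial>M) \<partial>lborel)"
proof -
  interpret sigma_finite_measure M by fact
  interpret P: pair_sigma_finite M lborel ..
  have *: "ennreal (f x) = (\<integral>\<^sup>+t. indicator {0<..<f x} t \<partial>lborel)" for x
    by (cases "0 \<le> f x") (auto simp: ennreal_neg)
  have "(\<integral>\<^sup>+x. w x * ennreal (f x) \<partial>M) = (\<integral>\<^sup>+x. (\<integral>\<^sup>+t. w x * indicator {0<..<f x} t \<partial>lborel) \<partial>M)"
    by (simp add: * nn_integral_cmult)
  also have "\<dots> = (\<integral>\<^sup>+x. (\<integral>\<^sup>+t. w x * indicator {x. 0 < t \<and> t < f x} x \<partial>lborel) \<partial>M)"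
    by (auto intro!: nn_integral_cong split: split_indicator)
  also have "\<dots> = (\<integral>\<^sup>+t. (\<integral>\<^sup>+x. w x * indicator {x. 0 < t \<and> t < f x} x \<partial>M) \<partial>lborel)"
    by (rule P.Fubini'[symmetric]) (unfold indicator_def mem_Collect_eq, measurable)
  finally show ?thesis .
qed

text \<open>The weight \<open>w\<close> allows two successive applications, one for each factor of a
  product, after which only the measures of joint superlevel sets remain to be compared.\<close>

lemma nn_integral_mono_level_sets:
  fixes f :: "'a \<Rightarrow> real" and w :: "'a \<Rightarrow> ennreal"
  assumes "sigma_finite_measure M" "sigma_finite_measure N" and s: "sets N = sets M"
    and m: "f \<in> borel_measurable M" "w \<in> borel_measurable M"
    and le: "\<And>t. 0 < t \<Longrightarrow> (\<integral>\<^sup>+x. w x * indicator {x. t < f x} x \<partial>M)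
      \<le> (\<integral>\<^sup>+x. w x * indicator {x. t < f x} x \<partial>N)"
  shows "(\<integral>\<^sup>+x. w x * ennreal (f x) \<partial>M) \<le> (\<integral>\<^sup>+x. w x * ennreal (f x) \<partial>N)"
proof -
  have m': "f \<in> borel_measurable N" "w \<in> borel_measurable N"
    using m measurable_cong_sets[OF s refl] by auto
  have "(\<integral>\<^sup>+x. w x * indicator {x. 0 < t \<and> t < f x} x \<partial>M)
      \<le> (\<integral>\<^sup>+x. w x * indicator {x. 0 < t \<and> t < f x} x \<partial>N)" for t
    using le[of t] by (cases "0 < t") auto
  then show ?thesis
    unfolding nn_integral_layer_cake[OF assms(1) m] nn_integral_layer_cake[OF assms(2) m']
    by (intro nn_integral_mono)
qed

section \<open>The least concave majorant of a distribution function\<close>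

text \<open>Both the law of \<open>f0\<close> and the empirical measure will be instances. That the
  maximum is attained is an assumption because the reasons differ: continuity and compactness in the
  first case, finitely many jumps in the second.\<close>

locale concave_hull = real_distribution \<mu> for \<mu> +
  assumes cdf_0: "cdf \<mu> 0 = 0"
    and cdf_minus_line_attains: "0 < a \<Longrightarrow> \<exists>\<tau>\<ge>0. \<forall>x\<ge>0. cdf \<mu> x - a * x \<le> cdf \<mu> \<tau> - a * \<tau>"
begin

abbreviation "F \<equiv> cdf \<mu>"

definition "H = least_concave_majorant F"

definition "g x = (if 0 < x then left_derivative H x else 0)"

abbreviation "majorant G \<equiv> concave_on {0..} G \<and> (\<forall>y\<ge>0. F y \<le> G y)"

lemma majorant_bdd_below: "0 \<le> x \<Longrightarrow> bdd_below {G x | G. majorant G}"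
  by (rule bdd_belowI[of _ "F x"]) auto

lemma majorant_1: "majorant (\<lambda>_. 1)"
  by (auto simp: concave_on_const cdf_bounded_prob)

lemma H_le: "majorant G \<Longrightarrow> 0 \<le> x \<Longrightarrow> H x \<le> G x"
  unfolding H_def least_concave_majorant_def
  by (rule cInf_lower[OF _ majorant_bdd_below]) auto

lemma H_ge: "(\<And>G. majorant G \<Longrightarrow> c \<le> G x) \<Longrightarrow> c \<le> H x"
  unfolding H_def least_concave_majorant_def
  by (rule cInf_greatest) (use majorant_1 in blast)+

lemma F_le_H: "0 \<le> x \<Longrightarrow> F x \<le> H x"
  by (rule H_ge) auto

lemma H_le_1: "0 \<le> x \<Longrightarrow> H x \<le> 1"
  using H_le[OF majorant_1] .

lemma H_nonneg: "0 \<le> x \<Longrightarrow> 0 \<le> H x"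
  using F_le_H[of x] cdf_nonneg[of x] by linarith

lemma concave_H: "concave_on {0..} H"
  unfolding concave_on_iff
proof (intro conjI ballI allI impI)
  fix x y u v :: real
  assume *: "x \<in> {0..}" "y \<in> {0..}" "0 \<le> u" "0 \<le> v" "u + v = 1"
  show "u * H x + v * H y \<le> H (u *\<^sub>R x + v *\<^sub>R y)"
  proof (rule H_ge)
    fix G assume G: "majorant G"
    have "u * H x + v * H y \<le> u * G x + v * G y"
      using H_le[OF G] * by (intro add_mono mult_left_mono) auto
    also have "\<dots> \<le> G (u *\<^sub>R x + v *\<^sub>R y)"
      using G * unfolding concave_on_iff by blast
    finally show "u * H x + v * H y \<le> G (u *\<^sub>R x + v *\<^sub>R y)" .
  qed
qed auto

lemma H_mono: assumes "0 \<le> x" "x \<le> y" shows "H x \<le> H y"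
proof (rule ccontr)
  assume "\<not> H x \<le> H y"
  with assms have xy: "x < y" "H y < H x" by (cases "x = y"; auto)+
  \<comment> \<open>At this point the line through the two values has dropped by a further 2, more
    than the range [0, 1] of \<open>H\<close> permits.\<close>
  define z where "z = y + 2 * (y - x) / (H x - H y)"
  have z: "y < z" unfolding z_def using xy by simp
  have "(H z - H y) / (z - y) \<le> (H y - H x) / (y - x)"
    using concave_on_slopes[OF concave_H assms(1) xy(1) z] by linarith
  then have "H z - H y \<le> (H y - H x) / (y - x) * (z - y)"
    using z by (simp add: divide_le_eq)
  also have "\<dots> = -2" unfolding z_def using xy by (simp add: divide_simps) (simp add: algebra_simps)
  finally show False
    using H_le_1[of y] H_nonneg[of z] assms z by linarith
qed

lemma g_le_slope: "0 \<le> y \<Longrightarrow> y < x \<Longrightarrow> g x \<le> (H x - H y) / (x - y)"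
  unfolding g_def using left_derivative_le_slope[OF concave_H, of x y] by simp

lemma slope_le_g: "0 < x \<Longrightarrow> x < z \<Longrightarrow> (H z - H x) / (z - x) \<le> g x"
  unfolding g_def using slope_le_left_derivative[OF concave_H, of x z] by simp

lemma g_greatest: "0 < x \<Longrightarrow> (\<And>y. 0 \<le> y \<Longrightarrow> y < x \<Longrightarrow> c \<le> (H x - H y) / (x - y)) \<Longrightarrow> c \<le> g x"
  unfolding g_def using left_derivative_greatest[OF concave_H, of x c] by simp

lemma g_antimono: "0 < x \<Longrightarrow> x \<le> y \<Longrightarrow> g y \<le> g x"
  using slope_le_g[of x y] g_le_slope[of x y] by (cases "x = y") auto

lemma g_antimono_on: "antimono_on {0<..} g"
  by (auto simp: monotone_on_def intro: g_antimono)

lemma g_nonneg: "0 \<le> g x"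
proof (cases "0 < x")
  case True
  then have "0 \<le> (H (x+1) - H x) / (x + 1 - x)" using H_mono[of x "x+1"] by simp
  also have "\<dots> \<le> g x" using True by (intro slope_le_g) auto
  finally show ?thesis .
qed (simp add: g_def)

lemma g_nonpos: "x \<le> 0 \<Longrightarrow> g x = 0" by (simp add: g_def)

lemma g_measurable [measurable]: "g \<in> borel_measurable borel"
  by (rule measurable_antimono_on_pos[OF g_antimono_on, of "\<lambda>_. 0"]) (auto simp: g_nonpos)

section \<open>Points of contact with supporting lines, and the switching relation\<close>

definition "contact a = (SOME \<tau>. 0 \<le> \<tau> \<and> (\<forall>x\<ge>0. F x - a * x \<le> F \<tau> - a * \<tau>))"

lemma contact:
  assumes "0 < a"
  shows contact_nonneg: "0 \<le> contact a"
    and contact_max: "\<And>x. 0 \<le> x \<Longrightarrow> F x - a * x \<le> F (contact a) - a * contact a"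
  using someI_ex[of "\<lambda>\<tau>. 0 \<le> \<tau> \<and> (\<forall>x\<ge>0. F x - a * x \<le> F \<tau> - a * \<tau>)"] cdf_minus_line_attains[OF assms]
  unfolding contact_def by auto

lemma H_le_tangent:
  assumes "0 < a" "0 \<le> x"
  shows "H x \<le> F (contact a) + a * (x - contact a)"
proof -
  have "concave_on {0..} (\<lambda>x. F (contact a) + a * (x - contact a))"
    by (auto simp: concave_on_iff algebra_simps simp flip: distrib_left distrib_right)
  moreover have "F y \<le> F (contact a) + a * (y - contact a)" if "0 \<le> y" for y
    using contact_max[OF assms(1) that] by (simp add: algebra_simps)
  ultimately show ?thesis using H_le[of "\<lambda>x. F (contact a) + a * (x - contact a)" x] assms by auto
qed

lemma H_contact: "0 < a \<Longrightarrow> H (contact a) = F (contact a)"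
  using H_le_tangent[of a "contact a"] F_le_H[OF contact_nonneg, of a] contact_nonneg[of a] by simp

text \<open>With \<open>le_g_of_le_contact\<close> this is the switching relation:
  \<open>contact\<close> acts as an inverse of the slope, so that up to boundary points the
  superlevel sets of \<open>g\<close> are intervals ending where \<open>H\<close> and
  \<open>F\<close> agree.\<close>

lemma g_le_of_contact_less: assumes "0 < a" "contact a < x" shows "g x \<le> a"
proof -
  have "g x \<le> (H x - H (contact a)) / (x - contact a)"
    using assms contact_nonneg[OF assms(1)] by (intro g_le_slope)
  also have "\<dots> \<le> a"
    using H_le_tangent[of a x] H_contact[of a] assms contact_nonneg[OF assms(1)]
    by (simp add: divide_le_eq)
  finally show ?thesis .
qed

lemma le_g_of_le_contact: assumes "0 < a" "0 < x" "x \<le> contact a" shows "a \<le> g x"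
proof -
  have "a \<le> g (contact a)"
  proof (rule g_greatest)
    fix y assume y: "0 \<le> y" "y < contact a"
    then show "a \<le> (H (contact a) - H y) / (contact a - y)"
      using H_le_tangent[of a y] H_contact[of a] assms(1) by (simp add: le_divide_eq algebra_simps)
  qed (use assms in auto)
  also have "\<dots> \<le> g x" using assms by (intro g_antimono)
  finally show ?thesis .
qed

text \<open>A steep supporting line must touch \<open>F\<close> close to 0, where \<open>F\<close>
  is small by right continuity; the same line then bounds \<open>H\<close> just to the right of 0.
  This excludes a jump of \<open>H\<close> at 0, which a density could not reproduce.\<close>

lemma H_tendsto_0: "(H \<longlongrightarrow> 0) (at_right 0)"
proof (rule tendstoI)
  fix e :: real assume e: "0 < e"
  have "(F \<longlongrightarrow> 0) (at_right 0)"
    using cdf_is_right_cont[of 0] by (simp add: continuous_within cdf_0)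
  then have "\<forall>\<^sub>F x in at_right 0. F x < e / 2"
    using e by (intro order_tendstoD) auto
  then obtain d where d: "0 < d" "\<And>x. 0 < x \<Longrightarrow> x < d \<Longrightarrow> F x < e / 2"
    by (auto simp: eventually_at_right_field)
  \<comment> \<open>At the contact point \<open>t\<close> the difference F t - a * t is at least its
    value 0 at the origin, so a * t is at most 1; this slope therefore gives t <= d / 2.\<close>
  define a where "a = 2 / d"
  have a: "0 < a" using d by (simp add: a_def)
  define t where "t = contact a"
  have t0: "0 \<le> t" unfolding t_def using contact_nonneg[OF a] .
  have "0 \<le> F t - a * t" unfolding t_def using contact_max[OF a, of 0] by (simp add: cdf_0)
  then have "a * t \<le> 1" using cdf_bounded_prob[of t] by linarith
  then have "t \<le> d / 2" unfolding a_def using d by (simp add: field_simps)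
  then have Ft: "F t < e / 2" using d(2)[of t] d(1) t0 e by (cases "t = 0") (auto simp: cdf_0)
  have "dist (H x) 0 < e" if x: "0 < x" "x < e / (2 * a)" for x
  proof -
    have "a * x < e / 2" using x a by (simp add: field_simps)
    moreover have "0 \<le> a * t" using a t0 by simp
    ultimately have "H x < e"
      using H_le_tangent[OF a, of x] x Ft unfolding t_def[symmetric] right_diff_distrib by linarith
    then show ?thesis using H_nonneg[of x] x by simp
  qed
  then show "\<forall>\<^sub>F x in at_right 0. dist (H x) 0 < e"
    unfolding eventually_at_right_field using e a by (intro exI[of _ "e / (2 * a)"]) auto
qed

section \<open>The slope as the density of the majorant\<close>

abbreviation "\<nu> \<equiv> density lborel (\<lambda>x. ennreal (g x))"

text \<open>The mass of an interval from \<open>s\<close> to \<open>t\<close> and the increment of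
  \<open>H\<close> over it both lie between g t * (t - s) and g s * (t - s). Their difference
  \<open>K\<close> thus has increments of second order and is constant.\<close>

lemma g_density_increment:
  assumes "0 < x" "x < y"
  shows "emeasure \<nu> {x<..y} = ennreal (H y - H x)"
proof -
  have meas [measurable]: "(\<lambda>x. ennreal (g x)) \<in> borel_measurable lborel" by measurable
  have up: "emeasure \<nu> {s<..t} \<le> ennreal (g s * (t - s))" if "0 < s" "s < t" for s t
  proof -
    have "emeasure \<nu> {s<..t} = (\<integral>\<^sup>+z. ennreal (g z) * indicator {s<..t} z \<partial>lborel)"
      by (simp add: emeasure_density)
    also have "\<dots> \<le> (\<integral>\<^sup>+z. ennreal (g s) * indicator {s<..t} z \<partial>lborel)"
      using that by (intro nn_integral_mono) (auto intro!: ennreal_leI g_antimono split: split_indicator)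
    also have "\<dots> = ennreal (g s * (t - s))"
      using that by (simp add: nn_integral_cmult_indicator ennreal_mult g_nonneg)
    finally show ?thesis .
  qed
  have lo: "ennreal (g t * (t - s)) \<le> emeasure \<nu> {s<..t}" if "0 < s" "s < t" for s t
  proof -
    have "ennreal (g t * (t - s)) = (\<integral>\<^sup>+z. ennreal (g t) * indicator {s<..t} z \<partial>lborel)"
      using that by (simp add: nn_integral_cmult_indicator ennreal_mult g_nonneg)
    also have "\<dots> \<le> (\<integral>\<^sup>+z. ennreal (g z) * indicator {s<..t} z \<partial>lborel)"
      using that by (intro nn_integral_mono) (auto intro!: ennreal_leI g_antimono split: split_indicator)
    also have "\<dots> = emeasure \<nu> {s<..t}" by (simp add: emeasure_density)
    finally show ?thesis .
  qed
  have fin: "emeasure \<nu> {s<..t} \<noteq> \<infinity>" if "0 < s" for s t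
    using up[OF that, of t] by (cases "s < t") (auto simp: top_unique)
  define m where "m s t = measure \<nu> {s<..t}" for s t
  have em: "emeasure \<nu> {s<..t} = ennreal (m s t)" if "0 < s" for s t
    unfolding m_def using fin[OF that, of t] by (simp add: emeasure_eq_ennreal_measure)
  have m_bounds: "g t * (t - s) \<le> m s t" "m s t \<le> g s * (t - s)" if "0 < s" "s < t" for s t
  proof -
    have "0 \<le> g s * (t - s)" "0 \<le> m s t" using that by (auto simp: g_nonneg m_def)
    then show "g t * (t - s) \<le> m s t" "m s t \<le> g s * (t - s)"
      using up[OF that] lo[OF that] that by (simp_all add: em ennreal_le_iff)
  qed
  have m_add: "m x t = m x s + m s t" if "x \<le> s" "s < t" for s t
  proof -
    have "{x<..t} = {x<..s} \<union> {s<..t}" "{x<..s} \<inter> {s<..t} = {}" using that by auto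
    then show ?thesis
      unfolding m_def using fin[of x] fin[of s] that assms
      by (simp add: measure_Union)
  qed
  define K where "K t = m x t - H t" for t
  have "K y = K x"
  proof (rule eq_of_second_order_increments[where K = K and g = g and a = x and b = y])
    fix s t assume *: "x \<le> s" "s < t" "t \<le> y"
    have s: "0 < s" using * assms by simp
    have "K t - K s = m s t - (H t - H s)" unfolding K_def using m_add[of s t] * by simp
    moreover have "g t * (t - s) \<le> H t - H s"
      using g_le_slope[of s t] s * by (simp add: le_divide_eq)
    moreover have "H t - H s \<le> g s * (t - s)"
      using slope_le_g[of s t] s * by (simp add: divide_le_eq)
    ultimately show "\<bar>K t - K s\<bar> \<le> (g s - g t) * (t - s)"
      using m_bounds[OF s *(2)] unfolding left_diff_distrib by linarith
  qed (use assms in auto)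
  then have "m x y = H y - H x" unfolding K_def m_def by simp
  then show ?thesis using em[of x y] assms by simp
qed

lemma emeasure_\<nu>_Ioc: assumes "0 < x" shows "emeasure \<nu> {0<..x} = ennreal (H x)"
proof -
  define t where "t n = x / real (Suc (Suc n))" for n
  have t: "0 < t n" "t n < x" for n unfolding t_def using assms by (auto simp: divide_simps)
  have lim: "t \<longlonglongrightarrow> 0"
    unfolding t_def by (intro LIMSEQ_Suc lim_const_over_n)
  have "(\<lambda>n. emeasure \<nu> {t n<..x}) \<longlonglongrightarrow> emeasure \<nu> (\<Union>n. {t n<..x})"
  proof (rule Lim_emeasure_incseq)
    show "incseq (\<lambda>n. {t n<..x})"
    proof (rule incseq_SucI)
      fix n
      have "t (Suc n) \<le> t n" unfolding t_def using assms by (intro divide_left_mono) auto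
      then show "{t n<..x} \<subseteq> {t (Suc n)<..x}" by auto
    qed
  qed auto
  also have "(\<Union>n. {t n<..x}) = {0<..x}"
  proof (intro equalityI subsetI)
    fix z assume z: "z \<in> {0<..x}"
    then obtain n where "t n < z"
      using order_tendstoD(2)[OF lim, of z] by (auto simp: eventually_sequentially)
    then show "z \<in> (\<Union>n. {t n<..x})" using z by auto
  qed (use t in \<open>auto intro: less_trans\<close>)
  finally have 1: "(\<lambda>n. emeasure \<nu> {t n<..x}) \<longlonglongrightarrow> emeasure \<nu> {0<..x}" .
  have "filterlim t (at_right 0) sequentially"
    using lim t by (auto simp: filterlim_at intro!: always_eventually less_imp_neq[THEN not_sym])
  then have "(\<lambda>n. H (t n)) \<longlonglongrightarrow> 0" by (rule filterlim_compose[OF H_tendsto_0])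
  then have "(\<lambda>n. ennreal (H x - H (t n))) \<longlonglongrightarrow> ennreal (H x - 0)"
    by (intro tendsto_ennrealI tendsto_diff tendsto_const)
  then have "(\<lambda>n. emeasure \<nu> {t n<..x}) \<longlonglongrightarrow> ennreal (H x)"
    using g_density_increment[OF t] by simp
  with 1 show ?thesis by (rule LIMSEQ_unique)
qed

lemma emeasure_\<nu>_nonpos: "emeasure \<nu> {..0} = 0"
proof -
  have "ennreal (g z) * indicator {..0} z = 0" for z
    by (auto simp: g_nonpos split: split_indicator)
  then show ?thesis by (subst emeasure_density) (simp_all del: mult_eq_0_iff)
qed

lemma emeasure_\<nu>_pos: "emeasure \<nu> {0<..} = 1"
proof -
  have "(\<lambda>n. emeasure \<nu> {0<..real (Suc n)}) \<longlonglongrightarrow> emeasure \<nu> (\<Union>n. {0<..real (Suc n)})"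
    by (rule Lim_emeasure_incseq) (auto simp: incseq_def)
  also have "(\<Union>n. {0<..real (Suc n)}) = {0<..}"
  proof (intro equalityI subsetI)
    fix z :: real assume "z \<in> {0<..}"
    moreover obtain n where "z \<le> real n" using real_arch_simple by blast
    ultimately show "z \<in> (\<Union>n. {0<..real (Suc n)})" by (intro UN_I[of n]) auto
  qed auto
  finally have 1: "(\<lambda>n. ennreal (H (real (Suc n)))) \<longlonglongrightarrow> emeasure \<nu> {0<..}"
    by (simp add: emeasure_\<nu>_Ioc)
  have "(\<lambda>n. H (real (Suc n))) \<longlonglongrightarrow> 1"
  proof (rule tendsto_sandwich[of "\<lambda>n. F (real (Suc n))" _ _ "\<lambda>_. 1"])
    show "(\<lambda>n. F (real (Suc n))) \<longlonglongrightarrow> 1" by (rule LIMSEQ_Suc[OF cdf_lim_infty_prob])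
  qed (auto intro!: always_eventually F_le_H H_le_1 simp del: of_nat_Suc)
  then have "(\<lambda>n. ennreal (H (real (Suc n)))) \<longlonglongrightarrow> ennreal 1" by (rule tendsto_ennrealI)
  then show ?thesis using LIMSEQ_unique[OF 1] by simp
qed

lemma real_distribution_\<nu>: "real_distribution \<nu>"
proof -
  have "emeasure \<nu> UNIV = emeasure \<nu> ({..0} \<union> {0<..})" by (rule arg_cong[where f = "emeasure \<nu>"]) auto
  also have "\<dots> = emeasure \<nu> {..0} + emeasure \<nu> {0<..}" by (rule plus_emeasure[symmetric]) auto
  finally have "prob_space \<nu>"
    by (intro prob_spaceI) (simp add: emeasure_\<nu>_nonpos emeasure_\<nu>_pos)
  then show ?thesis by (simp add: real_distribution_def real_distribution_axioms_def)
qed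

sublocale N: real_distribution \<nu> by (rule real_distribution_\<nu>)

lemma nn_integral_g: "(\<integral>\<^sup>+x. ennreal (g x) \<partial>lborel) = 1"
  using N.emeasure_space_1 by (simp add: emeasure_density)

lemma decreasing_density_g: "decreasing_density g"
  unfolding decreasing_density_def halfline_density_def
  using g_nonneg g_nonpos g_antimono_on nn_integral_g by auto

section \<open>Equality in law of the slope under a distribution and its projection\<close>

lemma measure_Ioc: "0 \<le> x \<Longrightarrow> measure \<mu> {0<..x} = F x"
  using cdf_diff_eq[of 0 x] by (cases "x = 0") (auto simp: cdf_0)

lemma measure_\<nu>_Ioc: "0 \<le> x \<Longrightarrow> measure \<nu> {0<..x} = H x"
proof (cases "x = 0")
  case True
  have "H 0 \<le> 0"
  proof (rule tendsto_lowerbound[OF H_tendsto_0])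
    show "\<forall>\<^sub>F x in at_right 0. H 0 \<le> H x"
      using eventually_at_right_less by eventually_elim (auto intro: H_mono)
  qed auto
  then show ?thesis using True H_nonneg[of 0] by simp
qed (simp add: measure_def emeasure_\<nu>_Ioc H_nonneg)

lemma measure_nonpos: "measure \<mu> {..0} = 0" "measure \<nu> {..0} = 0"
  using cdf_0 emeasure_\<nu>_nonpos by (auto simp: cdf_def measure_def)

lemma AE_pos: "AE x in \<mu>. 0 < x" "AE x in \<nu>. 0 < x"
proof -
  show "AE x in \<mu>. 0 < x"
    using measure_nonpos by (intro AE_I[of _ _ "{..0}"]) (auto simp: emeasure_eq_measure)
  show "AE x in \<nu>. 0 < x"
    using measure_nonpos by (intro AE_I[of _ _ "{..0}"]) (auto simp: N.emeasure_eq_measure)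
qed

text \<open>The superlevel set is an increasing union of intervals from 0 to a contact point, and at
  contact points the distribution functions \<open>F\<close> and \<open>H\<close> of the two
  measures coincide.\<close>

lemma measure_superlevel:
  assumes "0 \<le> a"
  shows "measure \<mu> {x. a < g x} = measure \<nu> {x. a < g x}"
proof -
  \<comment> \<open>The level is approached from above: contact points exist only for positive
    levels, while \<open>a\<close> may be 0, and on their left the slope is only weakly above the
    level.\<close>
  define c where "c k = a + 1 / real (Suc k)" for k
  have c: "0 < c k" "a < c k" for k unfolding c_def using assms by (auto intro: add_nonneg_pos)
  have cdec: "c (Suc k) < c k" for k unfolding c_def by (simp add: frac_less2)
  define A where "A k = {0<..contact (c k)}" for k
  have inc: "incseq A"
  proof (rule incseq_SucI, rule subsetI)
    fix k x assume "x \<in> A k"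
    then have "0 < x" "c k \<le> g x" unfolding A_def using le_g_of_le_contact[OF c(1)] by auto
    then show "x \<in> A (Suc k)"
      unfolding A_def using g_le_of_contact_less[OF c(1)[of "Suc k"], of x] cdec[of k] by force
  qed
  have Un: "(\<Union>k. A k) = {x. a < g x}"
  proof (intro equalityI subsetI)
    fix x assume "x \<in> (\<Union>k. A k)"
    then obtain k where "0 < x" "x \<le> contact (c k)" by (auto simp: A_def)
    then show "x \<in> {x. a < g x}" using le_g_of_le_contact[OF c(1)[of k], of x] c(2)[of k] by auto
  next
    fix x assume x: "x \<in> {x. a < g x}"
    then have x0: "0 < x" using assms g_nonpos[of x] by force
    have "c \<longlonglongrightarrow> a + 0" unfolding c_def by (intro tendsto_add tendsto_const LIMSEQ_Suc lim_const_over_n)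
    then obtain k where "c k < g x"
      using x order_tendstoD(2)[of c "a + 0" sequentially "g x"] by (auto simp: eventually_sequentially)
    then show "x \<in> (\<Union>k. A k)"
      using g_le_of_contact_less[OF c(1)[of k], of x] x0
      by (intro UN_I[of k]) (auto simp: A_def not_less[symmetric])
  qed
  have "(\<lambda>k. measure \<mu> (A k)) \<longlonglongrightarrow> measure \<mu> (\<Union>k. A k)"
    by (rule finite_Lim_measure_incseq[OF _ inc]) (auto simp: A_def)
  moreover have "(\<lambda>k. measure \<nu> (A k)) \<longlonglongrightarrow> measure \<nu> (\<Union>k. A k)"
    by (rule N.finite_Lim_measure_incseq[OF _ inc]) (auto simp: A_def)
  moreover have "measure \<mu> (A k) = measure \<nu> (A k)" for k
    unfolding A_def using contact_nonneg[OF c(1)] H_contact[OF c(1)]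
    by (simp add: measure_Ioc measure_\<nu>_Ioc)
  ultimately show ?thesis unfolding Un[symmetric] by (simp add: LIMSEQ_unique)
qed

lemma distr_g: "distr \<mu> borel g = distr \<nu> borel g"
proof (rule cdf_unique)
  show "real_distribution (distr \<mu> borel g)" "real_distribution (distr \<nu> borel g)"
    by (auto intro!: real_distribution_distr N.real_distribution_distr)
  have "measure \<mu> {x. g x \<le> a} = measure \<nu> {x. g x \<le> a}" for a
  proof (cases "0 \<le> a")
    case True
    have *: "{x. g x \<le> a} = UNIV - {x. a < g x}" by auto
    show ?thesis
      unfolding * using measure_superlevel[OF True] prob_compl[of "{x. a < g x}"] N.prob_compl[of "{x. a < g x}"]
      by simp
  next
    case False
    then have "\<not> g x \<le> a" for x using g_nonneg[of x] by linarith
    then have "{x. g x \<le> a} = {}" by auto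
    then show ?thesis by simp
  qed
  then show "cdf (distr \<mu> borel g) = cdf (distr \<nu> borel g)"
    by (auto simp: fun_eq_iff cdf_def measure_distr vimage_def)
qed

lemma integral_comp_g:
  fixes k :: "real \<Rightarrow> real"
  assumes [measurable]: "k \<in> borel_measurable borel"
  shows "(\<integral>x. k (g x) \<partial>\<mu>) = (\<integral>x. k (g x) \<partial>\<nu>)"
    and "integrable \<mu> (\<lambda>x. k (g x)) \<longleftrightarrow> integrable \<nu> (\<lambda>x. k (g x))"
proof -
  have "(\<integral>x. k (g x) \<partial>\<mu>) = (\<integral>y. k y \<partial>distr \<mu> borel g)" by (simp add: integral_distr)
  also have "\<dots> = (\<integral>x. k (g x) \<partial>\<nu>)" unfolding distr_g by (simp add: integral_distr)
  finally show "(\<integral>x. k (g x) \<partial>\<mu>) = (\<integral>x. k (g x) \<partial>\<nu>)" .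
  have "integrable \<mu> (\<lambda>x. k (g x)) \<longleftrightarrow> integrable (distr \<mu> borel g) k"
    by (subst integrable_distr_eq) auto
  also have "\<dots> \<longleftrightarrow> integrable \<nu> (\<lambda>x. k (g x))" unfolding distr_g by (subst integrable_distr_eq) auto
  finally show "integrable \<mu> (\<lambda>x. k (g x)) \<longleftrightarrow> integrable \<nu> (\<lambda>x. k (g x))" .
qed

lemma measure_comp_g:
  assumes [measurable]: "A \<in> sets borel"
  shows "measure \<mu> {x. g x \<in> A} = measure \<nu> {x. g x \<in> A}"
proof -
  have "measure (distr \<mu> borel g) A = measure (distr \<nu> borel g) A" unfolding distr_g ..
  then show ?thesis by (simp add: measure_distr vimage_def)
qed

text \<open>The measure with density \<open>g\<close> does not charge the zeros of \<open>g\<close>;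
  as the event is expressed through \<open>g\<close> alone, equality in law carries this over to
  \<open>\<mu>\<close>.\<close>

lemma AE_g_pos: "AE x in \<mu>. 0 < g x"
proof -
  have "ennreal (g z) * indicator {x. g x \<in> {..0}} z = 0" for z
    by (auto simp: ennreal_neg split: split_indicator)
  then have "emeasure \<nu> {x. g x \<in> {..0}} = 0"
    by (subst emeasure_density) (simp_all del: mult_eq_0_iff)
  then have "measure \<nu> {x. g x \<in> {..0}} = 0" by (simp add: measure_def)
  then have "measure \<mu> {x. g x \<in> {..0}} = 0" using measure_comp_g[of "{..0}"] by simp
  then show ?thesis
    by (intro AE_I[of _ _ "{x. g x \<in> {..0}}"]) (auto simp: emeasure_eq_measure)
qed

lemma integral_\<nu>: 
  assumes [measurable]: "k \<in> borel_measurable borel"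
  shows "(\<integral>x. k x \<partial>\<nu>) = (\<integral>x. g x * k x \<partial>lborel)"
  using integral_density[of k lborel g] g_nonneg by simp

lemma entropy_g: "entropy_functional g = (\<integral>x. ln (g x) \<partial>\<mu>)"
proof -
  have "entropy_functional g = (\<integral>x. g x * ln (g x) \<partial>lborel)"
    unfolding entropy_functional_def set_lebesgue_integral_def
    by (intro Bochner_Integration.integral_cong) (auto simp: g_nonpos split: split_indicator)
  also have "\<dots> = (\<integral>x. ln (g x) \<partial>\<nu>)" by (simp add: integral_\<nu>)
  also have "\<dots> = (\<integral>x. ln (g x) \<partial>\<mu>)" by (rule integral_comp_g(1)[symmetric]) measurable
  finally show ?thesis .
qed

section \<open>The ratio inequality for decreasing densities\<close>

lemma measure_initial_segment_le:
  assumes Q: "Q \<subseteq> {0<..}" "\<And>x y. x \<in> Q \<Longrightarrow> 0 < y \<Longrightarrow> y \<le> x \<Longrightarrow> y \<in> Q" and [measurable]: "Q \<in> sets borel"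
  shows "measure \<mu> Q \<le> measure \<nu> Q"
proof -
  have le: "F x \<le> measure \<nu> Q" if "x \<in> Q" for x
  proof -
    have x: "0 < x" using that Q by auto
    have "F x \<le> H x" using F_le_H x by simp
    also have "\<dots> = measure \<nu> {0<..x}" using measure_\<nu>_Ioc x by simp
    also have "\<dots> \<le> measure \<nu> Q"
      using that Q by (intro N.finite_measure_mono) auto
    finally show ?thesis .
  qed
  \<comment> \<open>For a segment with a last point the claim is \<open>F\<close> <=
    \<open>H\<close>. An open end is reached by left limits of \<open>F\<close>, and an unbounded
    segment has full mass under \<open>\<nu>\<close>.\<close>
  consider "Q = {}" | "Q \<noteq> {}" "bdd_above Q" | "\<not> bdd_above Q" by metis
  then show ?thesis
  proof cases
    case 2
    define s where "s = Sup Q"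
    have ub: "x \<le> s" if "x \<in> Q" for x unfolding s_def using that 2 by (intro cSup_upper)
    have s: "0 < s" using 2(1) ub Q(1) by (meson ex_in_conv greaterThan_iff less_le_trans subsetD)
    have inQ: "x \<in> Q" if "0 < x" "x < s" for x
      using less_cSupD[OF 2(1), of x] that Q(2) unfolding s_def by (meson less_imp_le)
    show ?thesis
    proof (cases "s \<in> Q")
      case True
      have "measure \<mu> Q \<le> measure \<mu> {0<..s}" using ub Q(1) by (intro finite_measure_mono) auto
      also have "\<dots> = F s" using s by (simp add: measure_Ioc)
      finally show ?thesis using le[OF True] by simp
    next
      case False
      have "measure \<mu> Q \<le> measure \<mu> {..<s}"
        using ub False by (intro finite_measure_mono) (auto simp: less_le)
      also have "\<dots> \<le> measure \<nu> Q"
      proof (rule tendsto_upperbound[OF cdf_at_left[of s]])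
        show "\<forall>\<^sub>F x in at_left s. F x \<le> measure \<nu> Q"
          using eventually_at_left_real[OF s] by eventually_elim (auto intro: le inQ)
      qed auto
      finally show ?thesis .
    qed
  next
    case 3
    have "Q = {0<..}"
    proof (intro equalityI subsetI)
      fix x :: real assume "x \<in> {0<..}"
      moreover obtain y where "y \<in> Q" "x < y" using 3 by (meson bdd_aboveI linorder_not_less)
      ultimately show "x \<in> Q" using Q(2)[of y x] by auto
    qed (use Q(1) in auto)
    then have "measure \<nu> Q = 1" by (simp add: measure_def emeasure_\<nu>_pos)
    then show ?thesis using prob_le_1 by simp
  qed simp
qed

text \<open>The level \<open>{g \<ge> a}\<close> has the same mass under both measures, and it is nested with
  every initial segment of the half-line.\<close>

lemma measure_band_le:
  fixes \<psi> :: "real \<Rightarrow> real"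
  assumes [measurable]: "\<psi> \<in> borel_measurable borel" and \<psi>: "antimono_on {0<..} \<psi>"
  shows "measure \<mu> {x. 0 < x \<and> g x < a \<and> s < \<psi> x} \<le> measure \<nu> {x. 0 < x \<and> g x < a \<and> s < \<psi> x}"
proof -
  define P where "P = {x. 0 < x \<and> a \<le> g x}"
  define Q where "Q = {x. 0 < x \<and> s < \<psi> x}"
  have [measurable]: "P \<in> sets borel" "Q \<in> sets borel" unfolding P_def Q_def by measurable
  have PP: "y \<in> P" if "x \<in> P" "0 < y" "y \<le> x" for x y
    using that g_antimono[of y x] unfolding P_def by auto
  have QQ: "y \<in> Q" if "x \<in> Q" "0 < y" "y \<le> x" for x y
    using that monotone_onD[OF \<psi>, of y x] unfolding Q_def by auto
  have eq: "{x. 0 < x \<and> g x < a \<and> s < \<psi> x} = Q - P" unfolding P_def Q_def by auto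
  show ?thesis
  proof (cases "Q \<subseteq> P")
    case True
    then have *: "Q - P = {}" by auto
    show ?thesis unfolding eq * by simp
  next
    case False
    then obtain q where q: "q \<in> Q" "q \<notin> P" by auto
    have sub: "P \<subseteq> Q"
    proof
      fix x assume "x \<in> P"
      then show "x \<in> Q" using q PP[of x q] QQ[of q x] by (cases "q \<le> x") (auto simp: P_def Q_def)
    qed
    have "measure \<mu> P = measure \<mu> {x. g x \<in> {a..}}"
      using AE_pos(1) by (intro finite_measure_eq_AE) (auto simp: P_def)
    also have "\<dots> = measure \<nu> {x. g x \<in> {a..}}" by (rule measure_comp_g) auto
    also have "\<dots> = measure \<nu> P"
      using AE_pos(2) by (intro N.finite_measure_eq_AE) (auto simp: P_def)
    finally have "measure \<mu> P = measure \<nu> P" .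
    moreover have "measure \<mu> Q \<le> measure \<nu> Q"
      by (rule measure_initial_segment_le) (use QQ in \<open>auto simp: Q_def\<close>)
    ultimately show ?thesis
      unfolding eq using finite_measure_Diff[of Q P] N.finite_measure_Diff[of Q P] sub by simp
  qed
qed

text \<open>The product of \<open>\<psi>\<close> and the reciprocal slope is integrated by layers in
  both factors. A joint superlevel set is a band {g < a, \<psi> > s}, whose mass does not decrease
  when \<open>\<mu>\<close> is replaced by \<open>\<nu>\<close>. Under \<open>\<nu>\<close> the
  density \<open>g\<close> cancels the reciprocal, which leaves at most the integral of
  \<open>\<psi>\<close>.\<close>

lemma nn_integral_ratio_le_1:
  assumes \<psi>: "decreasing_density \<psi>" and e: "0 < e"
  shows "(\<integral>\<^sup>+x. ennreal (\<psi> x / max (g x) e) \<partial>\<mu>) \<le> 1"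
proof -
  have [measurable]: "\<psi> \<in> borel_measurable borel" and \<psi>0: "\<And>x. 0 \<le> \<psi> x"
    and \<psi>1: "(\<integral>\<^sup>+x. ennreal (\<psi> x) \<partial>lborel) = 1" and anti: "antimono_on {0<..} \<psi>"
    using \<psi> unfolding decreasing_density_def halfline_density_def by auto
  \<comment> \<open>The value 0 off the positive half-line, a null set of \<open>\<mu>\<close>,
    keeps the level sets of \<open>p\<close> where \<open>g\<close> and \<open>\<psi>\<close> are
    monotone; there \<open>g\<close> = 0 would otherwise give the largest value of
    \<open>p\<close>.\<close>
  define p where "p x = (if 0 < x then 1 / max (g x) e else 0)" for x
  have [measurable]: "p \<in> borel_measurable borel" unfolding p_def by measurable
  have max: "0 < max (g x) e" for x using e by (simp add: less_max_iff_disj)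
  have key: "emeasure \<mu> {x. t < p x \<and> s < \<psi> x} \<le> emeasure \<nu> {x. t < p x \<and> s < \<psi> x}"
    if t: "0 < t" for s t
  proof (cases "e < 1 / t")
    case True
    have "{x. t < p x \<and> s < \<psi> x} = {x. 0 < x \<and> g x < 1 / t \<and> s < \<psi> x}"
    proof -
      have "t < 1 / max (g x) e \<longleftrightarrow> max (g x) e < 1 / t" for x
        using t max[of x] by (simp add: field_simps del: max_less_iff_conj)
      then show ?thesis using t True unfolding p_def by auto
    qed
    then show ?thesis
      using measure_band_le[OF _ anti, of "1 / t" s]
      by (simp add: emeasure_eq_measure N.emeasure_eq_measure)
  next
    case False
    have "\<not> t < p x" for x
    proof -
      have "1 / max (g x) e \<le> 1 / e" using e by (intro divide_left_mono) auto
      also have "1 / e \<le> t" using False t e by (simp add: field_simps)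
      finally show ?thesis using t unfolding p_def by auto
    qed
    then show ?thesis by simp
  qed
  have "(\<integral>\<^sup>+x. ennreal (\<psi> x / max (g x) e) \<partial>\<mu>) = (\<integral>\<^sup>+x. ennreal (\<psi> x) * ennreal (p x) \<partial>\<mu>)"
    using AE_pos(1) by (intro nn_integral_cong_AE)
      (auto simp: p_def ennreal_mult''[symmetric] max less_imp_le)
  also have "\<dots> \<le> (\<integral>\<^sup>+x. ennreal (\<psi> x) * ennreal (p x) \<partial>\<nu>)"
  proof (rule nn_integral_mono_level_sets)
    fix t :: real assume t: "0 < t"
    have "(\<integral>\<^sup>+x. indicator {x. t < p x} x * ennreal (\<psi> x) \<partial>\<mu>)
        \<le> (\<integral>\<^sup>+x. indicator {x. t < p x} x * ennreal (\<psi> x) \<partial>\<nu>)"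
    proof (rule nn_integral_mono_level_sets)
      fix s :: real
      have *: "indicator {x. t < p x} x * indicator {x. s < \<psi> x} x
          = (indicator {x. t < p x \<and> s < \<psi> x} x :: ennreal)" for x
        by (auto split: split_indicator)
      show "(\<integral>\<^sup>+x. indicator {x. t < p x} x * indicator {x. s < \<psi> x} x \<partial>\<mu>)
        \<le> (\<integral>\<^sup>+x. indicator {x. t < p x} x * indicator {x. s < \<psi> x} x \<partial>\<nu>)"
        unfolding * using key[OF t, of s] by simp
    qed (auto intro: prob_space_imp_sigma_finite prob_space_axioms N.prob_space_axioms)
    then show "(\<integral>\<^sup>+x. ennreal (\<psi> x) * indicator {x. t < p x} x \<partial>\<mu>)
        \<le> (\<integral>\<^sup>+x. ennreal (\<psi> x) * indicator {x. t < p x} x \<partial>\<nu>)"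
      by (simp add: mult.commute)
  qed (auto intro: prob_space_imp_sigma_finite prob_space_axioms N.prob_space_axioms)
  also have "\<dots> = (\<integral>\<^sup>+x. ennreal (g x) * (ennreal (\<psi> x) * ennreal (p x)) \<partial>lborel)"
    by (subst nn_integral_density) auto
  also have "\<dots> \<le> (\<integral>\<^sup>+x. ennreal (\<psi> x) \<partial>lborel)"
  proof (rule nn_integral_mono)
    fix x
    have p0: "0 \<le> p x" using max[of x] by (auto simp: p_def less_imp_le)
    have "g x * p x \<le> 1" using max[of x] by (auto simp: p_def divide_le_eq_1)
    then have "\<psi> x * (g x * p x) \<le> \<psi> x * 1" using \<psi>0[of x] by (intro mult_left_mono)
    then have "ennreal (g x * (\<psi> x * p x)) \<le> ennreal (\<psi> x)"
      by (intro ennreal_leI) (simp add: mult.left_commute)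
    then show "ennreal (g x) * (ennreal (\<psi> x) * ennreal (p x)) \<le> ennreal (\<psi> x)"
      using p0 \<psi>0 g_nonneg by (simp add: ennreal_mult)
  qed
  finally show ?thesis using \<psi>1 by simp
qed

end

section \<open>Chaining over dyadic quantile cells\<close>

lemma sum_lessThan_double:
  "(\<Sum>i<2 * (m::nat). f (i div 2) :: real) = 2 * (\<Sum>j<m. f j)"
proof (induction m)
  case (Suc m)
  have "2 * Suc m = Suc (Suc (2 * m))" by simp
  then show ?case using Suc by simp
qed simp

text \<open>Young's inequality. With s = 2^l the first term, summed over the cells, becomes one
  eighth of the integral of the square; the 8 is matched to
  \<open>ln_square_le_hellinger\<close>.\<close>

lemma mult_le_weighted_squares:
  fixes x y s :: real
  assumes "0 < s"
  shows "x * y \<le> x\<^sup>2 / (8 * s) + 2 * s * y\<^sup>2"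
proof -
  have "0 \<le> (x - 4 * s * y)\<^sup>2 / (8 * s)" using assms by simp
  also have "\<dots> = x\<^sup>2 / (8 * s) - x * y + 2 * s * y\<^sup>2"
    using assms by (simp add: power2_eq_square field_simps)
  finally show ?thesis by simp
qed

locale continuous_distribution = real_distribution \<mu> for \<mu> +
  assumes continuous_cdf: "continuous_on UNIV (cdf \<mu>)"
begin

text \<open>The minimum puts the points where the distribution function equals 1 into the last cell
  instead of a cell of index 2^l.\<close>

definition cell :: "nat \<Rightarrow> real \<Rightarrow> nat" where
  "cell l x = min (nat \<lfloor>2 ^ l * cdf \<mu> x\<rfloor>) (2 ^ l - 1)"

abbreviation "Cell l j \<equiv> {x. cell l x = j}"

lemma cdf_measurable [measurable]: "cdf \<mu> \<in> borel_measurable borel"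
  by (intro borel_measurable_mono monoI cdf_nondecreasing)

lemma cell_measurable [measurable]: "cell l \<in> measurable borel (count_space UNIV)"
  unfolding cell_def by measurable

lemma cell_less: "cell l x < 2 ^ l"
  by (simp add: cell_def min_less_iff_disj)

lemma cell_mono: "x \<le> y \<Longrightarrow> cell l x \<le> cell l y"
  unfolding cell_def
  by (intro min.mono nat_mono floor_mono mult_left_mono cdf_nondecreasing) auto

lemma cell_Suc_div: "cell (Suc l) x div 2 = cell l x"
proof -
  have "\<lfloor>2 ^ l * cdf \<mu> x\<rfloor> = \<lfloor>(2 ^ Suc l * cdf \<mu> x) / real_of_int 2\<rfloor>" by simp
  also have "\<dots> = \<lfloor>2 ^ Suc l * cdf \<mu> x\<rfloor> div 2" by (rule floor_divide_real_eq_div) simp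
  finally have 1: "nat \<lfloor>2 ^ Suc l * cdf \<mu> x\<rfloor> div 2 = nat \<lfloor>2 ^ l * cdf \<mu> x\<rfloor>"
    using cdf_nonneg[of x] by (subst nat_div_distrib[where y = 2, simplified, symmetric]) auto
  \<comment> \<open>Halving sends the cap of the finer scale to the cap of the coarser one, so the
    truncation respects the nesting of the cells.\<close>
  have 2: "(2 ^ Suc l - 1) div 2 = (2 ^ l - 1 :: nat)"
  proof -
    obtain q :: nat where "2 ^ l = Suc q" using gr0_implies_Suc[of "2 ^ l"] by auto
    then show ?thesis by simp
  qed
  have "mono (\<lambda>n::nat. n div 2)" by (auto simp: mono_def div_le_mono)
  from min_of_mono[OF this] show ?thesis
    unfolding cell_def 1[symmetric] 2[symmetric] by simp
qed

text \<open>A continuous distribution function is uniformly distributed under its own law, because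
  it attains every value strictly between 0 and 1. This is what gives all cells of one scale equal
  mass.\<close>

lemma measure_cdf_less:
  assumes t: "0 \<le> t" "t < 1"
  shows "measure \<mu> {x. cdf \<mu> x < t} = t"
proof -
  have ivt: "\<exists>s. cdf \<mu> s = r" if r: "0 < r" "r < 1" for r
  proof -
    obtain a where a: "cdf \<mu> a < r"
      using order_tendstoD(2)[OF cdf_lim_at_bot r(1)] by (auto simp: eventually_at_bot_linorder)
    obtain b where b: "cdf \<mu> b > r"
      using order_tendstoD(1)[OF cdf_lim_at_top_prob r(2)] by (auto simp: eventually_at_top_linorder)
    have "a \<le> b" using a b cdf_nondecreasing[of b a] by (cases "a \<le> b") auto
    then obtain s where "cdf \<mu> s = r"
      using IVT'[of "cdf \<mu>" a r b] a b continuous_on_subset[OF continuous_cdf] by auto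
    then show ?thesis by blast
  qed
  show ?thesis
  proof (cases "t = 0")
    case True
    have "{x. cdf \<mu> x < 0} = {}" using cdf_nonneg by (auto simp: not_less)
    then show ?thesis using True by simp
  next
    case False
    then obtain s where s: "cdf \<mu> s = t" using ivt[of t] t by auto
    have "x \<le> s" if "cdf \<mu> x < t" for x
      using that s cdf_nondecreasing[of s x] by (cases "x \<le> s") auto
    then have "measure \<mu> {x. cdf \<mu> x < t} \<le> measure \<mu> {..s}" by (intro finite_measure_mono) auto
    then have "measure \<mu> {x. cdf \<mu> x < t} \<le> t" using s by (simp add: cdf_def)
    moreover have "t \<le> measure \<mu> {x. cdf \<mu> x < t}"
    proof (rule dense_le_bounded[of 0])
      show "0 < t" using False t by simp
      fix r assume r: "0 < r" "r < t"
      then obtain q where q: "cdf \<mu> q = r" using ivt[of r] t by auto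
      have "measure \<mu> {..q} \<le> measure \<mu> {x. cdf \<mu> x < t}"
        using cdf_nondecreasing[of _ q] q r by (intro finite_measure_mono) fastforce+
      then show "r \<le> measure \<mu> {x. cdf \<mu> x < t}" using q by (simp add: cdf_def)
    qed
    ultimately show ?thesis by simp
  qed
qed

lemma measure_Cell:
  assumes "j < 2 ^ l"
  shows "measure \<mu> (Cell l j) = 1 / 2 ^ l"
proof -
  have ge: "measure \<mu> {x. i \<le> cell l x} = 1 - real i / 2 ^ l" if "i \<le> 2 ^ l" for i
  proof (cases "i = 2 ^ l")
    case True
    have "\<not> i \<le> cell l x" for x using cell_less[of l x] True by simp
    then have "{x. i \<le> cell l x} = {}" by simp
    then show ?thesis using True by simp
  next
    case False
    with that have i: "i < 2 ^ l" by simp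
    have "i \<le> cell l x \<longleftrightarrow> \<not> cdf \<mu> x < real i / 2 ^ l" for x
    proof -
      have "i \<le> cell l x \<longleftrightarrow> int i \<le> \<lfloor>2 ^ l * cdf \<mu> x\<rfloor>"
        using i cdf_nonneg[of x] unfolding cell_def by (auto simp: le_nat_iff)
      also have "\<dots> \<longleftrightarrow> real i \<le> 2 ^ l * cdf \<mu> x" by (simp add: le_floor_iff)
      also have "\<dots> \<longleftrightarrow> \<not> cdf \<mu> x < real i / 2 ^ l" by (simp add: field_simps not_less)
      finally show ?thesis .
    qed
    then have "{x. i \<le> cell l x} = space \<mu> - {x. cdf \<mu> x < real i / 2 ^ l}" by auto
    moreover have "measure \<mu> {x. cdf \<mu> x < real i / 2 ^ l} = real i / 2 ^ l"
      using i by (intro measure_cdf_less) (auto simp: divide_less_eq simp flip: of_nat_power)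
    ultimately show ?thesis using prob_compl[of "{x. cdf \<mu> x < real i / 2 ^ l}"] by simp
  qed
  have "Cell l j = {x. j \<le> cell l x} - {x. Suc j \<le> cell l x}" by auto
  then have "measure \<mu> (Cell l j) = measure \<mu> {x. j \<le> cell l x} - measure \<mu> {x. Suc j \<le> cell l x}"
    by (simp add: finite_measure_Diff subset_iff)
  also have "\<dots> = 1 / 2 ^ l" using assms by (simp add: ge) (simp add: field_simps)
  finally show ?thesis .
qed

lemma integral_comp_cell:
  assumes "real_distribution \<nu>"
  shows "integrable \<nu> (\<lambda>x. \<phi> (cell l x) :: real)"
    and "(\<integral>x. \<phi> (cell l x) \<partial>\<nu>) = (\<Sum>j<2 ^ l. \<phi> j * measure \<nu> (Cell l j))"
proof -
  interpret \<nu>: real_distribution \<nu> by fact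
  have *: "\<phi> (cell l x) = (\<Sum>j<2 ^ l. \<phi> j * indicator (Cell l j) x)" for x
    using cell_less[of l x] by (simp add: indicator_def sum.delta' if_distrib cong: if_cong)
  have int: "integrable \<nu> (\<lambda>x. \<phi> j * indicator (Cell l j) x)" for j
    by (intro integrable_mult_right) (auto intro!: integrable_real_indicator simp: \<nu>.emeasure_eq_measure)
  show "integrable \<nu> (\<lambda>x. \<phi> (cell l x))" unfolding * using int by (intro Bochner_Integration.integrable_sum)
  show "(\<integral>x. \<phi> (cell l x) \<partial>\<nu>) = (\<Sum>j<2 ^ l. \<phi> j * measure \<nu> (Cell l j))"
    unfolding * using int by (subst Bochner_Integration.integral_sum) auto
qed

text \<open>As cell \<open>j\<close> has mass 2^(-l) under \<open>\<mu>\<close>, this is the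
  conditional expectation of \<open>u\<close> given that cell.\<close>

definition avg :: "nat \<Rightarrow> (real \<Rightarrow> real) \<Rightarrow> nat \<Rightarrow> real" where
  "avg l u j = 2 ^ l * (\<integral>x. indicator (Cell l j) x * u x \<partial>\<mu>)"

lemma integrable_indicator_mult:
  "integrable \<mu> u \<Longrightarrow> integrable \<mu> (\<lambda>x. indicator (Cell l j) x * u x :: real)"
  using integrable_mult_indicator[of "Cell l j" \<mu> u] by simp

lemma avg_bounds:
  assumes j: "j < 2 ^ l" and int: "integrable \<mu> u"
    and u: "\<And>x. cell l x = j \<Longrightarrow> c \<le> u x" "\<And>x. cell l x = j \<Longrightarrow> u x \<le> d"
  shows "c \<le> avg l u j" "avg l u j \<le> d"
proof -
  have i: "integrable \<mu> (\<lambda>x. indicator (Cell l j) x * a)" for a :: real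
    by (intro integrable_mult_left) (auto intro!: integrable_real_indicator simp: emeasure_eq_measure)
  have e: "(\<integral>x. indicator (Cell l j) x * a \<partial>\<mu>) = a / 2 ^ l" for a :: real
    using measure_Cell[OF j] by simp
  have "c / 2 ^ l \<le> (\<integral>x. indicator (Cell l j) x * u x \<partial>\<mu>)"
    unfolding e[symmetric] using u int
    by (intro integral_mono i integrable_indicator_mult) (auto simp: indicator_def)
  then show "c \<le> avg l u j" by (simp add: avg_def divide_le_eq mult.commute)
  have "(\<integral>x. indicator (Cell l j) x * u x \<partial>\<mu>) \<le> d / 2 ^ l"
    unfolding e[symmetric] using u int
    by (intro integral_mono i integrable_indicator_mult) (auto simp: indicator_def)
  then show "avg l u j \<le> d" by (simp add: avg_def le_divide_eq mult.commute)
qed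

lemma sum_avg: assumes int: "integrable \<mu> u" shows "(\<Sum>j<2 ^ l. avg l u j / 2 ^ l) = (\<integral>x. u x \<partial>\<mu>)"
proof -
  have "u x = (\<Sum>j<2 ^ l. indicator (Cell l j) x * u x)" for x
    using cell_less[of l x] by (simp add: indicator_def sum.delta' if_distrib cong: if_cong)
  then have "(\<integral>x. u x \<partial>\<mu>) = (\<integral>x. (\<Sum>j<2 ^ l. indicator (Cell l j) x * u x) \<partial>\<mu>)"
    by (rule Bochner_Integration.integral_cong[OF refl])
  also have "\<dots> = (\<Sum>j<2 ^ l. (\<integral>x. indicator (Cell l j) x * u x \<partial>\<mu>))"
    using int by (intro Bochner_Integration.integral_sum integrable_indicator_mult)
  also have "\<dots> = (\<Sum>j<2 ^ l. avg l u j / 2 ^ l)" by (simp add: avg_def)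
  finally show ?thesis by simp
qed

text \<open>Jensen's inequality on one cell, read off from the nonnegative second moment of
  \<open>u\<close> about its average.\<close>

lemma avg_square_le:
  assumes j: "j < 2 ^ l" and int: "integrable \<mu> u" "integrable \<mu> (\<lambda>x. (u x)\<^sup>2)"
  shows "(avg l u j)\<^sup>2 \<le> avg l (\<lambda>x. (u x)\<^sup>2) j"
proof -
  define a where "a = avg l u j"
  have i0: "integrable \<mu> (\<lambda>x. indicator (Cell l j) x :: real)"
    by (auto intro!: integrable_real_indicator simp: emeasure_eq_measure)
  have i1: "integrable \<mu> (\<lambda>x. indicator (Cell l j) x * u x)"
    and i2: "integrable \<mu> (\<lambda>x. indicator (Cell l j) x * (u x)\<^sup>2)"
    using int by (auto intro: integrable_indicator_mult)
  have "0 \<le> (\<integral>x. indicator (Cell l j) x * (u x - a)\<^sup>2 \<partial>\<mu>)"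
    by (intro integral_nonneg_AE) auto
  also have "\<dots> = (\<integral>x. indicator (Cell l j) x * (u x)\<^sup>2 - 2 * a * (indicator (Cell l j) x * u x)
      + a\<^sup>2 * indicator (Cell l j) x \<partial>\<mu>)"
    by (intro Bochner_Integration.integral_cong) (auto simp: power2_eq_square algebra_simps)
  also have "\<dots> = (\<integral>x. indicator (Cell l j) x * (u x)\<^sup>2 \<partial>\<mu>)
      - 2 * a * (\<integral>x. indicator (Cell l j) x * u x \<partial>\<mu>) + a\<^sup>2 * (1 / 2 ^ l)"
    using i0 i1 i2 measure_Cell[OF j] by (simp add: integrable_mult_right)
  finally have "2 ^ l * 0 \<le> 2 ^ l * ((\<integral>x. indicator (Cell l j) x * (u x)\<^sup>2 \<partial>\<mu>)
      - 2 * a * (\<integral>x. indicator (Cell l j) x * u x \<partial>\<mu>) + a\<^sup>2 * (1 / 2 ^ l))"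
    by (intro mult_left_mono) auto
  also have "\<dots> = avg l (\<lambda>x. (u x)\<^sup>2) j - 2 * a * avg l u j + a\<^sup>2"
    unfolding avg_def by (simp add: algebra_simps)
  also have "\<dots> = avg l (\<lambda>x. (u x)\<^sup>2) j - a\<^sup>2" by (simp add: a_def power2_eq_square)
  finally show ?thesis by (simp add: a_def)
qed

text \<open>The values of \<open>b\<close> are levels separating consecutive cells, so b j - b (j +
  1) bounds the oscillation of \<open>u\<close> on cell \<open>j\<close>. The oscillations
  telescope: their sum is at most the range of \<open>u\<close>, however many cells there
  are.\<close>

lemma antimono_cell_bounds:
  assumes u: "antimono u" "\<And>x. \<alpha> \<le> u x" "\<And>x. u x \<le> \<beta>"
  obtains b :: "nat \<Rightarrow> real" where "antimono b" "b 0 - b (2 ^ l) \<le> \<beta> - \<alpha>"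
    "\<And>x. b (Suc (cell l x)) \<le> u x" "\<And>x. u x \<le> b (cell l x)"
proof
  define S where "S j = u ` {x. cell l x < j}" for j
  \<comment> \<open>The infimum of \<open>u\<close> over the cells before \<open>j\<close> lies
    above \<open>u\<close> on cell \<open>j\<close> and, for the next index, below it. No cell
    precedes cell 0, hence the default \<open>\<beta>\<close>.\<close>
  define b where "b j = (if j = 0 then \<beta> else Inf (S j))" for j
  have bdd: "bdd_below (S j)" for j unfolding S_def using u(2) by (intro bdd_belowI[of _ \<alpha>]) auto
  have ne: "S j \<noteq> {}" if "j \<noteq> 0" for j
  proof -
    have "\<forall>\<^sub>F x in at_bot. cdf \<mu> x < 1 / 2 ^ l" by (rule order_tendstoD[OF cdf_lim_at_bot]) simp
    then obtain x where "cdf \<mu> x < 1 / 2 ^ l" by (auto simp: eventually_at_bot_linorder)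
    then have "\<lfloor>2 ^ l * cdf \<mu> x\<rfloor> = 0"
      using cdf_nonneg[of x] by (simp add: floor_eq_iff field_simps)
    then have "cell l x = 0" unfolding cell_def by simp
    then have "u x \<in> S j" using that unfolding S_def by auto
    then show ?thesis by blast
  qed
  have lower: "b j \<le> u x" if "cell l x < j" for j x
    using that bdd unfolding b_def S_def by (auto intro: cInf_lower)
  show "antimono b"
  proof (rule antimonoI)
    fix i j :: nat assume ij: "i \<le> j"
    show "b j \<le> b i"
    proof (cases "i = 0")
      case True
      show ?thesis
      proof (cases "j = 0")
        case False
        then obtain x where "cell l x < j" using ne[of j] unfolding S_def by auto
        then have "b j \<le> u x" by (rule lower)
        also have "\<dots> \<le> b i" using True u(3) by (simp add: b_def)
        finally show ?thesis .
      qed (use True in simp)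
    next
      case False
      then have "Inf (S j) \<le> Inf (S i)"
        using ij by (intro cInf_superset_mono ne bdd) (auto simp: S_def)
      then show ?thesis using False ij by (simp add: b_def)
    qed
  qed
  have "\<alpha> \<le> b (2 ^ l)"
    unfolding b_def using ne[of "2 ^ l"] u(2) by (auto simp: S_def intro!: cInf_greatest)
  then show "b 0 - b (2 ^ l) \<le> \<beta> - \<alpha>" by (simp add: b_def)
  show "b (Suc (cell l x)) \<le> u x" for x by (rule lower) simp
  show "u x \<le> b (cell l x)" for x
  proof (cases "cell l x = 0")
    case False
    have "u x \<le> u y" if "cell l y < cell l x" for y
      using that cell_mono[of x y l] u(1) by (intro antimonoD[OF u(1)]) (meson leD linear)
    then show ?thesis
      unfolding b_def using False ne[OF False] by (auto simp: S_def intro!: cInf_greatest)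
  qed (use u in \<open>simp add: b_def\<close>)
qed

lemma antimono_integrable:
  fixes u :: "real \<Rightarrow> real"
  assumes "real_distribution \<nu>" "antimono u" "\<And>x. \<alpha> \<le> u x" "\<And>x. u x \<le> \<beta>"
  shows "integrable \<nu> u"
proof -
  interpret \<nu>: real_distribution \<nu> by fact
  have "mono (\<lambda>x. - u x)" using assms(2) by (auto simp: monotone_def)
  then have "(\<lambda>x. - (- u x)) \<in> borel_measurable borel"
    by (intro borel_measurable_uminus borel_measurable_mono)
  then have [measurable]: "u \<in> borel_measurable borel" by simp
  show ?thesis
  proof (rule \<nu>.integrable_const_bound[of _ "max \<bar>\<alpha>\<bar> \<bar>\<beta>\<bar>"])
    have "norm (u x) \<le> max \<bar>\<alpha>\<bar> \<bar>\<beta>\<bar>" for x using assms(3,4)[of x] by (auto simp: abs_if max_def)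
    then show "AE x in \<nu>. norm (u x) \<le> max \<bar>\<alpha>\<bar> \<bar>\<beta>\<bar>" by simp
  qed simp
qed

section \<open>Integrals over cell averages, and chaining between scales\<close>

abbreviation "dev \<nu> l j \<equiv> measure \<nu> (Cell l j) - 1 / 2 ^ l"

text \<open>The conditional expectation of \<open>u\<close> given the cells of scale
  \<open>l\<close>, integrated against the signed measure \<open>\<nu> - \<mu>\<close>.\<close>

definition coarse :: "real measure \<Rightarrow> nat \<Rightarrow> (real \<Rightarrow> real) \<Rightarrow> real" where
  "coarse \<nu> l u = (\<Sum>j<2 ^ l. avg l u j * dev \<nu> l j)"

lemma comp_cell_diff:
  assumes "real_distribution \<nu>"
  shows "(\<integral>x. \<phi> (cell l x) \<partial>\<nu>) - (\<integral>x. \<phi> (cell l x) \<partial>\<mu>) = (\<Sum>j<2 ^ l. \<phi> j * dev \<nu> l j)"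
proof -
  have "(\<integral>x. \<phi> (cell l x) \<partial>\<mu>) = (\<Sum>j<2 ^ l. \<phi> j * (1 / 2 ^ l))"
    unfolding integral_comp_cell(2)[OF real_distribution_axioms]
    by (intro sum.cong) (auto simp: measure_Cell)
  then show ?thesis
    unfolding integral_comp_cell(2)[OF assms] by (simp add: sum_subtractf right_diff_distrib)
qed

context
  fixes \<nu> :: "real measure" and u :: "real \<Rightarrow> real" and \<alpha> \<beta> :: real
  assumes \<nu>: "real_distribution \<nu>"
    and u: "antimono u" "\<And>x. \<alpha> \<le> u x" "\<And>x. u x \<le> \<beta>"
begin

lemma u_integrable: "integrable \<mu> u" "integrable \<nu> u"
  using antimono_integrable[OF _ u] \<nu> real_distribution_axioms by auto

lemma avg_between:
  assumes b: "\<And>x. b (Suc (cell l x)) \<le> u x" "\<And>x. u x \<le> b (cell l x)" and j: "j < 2 ^ l"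
  shows "b (Suc j) \<le> avg l u j" "avg l u j \<le> b j"
  using avg_bounds[OF j u_integrable(1), of "b (Suc j)" "b j"] b by auto

lemma sum_decrements: "(\<Sum>j<n. b j - b (Suc j)) = b 0 - (b n :: real)"
  by (rule sum_lessThan_telescope')

text \<open>The average over a cell and the average over its parent lie between the same two
  separating levels, so they differ by at most the oscillation on the parent. These oscillations sum
  to at most \<open>\<beta> - \<alpha>\<close>; the factor 2 counts the two children of each
  parent.\<close>

lemma coarse_step:
  assumes m: "\<And>j. j < 2 ^ Suc l \<Longrightarrow> \<bar>dev \<nu> (Suc l) j\<bar> \<le> m"
  shows "\<bar>coarse \<nu> (Suc l) u - coarse \<nu> l u\<bar> \<le> 2 * (\<beta> - \<alpha>) * m"
proof -
  obtain b :: "nat \<Rightarrow> real" where b: "antimono b" "b 0 - b (2 ^ l) \<le> \<beta> - \<alpha>"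
    "\<And>x. b (Suc (cell l x)) \<le> u x" "\<And>x. u x \<le> b (cell l x)"
    using antimono_cell_bounds[OF u, of l] by blast
  define \<delta> where "\<delta> j = b j - b (Suc j)" for j
  have \<delta>0: "0 \<le> \<delta> j" for j unfolding \<delta>_def using antimonoD[OF b(1), of j "Suc j"] by simp
  have m0: "0 \<le> m" using m[of 0] by (rule order_trans[OF abs_ge_zero]) simp
  have half: "i div 2 < 2 ^ l" if "i < 2 ^ Suc l" for i :: nat using that by simp
  have "coarse \<nu> l u = (\<integral>x. avg l u (cell l x) \<partial>\<nu>) - (\<integral>x. avg l u (cell l x) \<partial>\<mu>)"
    unfolding coarse_def by (rule comp_cell_diff[OF \<nu>, symmetric])
  \<comment> \<open>A function of the cell index at scale \<open>l\<close> is one of the index at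
    the next scale through division by 2, so both scales can be compared over the finer
    cells.\<close>
  also have "\<dots> = (\<Sum>i<2 ^ Suc l. avg l u (i div 2) * dev \<nu> (Suc l) i)"
    using comp_cell_diff[OF \<nu>, of "\<lambda>i. avg l u (i div 2)" "Suc l"] by (simp only: cell_Suc_div)
  finally have c: "coarse \<nu> l u = (\<Sum>i<2 ^ Suc l. avg l u (i div 2) * dev \<nu> (Suc l) i)" .
  have "\<bar>coarse \<nu> (Suc l) u - coarse \<nu> l u\<bar>
      = \<bar>\<Sum>i<2 ^ Suc l. (avg (Suc l) u i - avg l u (i div 2)) * dev \<nu> (Suc l) i\<bar>"
    unfolding c unfolding coarse_def by (subst sum_subtractf[symmetric]) (simp only: left_diff_distrib)
  also have "\<dots> \<le> (\<Sum>i<2 ^ Suc l. \<bar>(avg (Suc l) u i - avg l u (i div 2)) * dev \<nu> (Suc l) i\<bar>)"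
    by (rule sum_abs)
  also have "\<dots> \<le> (\<Sum>i<2 ^ Suc l. \<delta> (i div 2) * m)"
  proof (rule sum_mono)
    fix i :: nat assume "i \<in> {..<2 ^ Suc l}"
    then have i: "i < 2 ^ Suc l" by simp
    have "b (Suc (i div 2)) \<le> u x" "u x \<le> b (i div 2)" if "cell (Suc l) x = i" for x
      using b(3,4)[of x] that cell_Suc_div[of l x] by auto
    then have "b (Suc (i div 2)) \<le> avg (Suc l) u i" "avg (Suc l) u i \<le> b (i div 2)"
      using avg_bounds[OF i u_integrable(1), of "b (Suc (i div 2))" "b (i div 2)"] by auto
    then have "\<bar>avg (Suc l) u i - avg l u (i div 2)\<bar> \<le> \<delta> (i div 2)"
      using avg_between[OF b(3,4) half[OF i]] unfolding \<delta>_def by linarith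
    then show "\<bar>(avg (Suc l) u i - avg l u (i div 2)) * dev \<nu> (Suc l) i\<bar> \<le> \<delta> (i div 2) * m"
      unfolding abs_mult using m[OF i] \<delta>0 by (intro mult_mono) auto
  qed
  also have "\<dots> = 2 * (b 0 - b (2 ^ l)) * m"
  proof -
    have "(\<Sum>i<2 ^ Suc l. \<delta> (i div 2)) = 2 * (\<Sum>j<2 ^ l. \<delta> j)"
      using sum_lessThan_double[of \<delta> "2 ^ l"] by simp
    also have "(\<Sum>j<2 ^ l. \<delta> j) = b 0 - b (2 ^ l)" unfolding \<delta>_def by (rule sum_decrements)
    finally show ?thesis by (simp only: sum_distrib_right[symmetric])
  qed
  also have "\<dots> \<le> 2 * (\<beta> - \<alpha>) * m" using b(2) m0 by (intro mult_right_mono) auto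
  finally show ?thesis .
qed

lemma coarse_chain:
  assumes m: "\<And>l j. k < l \<Longrightarrow> l \<le> k + n \<Longrightarrow> j < 2 ^ l \<Longrightarrow> \<bar>dev \<nu> l j\<bar> \<le> m l"
  shows "\<bar>coarse \<nu> (k + n) u - coarse \<nu> k u\<bar> \<le> 2 * (\<beta> - \<alpha>) * (\<Sum>l\<in>{k<..k + n}. m l)"
  using m
proof (induction n)
  case (Suc n)
  have "{k<..k + Suc n} = insert (Suc (k + n)) {k<..k + n}" by auto
  then have "(\<Sum>l\<in>{k<..k + Suc n}. m l) = m (Suc (k + n)) + (\<Sum>l\<in>{k<..k + n}. m l)" by simp
  moreover have "\<bar>coarse \<nu> (Suc (k + n)) u - coarse \<nu> (k + n) u\<bar> \<le> 2 * (\<beta> - \<alpha>) * m (Suc (k + n))"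
  proof (rule coarse_step)
    fix j :: nat assume "j < 2 ^ Suc (k + n)"
    then show "\<bar>dev \<nu> (Suc (k + n)) j\<bar> \<le> m (Suc (k + n))"
      using Suc.prems[of "Suc (k + n)" j] by (simp del: power_Suc)
  qed
  moreover have "\<bar>coarse \<nu> (k + n) u - coarse \<nu> k u\<bar> \<le> 2 * (\<beta> - \<alpha>) * (\<Sum>l\<in>{k<..k + n}. m l)"
    using Suc by auto
  ultimately show ?case unfolding abs_le_iff add_Suc_right by (simp only: distrib_left) linarith
qed simp

text \<open>At the last scale \<open>u\<close> is replaced by its cell average at the cost of the
  oscillation on the cell, weighted with a mass under \<open>\<nu>\<close> of at most
  \<open>m\<close> + 2^(-l).\<close>

lemma fine_remainder:
  assumes m: "\<And>j. j < 2 ^ l \<Longrightarrow> \<bar>dev \<nu> l j\<bar> \<le> m"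
  shows "\<bar>((\<integral>x. u x \<partial>\<nu>) - (\<integral>x. u x \<partial>\<mu>)) - coarse \<nu> l u\<bar> \<le> (\<beta> - \<alpha>) * (m + 1 / 2 ^ l)"
proof -
  obtain b :: "nat \<Rightarrow> real" where b: "antimono b" "b 0 - b (2 ^ l) \<le> \<beta> - \<alpha>"
    "\<And>x. b (Suc (cell l x)) \<le> u x" "\<And>x. u x \<le> b (cell l x)"
    using antimono_cell_bounds[OF u, of l] by blast
  define \<delta> where "\<delta> j = b j - b (Suc j)" for j
  have \<delta>0: "0 \<le> \<delta> j" for j unfolding \<delta>_def using antimonoD[OF b(1), of j "Suc j"] by simp
  have m0: "0 \<le> m" using m[of 0] by (rule order_trans[OF abs_ge_zero]) simp
  have "(\<integral>x. avg l u (cell l x) \<partial>\<mu>) = (\<integral>x. u x \<partial>\<mu>)"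
    unfolding integral_comp_cell(2)[OF real_distribution_axioms] sum_avg[OF u_integrable(1), of l, symmetric]
    by (intro sum.cong) (auto simp: measure_Cell)
  then have "coarse \<nu> l u = (\<integral>x. avg l u (cell l x) \<partial>\<nu>) - (\<integral>x. u x \<partial>\<mu>)"
    using comp_cell_diff[OF \<nu>, of "avg l u" l] unfolding coarse_def by simp
  then have "((\<integral>x. u x \<partial>\<nu>) - (\<integral>x. u x \<partial>\<mu>)) - coarse \<nu> l u = (\<integral>x. u x - avg l u (cell l x) \<partial>\<nu>)"
    using u_integrable(2) integral_comp_cell(1)[OF \<nu>] by simp
  also have "\<bar>\<dots>\<bar> \<le> (\<integral>x. \<bar>u x - avg l u (cell l x)\<bar> \<partial>\<nu>)" by (rule integral_abs_bound)
  also have "\<dots> \<le> (\<integral>x. \<delta> (cell l x) \<partial>\<nu>)"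
  proof (rule integral_mono)
    fix x
    show "\<bar>u x - avg l u (cell l x)\<bar> \<le> \<delta> (cell l x)"
      using avg_between[OF b(3,4) cell_less[of l x]] b(3,4)[of x] unfolding \<delta>_def by linarith
  qed (use u_integrable(2) integral_comp_cell(1)[OF \<nu>] in auto)
  also have "\<dots> = (\<Sum>j<2 ^ l. \<delta> j * measure \<nu> (Cell l j))" by (rule integral_comp_cell(2)[OF \<nu>])
  also have "\<dots> \<le> (\<Sum>j<2 ^ l. \<delta> j * (m + 1 / 2 ^ l))"
  proof (intro sum_mono mult_left_mono \<delta>0)
    fix j :: nat assume "j \<in> {..<2 ^ l}"
    then show "measure \<nu> (Cell l j) \<le> m + 1 / 2 ^ l" using m[of j] by auto
  qed
  also have "\<dots> = (b 0 - b (2 ^ l)) * (m + 1 / 2 ^ l)"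
    by (simp add: sum_distrib_right[symmetric] \<delta>_def sum_decrements)
  also have "\<dots> \<le> (\<beta> - \<alpha>) * (m + 1 / 2 ^ l)" using b(2) m0 by (intro mult_right_mono) auto
  finally show ?thesis .
qed

end

lemma coarse_le:
  assumes int: "integrable \<mu> h" "integrable \<mu> (\<lambda>x. (h x)\<^sup>2)"
  shows "coarse \<nu> l h \<le> (\<integral>x. (h x)\<^sup>2 \<partial>\<mu>) / 8 + 2 * 2 ^ l * (\<Sum>j<2 ^ l. (dev \<nu> l j)\<^sup>2)"
proof -
  have "coarse \<nu> l h \<le> (\<Sum>j<2 ^ l. avg l (\<lambda>x. (h x)\<^sup>2) j / 2 ^ l / 8 + 2 * 2 ^ l * (dev \<nu> l j)\<^sup>2)"
    unfolding coarse_def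
  proof (rule sum_mono)
    fix j :: nat assume "j \<in> {..<2 ^ l}"
    then have "(avg l h j)\<^sup>2 \<le> avg l (\<lambda>x. (h x)\<^sup>2) j" using avg_square_le[OF _ int] by simp
    then have "(avg l h j)\<^sup>2 / (8 * 2 ^ l) \<le> avg l (\<lambda>x. (h x)\<^sup>2) j / (8 * 2 ^ l)"
      by (intro divide_right_mono) auto
    then show "avg l h j * dev \<nu> l j \<le> avg l (\<lambda>x. (h x)\<^sup>2) j / 2 ^ l / 8 + 2 * 2 ^ l * (dev \<nu> l j)\<^sup>2"
      using mult_le_weighted_squares[of "2 ^ l" "avg l h j" "dev \<nu> l j"] by (simp add: mult.commute)
  qed
  also have "\<dots> = (\<integral>x. (h x)\<^sup>2 \<partial>\<mu>) / 8 + 2 * 2 ^ l * (\<Sum>j<2 ^ l. (dev \<nu> l j)\<^sup>2)"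
    by (simp add: sum.distrib sum_divide_distrib[symmetric] sum_distrib_left[symmetric]
      sum_avg[OF int(2), of l, unfolded sum_divide_distrib[symmetric]])
  finally show ?thesis .
qed

lemma coarse_diff:
  assumes "integrable \<mu> u" "integrable \<mu> v"
  shows "coarse \<nu> l (\<lambda>x. u x - v x) = coarse \<nu> l u - coarse \<nu> l v"
proof -
  have "avg l (\<lambda>x. u x - v x) j = avg l u j - avg l v j" for j
    unfolding avg_def using assms by (simp add: right_diff_distrib integrable_indicator_mult)
  then show ?thesis by (simp add: coarse_def left_diff_distrib sum_subtractf)
qed

text \<open>A chaining bound: the coarse scale \<open>k\<close> is controlled by the \<open>L\<^sup>2\<close> norm of \<open>u - v\<close>,
  the scales between \<open>k\<close> and \<open>k + n\<close> by the monotonicity of \<open>u\<close> and \<open>v\<close>.\<close>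

theorem chaining:
  fixes u v :: "real \<Rightarrow> real"
  assumes \<nu>: "real_distribution \<nu>"
    and u: "antimono u" "\<And>x. \<alpha> \<le> u x" "\<And>x. u x \<le> \<beta>"
    and v: "antimono v" "\<And>x. \<alpha> \<le> v x" "\<And>x. v x \<le> \<beta>"
    and m: "\<And>l j. k < l \<Longrightarrow> l \<le> k + n \<Longrightarrow> j < 2 ^ l \<Longrightarrow> \<bar>dev \<nu> l j\<bar> \<le> m l" and n: "0 < n"
  shows "(\<integral>x. u x - v x \<partial>\<nu>) - (\<integral>x. u x - v x \<partial>\<mu>)
    \<le> (\<integral>x. (u x - v x)\<^sup>2 \<partial>\<mu>) / 8 + 2 * 2 ^ k * (\<Sum>j<2 ^ k. (dev \<nu> k j)\<^sup>2)
      + (\<beta> - \<alpha>) * (4 * (\<Sum>l\<in>{k<..k + n}. m l) + 2 * (m (k + n) + 1 / 2 ^ (k + n)))"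
proof -
  note iu = u_integrable[OF \<nu> u] and iv = u_integrable[OF \<nu> v]
  have [measurable]: "u \<in> borel_measurable borel" "v \<in> borel_measurable borel"
    using borel_measurable_integrable[OF iu(1)] borel_measurable_integrable[OF iv(1)] by simp_all
  have "integrable \<mu> (\<lambda>x. (u x - v x)\<^sup>2)"
  proof (rule integrable_const_bound[of _ "(\<beta> - \<alpha>)\<^sup>2"])
    have "(u x - v x)\<^sup>2 \<le> (\<beta> - \<alpha>)\<^sup>2" for x
      using u(2,3)[of x] v(2,3)[of x] by (intro power2_le_iff_abs_le[THEN iffD2]) auto
    then show "AE x in \<mu>. norm ((u x - v x)\<^sup>2) \<le> (\<beta> - \<alpha>)\<^sup>2" by simp
  qed simp
  then have low: "coarse \<nu> k u - coarse \<nu> k v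
      \<le> (\<integral>x. (u x - v x)\<^sup>2 \<partial>\<mu>) / 8 + 2 * 2 ^ k * (\<Sum>j<2 ^ k. (dev \<nu> k j)\<^sup>2)"
    using coarse_le[of "\<lambda>x. u x - v x" \<nu> k] iu iv by (simp add: coarse_diff)
  have bounds: "\<bar>((\<integral>x. w x \<partial>\<nu>) - (\<integral>x. w x \<partial>\<mu>)) - coarse \<nu> (k + n) w\<bar>
        \<le> (\<beta> - \<alpha>) * (m (k + n) + 1 / 2 ^ (k + n))"
      "\<bar>coarse \<nu> (k + n) w - coarse \<nu> k w\<bar> \<le> 2 * (\<beta> - \<alpha>) * (\<Sum>l\<in>{k<..k + n}. m l)"
    if "antimono w" "\<And>x. \<alpha> \<le> w x" "\<And>x. w x \<le> \<beta>" for w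
  proof -
    show "\<bar>((\<integral>x. w x \<partial>\<nu>) - (\<integral>x. w x \<partial>\<mu>)) - coarse \<nu> (k + n) w\<bar>
        \<le> (\<beta> - \<alpha>) * (m (k + n) + 1 / 2 ^ (k + n))"
      by (rule fine_remainder[OF \<nu> that], rule m) (use n in auto)
    show "\<bar>coarse \<nu> (k + n) w - coarse \<nu> k w\<bar> \<le> 2 * (\<beta> - \<alpha>) * (\<Sum>l\<in>{k<..k + n}. m l)"
      by (rule coarse_chain[OF \<nu> that], rule m)
  qed
  have "(\<integral>x. u x - v x \<partial>\<nu>) - (\<integral>x. u x - v x \<partial>\<mu>)
      = ((\<integral>x. u x \<partial>\<nu>) - (\<integral>x. u x \<partial>\<mu>)) - ((\<integral>x. v x \<partial>\<nu>) - (\<integral>x. v x \<partial>\<mu>))"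
    using iu iv by simp
  moreover have "(\<beta> - \<alpha>) * (4 * (\<Sum>l\<in>{k<..k + n}. m l) + 2 * (m (k + n) + 1 / 2 ^ (k + n)))
      = 2 * (2 * (\<beta> - \<alpha>) * (\<Sum>l\<in>{k<..k + n}. m l)) + 2 * ((\<beta> - \<alpha>) * (m (k + n) + 1 / 2 ^ (k + n)))"
    by (simp only: distrib_left) (simp add: mult_ac)
  ultimately show ?thesis
    using low bounds[OF u] bounds[OF v] unfolding abs_le_iff by linarith
qed

end

section \<open>Moments of empirical measures and negligible perturbations\<close>

lemma (in prob_space) integrable_bounded:
  fixes f :: "'a \<Rightarrow> 'b :: {banach, second_countable_topology}"
  shows "f \<in> borel_measurable M \<Longrightarrow> (\<And>x. x \<in> space M \<Longrightarrow> norm (f x) \<le> B) \<Longrightarrow> integrable M f"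
  by (rule integrable_const_bound[of _ B]) auto

text \<open>Both moments go through one induction because the fourth moment of the longer sum
  involves the second moment of the shorter one. Mixed terms with odd powers vanish by independence
  and centring.\<close>

lemma (in prob_space) moments_sum_indep:
  fixes Y :: "nat \<Rightarrow> 'a \<Rightarrow> real"
  assumes "indep_vars (\<lambda>_. borel) Y {..<n}"
    and bd: "\<And>i x. i < n \<Longrightarrow> x \<in> space M \<Longrightarrow> \<bar>Y i x\<bar> \<le> B"
    and mean: "\<And>i. i < n \<Longrightarrow> expectation (Y i) = 0"
    and v: "\<And>i. i < n \<Longrightarrow> expectation (\<lambda>x. (Y i x)^2) \<le> v"
    and w: "\<And>i. i < n \<Longrightarrow> expectation (\<lambda>x. (Y i x)^4) \<le> w"
  shows "expectation (\<lambda>x. (\<Sum>i<n. Y i x)^2) \<le> n * v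
    \<and> expectation (\<lambda>x. (\<Sum>i<n. Y i x)^4) \<le> 3 * (real n)\<^sup>2 * v\<^sup>2 + n * w"
  using assms
proof (induction n)
  case (Suc n)
  define S where "S x = (\<Sum>i<n. Y i x)" for x
  have set: "{..<Suc n} = insert n {..<n}" by auto
  have rv [measurable]: "Y i \<in> borel_measurable M" if "i < Suc n" for i
    using Suc.prems(1) that unfolding indep_vars_def2 by auto
  have Sm [measurable]: "S \<in> borel_measurable M"
    unfolding S_def using rv by (intro borel_measurable_sum) auto
  have Ym [measurable]: "Y n \<in> borel_measurable M" by (rule rv) simp
  have indep0: "indep_var borel (Y n) borel S"
    unfolding S_def using Suc.prems(1) by (intro indep_vars_sum) (auto simp: set)
  have Yb: "\<bar>Y n x\<bar> \<le> B" if "x \<in> space M" for x using Suc.prems(2)[OF _ that, of n] by simp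
  have Sb: "\<bar>S x\<bar> \<le> n * B" if "x \<in> space M" for x
  proof -
    have "\<bar>S x\<bar> \<le> (\<Sum>i<n. \<bar>Y i x\<bar>)" unfolding S_def by (rule sum_abs)
    also have "\<dots> \<le> (\<Sum>i<n. B)" using Suc.prems(2) that by (intro sum_mono) auto
    finally show ?thesis by simp
  qed
  have iY: "integrable M (\<lambda>x. (Y n x)^a)" for a
    by (rule integrable_bounded[of _ "B^a"]) (auto simp: power_abs intro!: power_mono Yb)
  have iS: "integrable M (\<lambda>x. (S x)^a)" for a
    by (rule integrable_bounded[of _ "(n * B)^a"]) (auto simp: power_abs intro!: power_mono Sb)
  have ind: "indep_var borel (\<lambda>x. (Y n x)^a) borel (\<lambda>x. (S x)^b)" for a b
    using indep_var_compose[OF indep0, of "\<lambda>x. x^a" borel "\<lambda>x. x^b" borel] by (simp add: comp_def)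
  have prod: "expectation (\<lambda>x. (Y n x)^a * (S x)^b) = expectation (\<lambda>x. (Y n x)^a) * expectation (\<lambda>x. (S x)^b)"
    and iprod: "integrable M (\<lambda>x. (Y n x)^a * (S x)^b)" for a b
    using indep_var_lebesgue_integral[OF ind iY iS] indep_var_integrable[OF ind iY iS] by auto
  have EY: "expectation (Y n) = 0" and EY2: "expectation (\<lambda>x. (Y n x)^2) \<le> v"
    and EY4: "expectation (\<lambda>x. (Y n x)^4) \<le> w" using Suc.prems(3-5) by auto
  have IH: "expectation (\<lambda>x. (S x)^2) \<le> n * v" "expectation (\<lambda>x. (S x)^4) \<le> 3 * (real n)\<^sup>2 * v\<^sup>2 + n * w"
    using Suc.IH Suc.prems(2-5) indep_vars_subset[OF Suc.prems(1), of "{..<n}"] unfolding S_def by auto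
  have v0: "0 \<le> v" by (rule order_trans[OF _ EY2]) simp
  have ES: "expectation S = 0"
    unfolding S_def using Suc.prems(3) rv Suc.prems(2)
    by (subst Bochner_Integration.integral_sum) (auto intro!: integrable_bounded[of _ B])
  have "(\<Sum>i<Suc n. Y i x)^2 = (S x)^2 + 2 * ((Y n x)^1 * (S x)^1) + (Y n x)^2" for x
    by (simp add: S_def power2_eq_square algebra_simps)
  then have "expectation (\<lambda>x. (\<Sum>i<Suc n. Y i x)^2)
      = expectation (\<lambda>x. (S x)^2) + 2 * expectation (\<lambda>x. (Y n x)^1 * (S x)^1) + expectation (\<lambda>x. (Y n x)^2)"
    using iS[of 2] iY[of 2] iprod[of 1 1] by simp
  also have "\<dots> \<le> real (Suc n) * v"
    using prod[of 1 1] EY IH(1) EY2 by (simp add: algebra_simps)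
  finally have 2: "expectation (\<lambda>x. (\<Sum>i<Suc n. Y i x)^2) \<le> real (Suc n) * v" .
  have "(\<Sum>i<Suc n. Y i x)^4 = (S x)^4 + 4 * ((Y n x)^1 * (S x)^3) + 6 * ((Y n x)^2 * (S x)^2)
      + 4 * ((Y n x)^3 * (S x)^1) + (Y n x)^4" for x
  proof -
    have "(a + b)^4 = a^4 + 4 * (b^1 * a^3) + 6 * (b^2 * a^2) + 4 * (b^3 * a^1) + b^4" for a b :: real
      by (simp add: power2_eq_square power3_eq_cube power4_eq_xxxx algebra_simps)
    then show ?thesis by (simp add: S_def)
  qed
  then have "expectation (\<lambda>x. (\<Sum>i<Suc n. Y i x)^4)
      = expectation (\<lambda>x. (S x)^4) + 4 * expectation (\<lambda>x. (Y n x)^1 * (S x)^3)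
        + 6 * expectation (\<lambda>x. (Y n x)^2 * (S x)^2) + 4 * expectation (\<lambda>x. (Y n x)^3 * (S x)^1)
        + expectation (\<lambda>x. (Y n x)^4)"
    using iS[of 4] iY[of 4] iprod[of 1 3] iprod[of 2 2] iprod[of 3 1] by simp
  also have "\<dots> = expectation (\<lambda>x. (S x)^4) + 6 * (expectation (\<lambda>x. (Y n x)^2) * expectation (\<lambda>x. (S x)^2))
      + expectation (\<lambda>x. (Y n x)^4)"
    using prod[of 1 3] prod[of 2 2] prod[of 3 1] EY ES by simp
  also have "\<dots> \<le> (3 * (real n)\<^sup>2 * v\<^sup>2 + n * w) + 6 * (v * (n * v)) + w"
    using IH EY2 EY4 v0 by (intro add_mono mult_left_mono mult_mono) auto
  \<comment> \<open>The constant 3 is reproduced because 3 n^2 + 6 n <= 3 (n + 1)^2.\<close>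
  also have "\<dots> \<le> 3 * (real (Suc n))\<^sup>2 * v\<^sup>2 + real (Suc n) * w"
    by (simp add: power2_eq_square algebra_simps)
  finally show ?case using 2 by simp
qed simp

text \<open>As the image of a probability mass function on the indices this is a probability measure
  for every \<open>n\<close>; its integrals are sample means once \<open>n\<close> is
  positive.\<close>

definition empirical :: "(nat \<Rightarrow> real) \<Rightarrow> nat \<Rightarrow> real measure" where
  "empirical x n = distr (measure_pmf (pmf_of_set {..<n})) borel x"

lemma real_distribution_empirical: "real_distribution (empirical x n)"
  unfolding empirical_def by (rule prob_space.real_distribution_distr) (auto simp: prob_space_measure_pmf)

lemma integral_empirical:
  fixes f :: "real \<Rightarrow> real"
  assumes "0 < n" and [measurable]: "f \<in> borel_measurable borel"
  shows "(\<integral>y. f y \<partial>empirical x n) = (\<Sum>i<n. f (x i)) / n"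
  unfolding empirical_def using assms
  by (subst integral_distr) (auto simp: integral_pmf_of_set lessThan_empty_iff)

lemma measure_empirical:
  assumes "0 < n" and [measurable]: "A \<in> sets borel"
  shows "measure (empirical x n) A = (\<Sum>i<n. indicator A (x i)) / n"
proof -
  interpret real_distribution "empirical x n" by (rule real_distribution_empirical)
  show ?thesis using integral_empirical[OF assms(1), of "indicator A" x] by simp
qed

text \<open>The mass of \<open>A\<close> is kept in the bounds, since for a cell it is 2^(-l) and
  compensates for summing over 2^l cells. It enters because a centred indicator has variance at most
  its mean, and its fourth power is at most its square.\<close>

lemma (in prob_space) empirical_moments:
  fixes X :: "nat \<Rightarrow> 'a \<Rightarrow> real"
  assumes indep: "indep_vars (\<lambda>_. borel) X UNIV" and law: "\<And>i. distr M borel (X i) = \<mu>"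
    and n: "0 < n" and A [measurable]: "A \<in> sets borel"
  defines "N \<equiv> \<lambda>\<omega>. measure (empirical (\<lambda>i. X i \<omega>) n) A - measure \<mu> A"
  shows "expectation (\<lambda>\<omega>. (N \<omega>)^2) \<le> measure \<mu> A / n"
    and "expectation (\<lambda>\<omega>. (N \<omega>)^4) \<le> 3 * (measure \<mu> A)\<^sup>2 / (real n)\<^sup>2 + measure \<mu> A / real n ^ 3"
    and "N \<in> borel_measurable M" and "\<And>\<omega>. \<bar>N \<omega>\<bar> \<le> 1"
proof -
  define p where "p = measure \<mu> A"
  have Xm [measurable]: "X i \<in> borel_measurable M" for i using indep unfolding indep_vars_def2 by auto
  interpret \<mu>: real_distribution \<mu> using law[of 0] real_distribution_distr[OF Xm[of 0]] by simp
  have p: "0 \<le> p" "p \<le> 1" by (auto simp: p_def)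
  define Y where "Y i \<omega> = indicator A (X i \<omega>) - p" for i \<omega>
  have indY: "indep_vars (\<lambda>_. borel) Y {..<n}"
    unfolding Y_def by (rule indep_vars_compose2[OF indep_vars_subset[OF indep]]) auto
  have Yb: "\<bar>Y i \<omega>\<bar> \<le> 1" for i \<omega> unfolding Y_def using p by (auto simp: indicator_def)
  have [measurable]: "Y i \<in> borel_measurable M" for i unfolding Y_def by measurable
  have Ei: "expectation (\<lambda>\<omega>. indicator A (X i \<omega>)) = p" for i
  proof -
    have "p = (\<integral>y. indicator A y \<partial>distr M borel (X i))" unfolding law p_def by simp
    also have "\<dots> = expectation (\<lambda>\<omega>. indicator A (X i \<omega>))" by (subst integral_distr) auto
    finally show ?thesis by simp
  qed
  have ii: "integrable M (\<lambda>\<omega>. indicator A (X i \<omega>) :: real)" for i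
    by (rule integrable_bounded[of _ 1]) (auto simp: indicator_def)
  have iYp: "integrable M (\<lambda>\<omega>. (Y i \<omega>)^a)" for i a
    by (rule integrable_bounded[of _ "1"]) (auto simp: power_abs intro!: power_le_one Yb)
  have E1: "expectation (Y i) = 0" for i
    unfolding Y_def using ii[of i] Ei[of i] by (simp add: prob_space)
  have E2: "expectation (\<lambda>\<omega>. (Y i \<omega>)^2) \<le> p" for i
  proof -
    have "(Y i \<omega>)^2 = (1 - 2 * p) * indicator A (X i \<omega>) + p^2" for \<omega>
      unfolding Y_def by (auto simp: indicator_def power2_eq_square algebra_simps)
    then have "expectation (\<lambda>\<omega>. (Y i \<omega>)^2) = (1 - 2 * p) * p + p^2"
      using ii[of i] Ei[of i] by (simp add: prob_space)
    also have "\<dots> \<le> p" using p by (simp add: power2_eq_square algebra_simps)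
    finally show ?thesis .
  qed
  have E4: "expectation (\<lambda>\<omega>. (Y i \<omega>)^4) \<le> p" for i
  proof -
    have "(Y i \<omega>)^4 \<le> (Y i \<omega>)^2" for \<omega>
    proof -
      have "(Y i \<omega>)^2 * (Y i \<omega>)^2 \<le> 1 * (Y i \<omega>)^2"
        using Yb[of i \<omega>] by (intro mult_right_mono) (auto simp: abs_square_le_1)
      then show ?thesis by (simp add: power2_eq_square power4_eq_xxxx mult.assoc)
    qed
    then have "expectation (\<lambda>\<omega>. (Y i \<omega>)^4) \<le> expectation (\<lambda>\<omega>. (Y i \<omega>)^2)"
      by (intro integral_mono iYp)
    then show ?thesis using E2[of i] by simp
  qed
  have N: "N \<omega> = (\<Sum>i<n. Y i \<omega>) / n" for \<omega>
    unfolding N_def measure_empirical[OF n A] Y_def p_def[symmetric] using n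
    by (simp add: sum_subtractf field_simps)
  have mom: "expectation (\<lambda>x. (\<Sum>i<n. Y i x)^2) \<le> n * p"
    "expectation (\<lambda>x. (\<Sum>i<n. Y i x)^4) \<le> 3 * (real n)\<^sup>2 * p\<^sup>2 + n * p"
    using moments_sum_indep[OF indY Yb E1 E2 E4] by auto
  show "expectation (\<lambda>\<omega>. (N \<omega>)^2) \<le> measure \<mu> A / n"
    unfolding N p_def[symmetric] using mom(1) n by (simp add: power_divide field_simps power2_eq_square)
  have "expectation (\<lambda>\<omega>. (N \<omega>)^4) = expectation (\<lambda>x. (\<Sum>i<n. Y i x)^4) / n^4"
    unfolding N by (simp add: power_divide)
  also have "\<dots> \<le> (3 * (real n)\<^sup>2 * p\<^sup>2 + n * p) / n^4"
    using mom(2) by (intro divide_right_mono) auto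
  also have "\<dots> = 3 * p\<^sup>2 / (real n)\<^sup>2 + p / real n ^ 3"
    using n by (simp add: field_simps power2_eq_square power3_eq_cube power4_eq_xxxx)
  finally show "expectation (\<lambda>\<omega>. (N \<omega>)^4) \<le> 3 * (measure \<mu> A)\<^sup>2 / (real n)\<^sup>2 + measure \<mu> A / real n ^ 3"
    by (simp add: p_def)
  show "N \<in> borel_measurable M" unfolding N by measurable
  show "\<bar>N \<omega>\<bar> \<le> 1" for \<omega>
  proof -
    interpret E: real_distribution "empirical (\<lambda>i. X i \<omega>) n" by (rule real_distribution_empirical)
    have "0 \<le> E.prob A" "E.prob A \<le> 1" by auto
    then show ?thesis unfolding N_def p_def[symmetric] using p by linarith
  qed
qed

lemma cmod_iexp_diff_le: "cmod (iexp a - iexp b) \<le> \<bar>a - b\<bar>"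
proof -
  have "iexp a = iexp b * iexp (a - b)"
    by (simp flip: exp_add add: algebra_simps)
  then have "iexp a - iexp b = iexp b * (iexp (a - b) - 1)"
    by (simp add: right_diff_distrib)
  then have "cmod (iexp a - iexp b) = cmod (iexp (a - b) - 1)" by (simp add: norm_mult)
  also have "\<dots> \<le> \<bar>a - b\<bar>" using iexp_approx1[of "a - b" 0] by simp
  finally show ?thesis .
qed

text \<open>Slutsky's theorem through characteristic functions: the two integrands differ by at most
  |t| d where the variables are within \<open>d\<close>, and by at most 2 on the event of vanishing
  probability.\<close>

lemma (in prob_space) weak_conv_m_add_negligible:
  fixes A Y :: "nat \<Rightarrow> 'a \<Rightarrow> real"
  assumes conv: "weak_conv_m (\<lambda>n. distr M borel (A n)) L" and L: "real_distribution L"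
    and [measurable]: "\<And>n. A n \<in> borel_measurable M" "\<And>n. Y n \<in> borel_measurable M"
    and negl: "\<And>d. 0 < d \<Longrightarrow> (\<lambda>n. prob {\<omega>\<in>space M. d < \<bar>Y n \<omega> - A n \<omega>\<bar>}) \<longlonglongrightarrow> 0"
  shows "weak_conv_m (\<lambda>n. distr M borel (Y n)) L"
proof (rule levy_continuity)
  fix t :: real
  have A: "(\<lambda>n. char (distr M borel (A n)) t) \<longlonglongrightarrow> char L t"
    by (rule levy_continuity1[OF _ L conv]) simp
  have "(\<lambda>n. char (distr M borel (Y n)) t - char (distr M borel (A n)) t) \<longlonglongrightarrow> 0"
  proof (rule tendstoI)
    fix e :: real assume e: "0 < e"
    \<comment> \<open>Dividing by |t| + 1 instead of |t| covers t = 0.\<close>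
    define d where "d = e / (4 * (\<bar>t\<bar> + 1))"
    have d: "0 < d" unfolding d_def using e by (simp add: add_nonneg_pos)
    have td: "\<bar>t\<bar> * d \<le> e / 4"
      unfolding d_def using e by (simp add: divide_simps)
    have bound: "cmod (char (distr M borel (Y n)) t - char (distr M borel (A n)) t)
        \<le> e / 4 + 2 * prob {\<omega>\<in>space M. d < \<bar>Y n \<omega> - A n \<omega>\<bar>}" for n
    proof -
      define B where "B = {\<omega>\<in>space M. d < \<bar>Y n \<omega> - A n \<omega>\<bar>}"
      have [measurable]: "B \<in> sets M" unfolding B_def by measurable
      have i: "integrable M (\<lambda>\<omega>. iexp (t * Z \<omega>))" if [measurable]: "Z \<in> borel_measurable M" for Z
        by (rule integrable_bounded[of _ 1]) auto
      have "char (distr M borel (Y n)) t - char (distr M borel (A n)) t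
          = expectation (\<lambda>\<omega>. iexp (t * Y n \<omega>) - iexp (t * A n \<omega>))"
        unfolding char_def using i[of "Y n"] i[of "A n"] by (simp add: integral_distr)
      also have "cmod \<dots> \<le> expectation (\<lambda>\<omega>. cmod (iexp (t * Y n \<omega>) - iexp (t * A n \<omega>)))"
        by (rule integral_norm_bound)
      also have "\<dots> \<le> expectation (\<lambda>\<omega>. e / 4 + 2 * indicator B \<omega>)"
      proof (rule integral_mono)
        show "integrable M (\<lambda>\<omega>. cmod (iexp (t * Y n \<omega>) - iexp (t * A n \<omega>)))"
          by (intro integrable_norm Bochner_Integration.integrable_diff i) auto
        show "integrable M (\<lambda>\<omega>. e / 4 + 2 * indicator B \<omega>)"
          by (rule integrable_bounded[of _ "e / 4 + 2"]) (use e in \<open>auto simp: indicator_def\<close>)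
        fix \<omega> assume \<omega>: "\<omega> \<in> space M"
        show "cmod (iexp (t * Y n \<omega>) - iexp (t * A n \<omega>)) \<le> e / 4 + 2 * indicator B \<omega>"
        proof (cases "\<omega> \<in> B")
          case True
          have "cmod (iexp (t * Y n \<omega>) - iexp (t * A n \<omega>)) \<le> 1 + 1"
            by (rule order_trans[OF norm_triangle_ineq4]) (simp add: norm_exp_i_times)
          then show ?thesis using True e by simp
        next
          case False
          have "cmod (iexp (t * Y n \<omega>) - iexp (t * A n \<omega>)) \<le> \<bar>t\<bar> * \<bar>Y n \<omega> - A n \<omega>\<bar>"
            using cmod_iexp_diff_le[of "t * Y n \<omega>" "t * A n \<omega>"]
            by (simp flip: right_diff_distrib add: abs_mult)
          also have "\<dots> \<le> \<bar>t\<bar> * d" using False \<omega> unfolding B_def by (intro mult_left_mono) auto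
          finally show ?thesis using td False by simp
        qed
      qed
      also have "\<dots> = e / 4 + 2 * prob B"
      proof -
        have "integrable M (\<lambda>\<omega>. indicator B \<omega> :: real)"
          by (rule integrable_bounded[of _ 1]) (auto simp: indicator_def)
        then show ?thesis by (simp add: prob_space)
      qed
      finally show ?thesis unfolding B_def .
    qed
    have "\<forall>\<^sub>F n in sequentially. prob {\<omega>\<in>space M. d < \<bar>Y n \<omega> - A n \<omega>\<bar>} < e / 4"
      by (rule order_tendstoD[OF negl[OF d]]) (use e in simp)
    then show "\<forall>\<^sub>F n in sequentially. dist (char (distr M borel (Y n)) t - char (distr M borel (A n)) t) 0 < e"
    proof eventually_elim
      case (elim n)
      then show ?case using bound[of n] e by simp
    qed
  qed
  from tendsto_add[OF this A] show "(\<lambda>n. char (distr M borel (Y n)) t) \<longlonglongrightarrow> char L t" by simp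
qed (auto simp: L)

section \<open>The Grenander estimator\<close>

text \<open>Between consecutive observations the distribution function is constant, so subtracting a
  line of positive slope leaves a decreasing function there. The maximum is attained at 0 or at an
  observation.\<close>

lemma concave_hull_empirical:
  assumes n: "0 < n" and pos: "\<And>i. i < n \<Longrightarrow> 0 < x i"
  shows "concave_hull (empirical x n)"
proof -
  interpret real_distribution "empirical x n" by (rule real_distribution_empirical)
  have F: "cdf (empirical x n) t = (\<Sum>i<n. indicator {..t} (x i)) / n" for t
    unfolding cdf_def using n by (simp add: measure_empirical)
  show ?thesis
  proof
    show "cdf (empirical x n) 0 = 0"
        unfolding F using pos by (fastforce intro!: sum.neutral simp: indicator_def)
    fix a :: real assume a: "0 < a"
    define \<phi> where "\<phi> t = cdf (empirical x n) t - a * t" for t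
    define S where "S = insert 0 (x ` {..<n})"
    have S: "finite S" "S \<noteq> {}" unfolding S_def by auto
    have S0: "0 \<le> s" if "s \<in> S" for s using that pos unfolding S_def by (auto simp: less_imp_le)
    obtain \<tau> where \<tau>: "\<tau> \<in> S" "\<phi> \<tau> = Max (\<phi> ` S)"
      using Max_in[of "\<phi> ` S"] S by (metis (no_types, lifting) finite_imageI image_iff image_is_empty)
    have "\<phi> t \<le> \<phi> \<tau>" if t: "0 \<le> t" for t
    proof -
      \<comment> \<open>The last candidate point not beyond \<open>t\<close>; there the distribution
        function has the same value and the line is no higher.\<close>
      define p where "p = Max {s\<in>S. s \<le> t}"
      have ne: "{s\<in>S. s \<le> t} \<noteq> {}" using t unfolding S_def by auto
      have p: "p \<in> S" "p \<le> t" using Max_in[OF _ ne] S unfolding p_def by auto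
      have "s \<le> p" if "s \<in> S" "s \<le> t" for s unfolding p_def using that S by (intro Max_ge) auto
      then have "x i \<le> t \<longleftrightarrow> x i \<le> p" if "i < n" for i using p that unfolding S_def by force
      then have "cdf (empirical x n) t = cdf (empirical x n) p"
        unfolding F by (intro arg_cong2[where f = "(/)"] sum.cong) (auto simp: indicator_def)
      moreover have "a * p \<le> a * t" using p a by simp
      ultimately have "\<phi> t \<le> \<phi> p" unfolding \<phi>_def by simp
      also have "\<dots> \<le> \<phi> \<tau>" unfolding \<tau>(2) using S p by (intro Max_ge) auto
      finally show ?thesis .
    qed
    then show "\<exists>\<tau>\<ge>0. \<forall>x'\<ge>0. cdf (empirical x n) x' - a * x' \<le> cdf (empirical x n) \<tau> - a * \<tau>"
      using S0[OF \<tau>(1)] unfolding \<phi>_def by blast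
  qed
qed

lemma nn_integral_empirical:
  assumes n: "0 < n" and [measurable]: "f \<in> borel_measurable borel" and f: "\<And>y. 0 \<le> f y"
  shows "(\<integral>\<^sup>+y. ennreal (f y) \<partial>empirical x n) = ennreal ((\<Sum>i<n. f (x i)) / n)"
proof -
  have "integrable (empirical x n) f"
    unfolding empirical_def using n
    by (subst integrable_distr_eq) (auto intro!: integrable_measure_pmf_finite simp: lessThan_empty_iff)
  then have "(\<integral>\<^sup>+y. ennreal (f y) \<partial>empirical x n) = ennreal (\<integral>y. f y \<partial>empirical x n)"
    using f by (intro nn_integral_eq_integral) auto
  then show ?thesis using n by (simp add: integral_empirical)
qed

section \<open>The hull slope as maximizer of the likelihood\<close>

abbreviation "ghat x n \<equiv> concave_hull.g (empirical x n)"

definition "max_loglik x n = (\<Sum>i<n. ln (ghat x n (x i))) / n"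

lemma empirical_loglik_pos:
  assumes "0 < n" "\<And>i. i < n \<Longrightarrow> 0 < \<psi> (x i)"
  shows "empirical_loglik x n \<psi> = ereal ((\<Sum>i<n. ln (\<psi> (x i))) / n)"
proof -
  have "(\<Sum>i<n. elog (\<psi> (x i))) = (\<Sum>i<n. ereal (ln (\<psi> (x i))))"
    using assms by (intro sum.cong) (auto simp: elog_def)
  then show ?thesis using assms(1) by (simp add: empirical_loglik_def)
qed

lemma empirical_loglik_nonpos:
  assumes "i < n" "\<psi> (x i) \<le> 0"
  shows "empirical_loglik x n \<psi> = -\<infinity>"
proof -
  have "\<bar>\<Sum>i<n. elog (\<psi> (x i))\<bar> = \<infinity>"
    unfolding sum_Inf using assms by (auto simp: elog_def intro!: bexI[of _ i])
  moreover have "(\<Sum>i<n. elog (\<psi> (x i))) \<noteq> \<infinity>"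
    unfolding sum_Pinfty by (auto simp: elog_def)
  ultimately have "(\<Sum>i<n. elog (\<psi> (x i))) = -\<infinity>" by (cases "\<Sum>i<n. elog (\<psi> (x i))") auto
  then show ?thesis using assms(1) by (simp add: empirical_loglik_def)
qed

lemma decreasing_densityD:
  assumes "decreasing_density \<psi>"
  shows "\<psi> \<in> borel_measurable borel" "\<And>x. 0 \<le> \<psi> x" "\<And>x. x < 0 \<Longrightarrow> \<psi> x = 0"
    "(\<integral>\<^sup>+x. ennreal (\<psi> x) \<partial>lborel) = 1" "\<And>x y. 0 < x \<Longrightarrow> x \<le> y \<Longrightarrow> \<psi> y \<le> \<psi> x"
  using assms unfolding decreasing_density_def halfline_density_def
  by (auto simp: monotone_on_def)

context
  fixes x :: "nat \<Rightarrow> real" and n :: nat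
  assumes n: "0 < n" and pos: "\<And>i. i < n \<Longrightarrow> 0 < x i"
begin

interpretation E: concave_hull "empirical x n" by (rule concave_hull_empirical[OF n pos])

text \<open>Every observation has positive empirical mass, so what holds almost everywhere under the
  empirical measure holds at each of them.\<close>

lemma ghat_pos: assumes "i < n" shows "0 < ghat x n (x i)"
proof -
  have "measure (empirical x n) {y. ghat x n y \<le> 0} = 0"
    using E.AE_g_pos by (subst E.prob_eq_0) (auto simp: not_le)
  then have "(\<Sum>i<n. indicator {y. ghat x n y \<le> 0} (x i)) = (0::real)"
    using n by (subst (asm) measure_empirical) auto
  then have "indicator {y. ghat x n y \<le> 0} (x i) = (0::real)"
    using assms by (subst (asm) sum_nonneg_eq_0_iff) auto
  then show ?thesis by (auto simp: indicator_def split: if_splits)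
qed

lemma sum_ratio_le:
  assumes \<psi>: "decreasing_density \<psi>"
  shows "(\<Sum>i<n. \<psi> (x i) / ghat x n (x i)) \<le> n"
proof -
  note d [measurable] = decreasing_densityD(1)[OF \<psi>]
  \<comment> \<open>The smallest slope at an observation, so that truncating at \<open>e\<close>
    changes nothing there.\<close>
  define e where "e = Min ((\<lambda>i. ghat x n (x i)) ` {..<n})"
  have ne: "(\<lambda>i. ghat x n (x i)) ` {..<n} \<noteq> {}" using n by auto
  have e0: "0 < e" unfolding e_def using ne ghat_pos by (subst Min_gr_iff) auto
  have max: "max (ghat x n (x i)) e = ghat x n (x i)" if "i < n" for i
    unfolding e_def using that by (intro max_absorb1 Min_le) auto
  have "ennreal ((\<Sum>i<n. \<psi> (x i) / max (ghat x n (x i)) e) / n) \<le> 1"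
    using E.nn_integral_ratio_le_1[OF \<psi> e0] decreasing_densityD(2)[OF \<psi>] e0
    by (subst (asm) nn_integral_empirical[OF n]) (auto intro!: divide_nonneg_nonneg simp: le_max_iff_disj)
  then have "(\<Sum>i<n. \<psi> (x i) / max (ghat x n (x i)) e) / n \<le> 1" by simp
  then show ?thesis using n max by (simp add: divide_le_eq)
qed

text \<open>The ratios \<open>r\<close> sum to at most \<open>n\<close>, and ln r <= r - 1 with
  equality only at r = 1. This yields maximality together with uniqueness of the values at the
  observations.\<close>

lemma ghat_maximal:
  assumes \<psi>: "decreasing_density \<psi>" and p: "\<And>i. i < n \<Longrightarrow> 0 < \<psi> (x i)"
  shows "(\<Sum>i<n. ln (\<psi> (x i))) \<le> (\<Sum>i<n. ln (ghat x n (x i)))"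
    and "(\<Sum>i<n. ln (\<psi> (x i))) = (\<Sum>i<n. ln (ghat x n (x i))) \<Longrightarrow> i < n \<Longrightarrow> \<psi> (x i) = ghat x n (x i)"
proof -
  define r where "r i = \<psi> (x i) / ghat x n (x i)" for i
  have r: "0 < r i" if "i < n" for i unfolding r_def using p ghat_pos that by simp
  have ln_r: "ln (r i) = ln (\<psi> (x i)) - ln (ghat x n (x i))" if "i < n" for i
    unfolding r_def using p[OF that] ghat_pos[OF that] by (simp add: ln_div)
  then have s: "(\<Sum>i<n. ln (r i)) = (\<Sum>i<n. ln (\<psi> (x i))) - (\<Sum>i<n. ln (ghat x n (x i)))"
    by (simp add: sum_subtractf)
  have nn: "0 \<le> r i - 1 - ln (r i)" if "i < n" for i using ln_le_minus_one[OF r[OF that]] by simp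
  have le: "(\<Sum>i<n. r i - 1 - ln (r i)) \<le> - (\<Sum>i<n. ln (r i))"
    using sum_ratio_le[OF \<psi>] by (simp add: sum_subtractf r_def)
  have "0 \<le> (\<Sum>i<n. r i - 1 - ln (r i))" using nn by (intro sum_nonneg) auto
  then show "(\<Sum>i<n. ln (\<psi> (x i))) \<le> (\<Sum>i<n. ln (ghat x n (x i)))" using le s by simp
  assume eq: "(\<Sum>i<n. ln (\<psi> (x i))) = (\<Sum>i<n. ln (ghat x n (x i)))" and i: "i < n"
  have "(\<Sum>i<n. r i - 1 - ln (r i)) = 0" using le s eq nn by (intro antisym sum_nonneg) auto
  then have "r i - 1 - ln (r i) = 0" using nn i by (subst (asm) sum_nonneg_eq_0_iff) auto
  then have "r i = 1" using ln_eq_minus_one[OF r[OF i]] by simp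
  then show "\<psi> (x i) = ghat x n (x i)" using ghat_pos[OF i] unfolding r_def by simp
qed

lemma decreasing_density_ghat: "decreasing_density (ghat x n)" by (rule E.decreasing_density_g)

lemma empirical_loglik_ghat: "empirical_loglik x n (ghat x n) = ereal (max_loglik x n)"
  unfolding max_loglik_def by (rule empirical_loglik_pos[of n "ghat x n" x, OF n ghat_pos])

lemma empirical_loglik_le:
  assumes \<psi>: "decreasing_density \<psi>"
  shows "empirical_loglik x n \<psi> \<le> ereal (max_loglik x n)"
proof (cases "\<forall>i<n. 0 < \<psi> (x i)")
  case True
  then show ?thesis
    using ghat_maximal(1)[OF \<psi>] n
    by (simp add: empirical_loglik_pos max_loglik_def divide_right_mono)
next
  case False
  then show ?thesis by (auto simp: not_less empirical_loglik_nonpos)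
qed

text \<open>A maximizer agrees with \<open>ghat\<close> at the observations; the minimum of the two is then a
  subdensity with the same likelihood, so it has mass one and both agree with it almost everywhere.\<close>

lemma maximizer_unique:
  assumes \<psi>: "decreasing_density \<psi>" and max: "empirical_loglik x n \<psi> = ereal (max_loglik x n)"
  shows "AE t in lborel. \<psi> t = ghat x n t"
proof -
  note d = decreasing_densityD[OF \<psi>] and d' = decreasing_densityD[OF decreasing_density_ghat]
  note [measurable] = d(1)
  have p: "0 < \<psi> (x i)" if "i < n" for i
    using max empirical_loglik_nonpos[OF that, of \<psi> x] by (cases "0 < \<psi> (x i)") auto
  have "(\<Sum>i<n. ln (\<psi> (x i))) = (\<Sum>i<n. ln (ghat x n (x i)))"
    using max n by (simp add: empirical_loglik_pos[of n \<psi> x, OF n p] max_loglik_def)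
  then have eq: "\<psi> (x i) = ghat x n (x i)" if "i < n" for i
    using ghat_maximal(2)[OF \<psi> p _ that] by simp
  define \<phi> where "\<phi> t = min (\<psi> t) (ghat x n t)" for t
  have [measurable]: "\<phi> \<in> borel_measurable borel" unfolding \<phi>_def by measurable
  have \<phi>0: "0 \<le> \<phi> t" for t unfolding \<phi>_def using d(2) d'(2) by simp
  have \<phi>dec: "\<phi> t \<le> \<phi> s" if "0 < s" "s \<le> t" for s t
    unfolding \<phi>_def using d(5)[OF that] d'(5)[OF that] by (intro min.mono)
  have \<phi>x: "\<phi> (x i) = ghat x n (x i)" if "i < n" for i unfolding \<phi>_def using eq[OF that] by simp
  define c where "c = enn2real (\<integral>\<^sup>+t. ennreal (\<phi> t) \<partial>lborel)"
  have le1: "(\<integral>\<^sup>+t. ennreal (\<phi> t) \<partial>lborel) \<le> 1"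
    unfolding d(4)[symmetric] by (intro nn_integral_mono ennreal_leI) (simp add: \<phi>_def)
  then have c: "(\<integral>\<^sup>+t. ennreal (\<phi> t) \<partial>lborel) = ennreal c"
    unfolding c_def by (subst ennreal_enn2real) (auto intro: le_less_trans)
  have "0 < (\<integral>\<^sup>+t. ennreal (\<phi> t) \<partial>lborel)"
  proof -
    have "0 < ennreal (\<phi> (x 0)) * emeasure lborel {0<..x 0}"
      using ghat_pos[OF n] pos[OF n] \<phi>x[OF n] by (simp add: ennreal_zero_less_mult_iff)
    also have "\<dots> = (\<integral>\<^sup>+t. ennreal (\<phi> (x 0)) * indicator {0<..x 0} t \<partial>lborel)"
      by (simp add: nn_integral_cmult_indicator)
    also have "\<dots> \<le> (\<integral>\<^sup>+t. ennreal (\<phi> t) \<partial>lborel)"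
      using \<phi>dec by (intro nn_integral_mono) (auto intro!: ennreal_leI split: split_indicator)
    finally show ?thesis .
  qed
  then have c0: "0 < c" unfolding c by simp
  have dd: "decreasing_density (\<lambda>t. \<phi> t / c)"
    unfolding decreasing_density_def halfline_density_def
  proof (intro conjI allI impI)
    show "(\<integral>\<^sup>+t. ennreal (\<phi> t / c) \<partial>lborel) = 1"
    proof -
      have "(\<integral>\<^sup>+t. ennreal (\<phi> t / c) \<partial>lborel) = (\<integral>\<^sup>+t. ennreal (1 / c) * ennreal (\<phi> t) \<partial>lborel)"
        using c0 \<phi>0 by (intro nn_integral_cong) (simp flip: ennreal_mult)
      also have "\<dots> = ennreal (1 / c) * ennreal c" unfolding c[symmetric] by (rule nn_integral_cmult) simp
      also have "\<dots> = 1" using c0 by (simp flip: ennreal_mult)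
      finally show ?thesis .
    qed
    show "antimono_on {0<..} (\<lambda>t. \<phi> t / c)"
      using \<phi>dec c0 by (auto simp: monotone_on_def intro!: divide_right_mono)
    show "\<phi> t / c = 0" if "t < 0" for t using d(3)[OF that] d'(3)[OF that] by (simp add: \<phi>_def)
  qed (use \<phi>0 c0 in auto)
  \<comment> \<open>Normalizing the minimum changes the log-likelihood sum by - n ln c; as this
    cannot exceed the maximum, its mass \<open>c\<close> is at least 1.\<close>
  have "(\<Sum>i<n. ln (\<phi> (x i) / c)) \<le> (\<Sum>i<n. ln (ghat x n (x i)))"
    using ghat_maximal(1)[OF dd] ghat_pos \<phi>x c0 by auto
  moreover have "(\<Sum>i<n. ln (\<phi> (x i) / c)) = (\<Sum>i<n. ln (ghat x n (x i))) - n * ln c"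
  proof -
    have "ln (\<phi> (x i) / c) = ln (ghat x n (x i)) - ln c" if "i < n" for i
      using ghat_pos[OF that] \<phi>x[OF that] c0 by (simp add: ln_div)
    then show ?thesis by (simp add: sum_subtractf)
  qed
  ultimately have "0 \<le> ln c" using n by (simp add: zero_le_mult_iff)
  then have "1 \<le> c" using c0 by simp
  then have one: "(\<integral>\<^sup>+t. ennreal (\<phi> t) \<partial>lborel) = 1" using le1 unfolding c by (simp add: antisym)
  have ae: "AE t in lborel. k t \<le> \<phi> t"
    if "\<And>t. \<phi> t \<le> k t" "(\<integral>\<^sup>+t. ennreal (k t) \<partial>lborel) = 1" "k \<in> borel_measurable borel" for k
  proof -
    have [measurable]: "k \<in> borel_measurable borel" by fact
    have "AE t in lborel. ennreal (k t) \<le> ennreal (\<phi> t)"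
    proof (rule ccontr)
      assume "\<not> (AE t in lborel. ennreal (k t) \<le> ennreal (\<phi> t))"
      then have "(\<integral>\<^sup>+t. ennreal (\<phi> t) \<partial>lborel) < (\<integral>\<^sup>+t. ennreal (k t) \<partial>lborel)"
        using that one by (intro nn_integral_less) (auto intro!: ennreal_leI)
      then show False using one that by simp
    qed
    then show ?thesis using \<phi>0 by (simp add: ennreal_le_iff)
  qed
  have "AE t in lborel. \<psi> t \<le> \<phi> t" "AE t in lborel. ghat x n t \<le> \<phi> t"
    by (rule ae; use d(1,4) d'(1,4) in \<open>simp add: \<phi>_def\<close>)+
  then show ?thesis by eventually_elim (auto simp: \<phi>_def)
qed

lemma entropy_ghat: "entropy_functional (ghat x n) = max_loglik x n"
  unfolding E.entropy_g max_loglik_def using n by (simp add: integral_empirical)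

text \<open>The \<open>arg_max\<close> may select any maximizer, for instance one with another value
  at 0. All of them agree almost everywhere, so the entropy does not depend on the choice.\<close>

lemma entropy_grenander: "entropy_functional (grenander x n) = max_loglik x n"
proof -
  have am: "is_arg_max (empirical_loglik x n) decreasing_density (ghat x n)"
    unfolding is_arg_max_linorder
    using decreasing_density_ghat empirical_loglik_le by (simp add: empirical_loglik_ghat)
  have "is_arg_max (empirical_loglik x n) decreasing_density (grenander x n)"
    unfolding grenander_def arg_max_def
    by (rule someI[of "is_arg_max (empirical_loglik x n) decreasing_density", OF am])
  then have dd: "decreasing_density (grenander x n)"
    and ge: "ereal (max_loglik x n) \<le> empirical_loglik x n (grenander x n)"
    unfolding is_arg_max_linorder empirical_loglik_ghat[symmetric] using decreasing_density_ghat by auto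
  have ae: "AE t in lborel. grenander x n t = ghat x n t"
    using ge empirical_loglik_le[OF dd] by (intro maximizer_unique[OF dd] antisym)
  note [measurable] = decreasing_densityD(1)[OF dd]
  have "entropy_functional (grenander x n) = entropy_functional (ghat x n)"
    unfolding entropy_functional_def set_lebesgue_integral_def
    by (rule integral_cong_AE) (use ae in auto)
  then show ?thesis using entropy_ghat by simp
qed

end

section \<open>Measurability of the entropy of the estimator\<close>

lemma decreasing_density_scale:
  assumes "decreasing_density \<psi>" and c: "0 < c"
  shows "decreasing_density (\<lambda>t. c * \<psi> (c * t))"
proof -
  note d = decreasing_densityD[OF assms(1)]
  note [measurable] = d(1)
  have "(\<integral>\<^sup>+t. ennreal (c * \<psi> (c * t)) \<partial>lborel) = ennreal \<bar>c\<bar> * (\<integral>\<^sup>+t. ennreal (\<psi> (0 + c * t)) \<partial>lborel)"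
    using c d(2) by (simp add: ennreal_mult nn_integral_cmult)
  also have "\<dots> = 1" using c d(4) by (subst nn_integral_real_affine[symmetric]) auto
  finally have "(\<integral>\<^sup>+t. ennreal (c * \<psi> (c * t)) \<partial>lborel) = 1" .
  moreover have "antimono_on {0<..} (\<lambda>t. c * \<psi> (c * t))"
    using c d(5) by (auto simp: monotone_on_def intro!: mult_left_mono)
  ultimately show ?thesis
    unfolding decreasing_density_def halfline_density_def using c d(2,3) by (auto simp: mult_pos_neg)
qed

text \<open>With c = exp (- d), rescaling \<open>ghat x n\<close> to c * ghat (c * t) gives a
  competitor for the sample \<open>y\<close>. Since c * y i does not exceed x i, monotonicity shows
  that its mean log-likelihood on \<open>y\<close> falls short of the maximum for \<open>x\<close>
  by at most \<open>d\<close>.\<close>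

lemma max_loglik_log_Lipschitz:
  assumes n: "0 < n" and x: "\<And>i. i < n \<Longrightarrow> 0 < x i" and y: "\<And>i. i < n \<Longrightarrow> 0 < y i"
    and le: "\<And>i. i < n \<Longrightarrow> ln (y i) \<le> ln (x i) + d"
  shows "max_loglik x n - d \<le> max_loglik y n"
proof -
  define c where "c = exp (- d)"
  have c: "0 < c" by (simp add: c_def)
  note dd = decreasing_density_ghat[OF n x]
  have cy: "0 < c * y i" "c * y i \<le> x i" if "i < n" for i
  proof -
    show "0 < c * y i" using c y that by simp
    moreover have "ln (c * y i) \<le> ln (x i)" using le[OF that] c y[OF that] by (simp add: ln_mult c_def)
    ultimately show "c * y i \<le> x i" using x[OF that] by simp
  qed
  have ge: "ghat x n (x i) \<le> ghat x n (c * y i)" if "i < n" for i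
    using decreasing_densityD(5)[OF dd cy[OF that]] .
  have gp: "0 < ghat x n (x i)" if "i < n" for i using ghat_pos[OF n x that] .
  have "(\<Sum>i<n. ln (ghat x n (x i)) - d) \<le> (\<Sum>i<n. ln (c * ghat x n (c * y i)))"
  proof (rule sum_mono)
    fix i assume "i \<in> {..<n}"
    then have i: "i < n" by simp
    have "ln (c * ghat x n (c * y i)) = ln (ghat x n (c * y i)) - d"
      using c gp[OF i] ge[OF i] by (simp add: ln_mult c_def)
    then show "ln (ghat x n (x i)) - d \<le> ln (c * ghat x n (c * y i))" using ge[OF i] gp[OF i] by simp
  qed
  also have "\<dots> \<le> (\<Sum>i<n. ln (ghat y n (y i)))"
  proof (rule ghat_maximal(1)[OF n y decreasing_density_scale[OF dd c]])
    show "0 < c * ghat x n (c * y i)" if "i < n" for i using c gp[OF that] ge[OF that] by simp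
  qed
  finally have "(\<Sum>i<n. ln (ghat x n (x i))) - n * d \<le> (\<Sum>i<n. ln (ghat y n (y i)))"
    by (simp add: sum_subtractf)
  then have "((\<Sum>i<n. ln (ghat x n (x i))) - n * d) / n \<le> (\<Sum>i<n. ln (ghat y n (y i))) / n"
    by (rule divide_right_mono) simp
  then show ?thesis unfolding max_loglik_def using n by (simp add: diff_divide_distrib)
qed

lemma continuous_on_max_loglik:
  assumes n: "0 < n"
  shows "continuous_on {x. \<forall>i\<in>{..<n}. 0 < x i} (\<lambda>x. max_loglik x n)"
  unfolding continuous_on_def
proof (intro ballI tendstoI)
  let ?P = "{x :: nat \<Rightarrow> real. \<forall>i\<in>{..<n}. 0 < x i}"
  fix x and e :: real assume x: "x \<in> ?P" and e: "0 < e"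
  have "\<forall>i\<in>{..<n}. \<forall>\<^sub>F y in at x within ?P. \<bar>ln (y i) - ln (x i)\<bar> < e / 2"
  proof
    fix i assume i: "i \<in> {..<n}"
    then have xi: "x i \<noteq> 0" using x by force
    have "((\<lambda>y :: nat \<Rightarrow> real. y i) \<longlongrightarrow> x i) (at x within ?P)"
      using continuous_on_subset[OF continuous_on_product_coordinates[of i], of ?P] x
      unfolding continuous_on_def by auto
    then have "((\<lambda>y. ln (y i)) \<longlongrightarrow> ln (x i)) (at x within ?P)"
      using xi by (intro tendsto_ln)
    from tendstoD[OF this, of "e / 2"] show "\<forall>\<^sub>F y in at x within ?P. \<bar>ln (y i) - ln (x i)\<bar> < e / 2"
      using e by (simp add: dist_real_def)
  qed
  then have "\<forall>\<^sub>F y in at x within ?P. \<forall>i\<in>{..<n}. \<bar>ln (y i) - ln (x i)\<bar> < e / 2"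
    by (intro eventually_ball_finite) auto
  moreover have "\<forall>\<^sub>F y in at x within ?P. y \<in> ?P"
    by (simp add: eventually_at_filter)
  ultimately show "\<forall>\<^sub>F y in at x within ?P. dist (max_loglik y n) (max_loglik x n) < e"
  proof eventually_elim
    case (elim y)
    have close: "ln (y i) \<le> ln (x i) + e / 2" "ln (x i) \<le> ln (y i) + e / 2" if "i < n" for i
    proof -
      have "\<bar>ln (y i) - ln (x i)\<bar> < e / 2" using elim(1) that by blast
      then show "ln (y i) \<le> ln (x i) + e / 2" "ln (x i) \<le> ln (y i) + e / 2" by linarith+
    qed
    have "max_loglik x n - e / 2 \<le> max_loglik y n"
      using elim x close by (intro max_loglik_log_Lipschitz[OF n]) auto
    moreover have "max_loglik y n - e / 2 \<le> max_loglik x n"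
      using elim x close by (intro max_loglik_log_Lipschitz[OF n]) auto
    ultimately show ?case using e by (simp add: dist_real_def abs_if)
  qed
qed

text \<open>A negative observation makes every likelihood vanish, so the choice does not depend on the
  sample.\<close>

lemma grenander_neg:
  assumes "i < n" "x i < 0"
  shows "grenander x n = (SOME \<psi>. decreasing_density \<psi>)"
proof -
  have "empirical_loglik x n \<psi> = -\<infinity>" if "decreasing_density \<psi>" for \<psi>
    using decreasing_densityD(3)[OF that assms(2)] by (intro empirical_loglik_nonpos[OF assms(1)]) simp
  then have "is_arg_max (empirical_loglik x n) decreasing_density = decreasing_density"
    unfolding is_arg_max_def by auto
  then show ?thesis unfolding grenander_def arg_max_def by simp
qed

text \<open>An observation at \<open>0\<close> makes the likelihood unbounded, since the value at \<open>0\<close> is free.\<close>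

lemma grenander_zero:
  assumes i: "i < n" "x i = 0" and nn: "\<And>j. j < n \<Longrightarrow> 0 \<le> x j"
  shows "grenander x n = (SOME \<psi>. False)"
proof -
  have n: "0 < n" using i by simp
  define b where "b = Max (insert 1 (x ` {..<n}))"
  have b1: "1 \<le> b" unfolding b_def by (intro Max_ge) auto
  have xb: "x j \<le> b" if "j < n" for j unfolding b_def using that by (intro Max_ge) auto
  have "\<not> is_arg_max (empirical_loglik x n) decreasing_density \<psi>" for \<psi>
  proof
    assume am: "is_arg_max (empirical_loglik x n) decreasing_density \<psi>"
    have "empirical_loglik x n \<psi> \<noteq> \<infinity>"
      using empirical_loglik_pos[OF n, of \<psi> x] empirical_loglik_nonpos[of _ n \<psi> x]
      by (cases "\<forall>j<n. 0 < \<psi> (x j)") (auto simp: not_less)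
    then obtain L where L: "empirical_loglik x n \<psi> \<le> ereal L"
      by (cases "empirical_loglik x n \<psi>") auto
    \<comment> \<open>After a loss of at most n ln b over the other observations, the log-likelihood
      sum still exceeds n L.\<close>
    define K where "K = n * \<bar>L\<bar> + n * ln b + 1"
    have lnb: "0 \<le> ln b" using b1 by simp
    have K0: "0 \<le> K" unfolding K_def using lnb by (intro add_nonneg_nonneg) auto
    \<comment> \<open>The uniform density on an interval covering all observations, with its value
      at the single point 0 raised to exp K.\<close>
    define w where "w t = (if t = 0 then exp K else if 0 < t \<and> t \<le> b then 1 / b else 0)" for t :: real
    have [measurable]: "w \<in> borel_measurable borel" unfolding w_def by measurable
    have "AE t in lborel. t \<noteq> (0::real)" by (rule AE_lborel_singleton)
    then have "(\<integral>\<^sup>+t. ennreal (w t) \<partial>lborel) = (\<integral>\<^sup>+t. ennreal (1 / b) * indicator {0<..b} t \<partial>lborel)"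
      by (intro nn_integral_cong_AE) (auto simp: w_def)
    also have "\<dots> = 1" using b1 by (simp add: nn_integral_cmult_indicator flip: ennreal_mult)
    finally have dd: "decreasing_density w"
      unfolding decreasing_density_def halfline_density_def using b1
      by (auto simp: monotone_on_def) (auto simp: w_def)
    have wp: "0 < w (x j)" if "j < n" for j
      using nn[OF that] xb[OF that] b1 by (auto simp: w_def)
    have "K - n * ln b \<le> (\<Sum>j<n. ln (w (x j)))"
    proof -
      have lo: "- ln b \<le> ln (w (x j))" if "j < n" for j
      proof (cases "x j = 0")
        case True
        then show ?thesis using K0 lnb by (simp add: w_def del: ln_ge_zero_iff)
      next
        case False
        then have "w (x j) = 1 / b" using nn[OF that] xb[OF that] by (simp add: w_def)
        then show ?thesis using b1 by (simp add: ln_div)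
      qed
      have "(\<Sum>j<n. ln (w (x j))) = ln (w (x i)) + (\<Sum>j\<in>{..<n} - {i}. ln (w (x j)))"
        using i by (intro sum.remove) auto
      moreover have "(\<Sum>j\<in>{..<n} - {i}. - ln b) \<le> (\<Sum>j\<in>{..<n} - {i}. ln (w (x j)))"
        using lo by (intro sum_mono) auto
      moreover have "- (n * ln b) \<le> (\<Sum>j\<in>{..<n} - {i}. - ln b)"
        using lnb i by (simp add: mult_right_mono)
      moreover have "ln (w (x i)) = K" using i by (simp add: w_def)
      ultimately show ?thesis by linarith
    qed
    then have "n * L < (\<Sum>j<n. ln (w (x j)))"
      unfolding K_def using mult_left_mono[OF abs_ge_self[of L], of "real n"] by simp
    then have "L < (\<Sum>j<n. ln (w (x j))) / n" using n by (simp add: field_simps)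
    moreover have "empirical_loglik x n w = ereal ((\<Sum>j<n. ln (w (x j))) / n)"
      by (rule empirical_loglik_pos[OF n]) (rule wp)
    ultimately have "empirical_loglik x n \<psi> < empirical_loglik x n w"
      using L by (auto intro: le_less_trans)
    then show False using am dd unfolding is_arg_max_def by blast
  qed
  then have "is_arg_max (empirical_loglik x n) decreasing_density = (\<lambda>\<psi>. False)" by auto
  then show ?thesis unfolding grenander_def arg_max_def by simp
qed

text \<open>On samples with positive entries the entropy is the continuous function
  \<open>max_loglik\<close>. On those with a negative entry, and on the remaining ones with a zero
  entry, the choice made by \<open>arg_max\<close> does not vary with the sample, so the entropy is
  constant.\<close>

lemma entropy_grenander_measurable:
  assumes X: "\<And>i. X i \<in> borel_measurable M"
  shows "(\<lambda>\<omega>. entropy_functional (grenander (\<lambda>i. X i \<omega>) n)) \<in> borel_measurable M"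
proof (cases "n = 0")
  case True
  have "grenander x 0 = grenander (\<lambda>_. 0) 0" for x
    unfolding grenander_def empirical_loglik_def by simp
  then have "(\<lambda>\<omega>. entropy_functional (grenander (\<lambda>i. X i \<omega>) n))
      = (\<lambda>\<omega>. entropy_functional (grenander (\<lambda>_. 0) 0))" unfolding True by metis
  then show ?thesis by simp
next
  case False
  then have n: "0 < n" by simp
  have [measurable]: "(\<lambda>x :: nat \<Rightarrow> real. x i) \<in> borel_measurable borel" for i
    by (intro borel_measurable_continuous_onI continuous_on_product_coordinates)
  let ?P = "{x :: nat \<Rightarrow> real. \<forall>i\<in>{..<n}. 0 < x i}"
  have [measurable]: "?P \<in> sets borel" "{x :: nat \<Rightarrow> real. \<exists>i\<in>{..<n}. x i < 0} \<in> sets borel" by measurable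
  have [measurable]: "(\<lambda>x. if x \<in> ?P then max_loglik x n else 0) \<in> borel_measurable borel"
    by (intro borel_measurable_continuous_on_if continuous_on_max_loglik n) auto
  have eq: "entropy_functional (grenander x n) = (if x \<in> ?P then (if x \<in> ?P then max_loglik x n else 0)
      else if x \<in> {x. \<exists>i\<in>{..<n}. x i < 0} then entropy_functional (SOME \<psi>. decreasing_density \<psi>)
      else entropy_functional (SOME \<psi>. False))" for x
  proof -
    consider "x \<in> ?P" | "x \<notin> ?P" "\<exists>i<n. x i < 0" | "x \<notin> ?P" "\<forall>i<n. 0 \<le> x i" by (force simp: not_less)
    then show ?thesis
    proof cases
      case 1
      then show ?thesis using entropy_grenander[OF n, of x] by auto
    next
      case 2
      then show ?thesis using grenander_neg[of _ n x] by auto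
    next
      case 3
      then obtain i where "i < n" "x i = 0" by (auto simp: not_less intro: antisym)
      then show ?thesis using 3 grenander_zero[of i n x] by auto
    qed
  qed
  have "(\<lambda>x. entropy_functional (grenander x n)) \<in> borel_measurable borel"
    unfolding eq by measurable
  moreover have "(\<lambda>\<omega> i. X i \<omega>) \<in> borel_measurable M"
    using X by (rule measurable_coordinatewise_then_product)
  ultimately show ?thesis by (rule measurable_compose[rotated])
qed

section \<open>The excess log-likelihood\<close>

text \<open>The geometric mean of 1 and \<open>r\<close> is at most their arithmetic mean. The new
  bound stays above 2 ln (1 / 2), whereas ln r is unbounded below and its square could not be
  controlled.\<close>

lemma ln_le_twice_ln_mean:
  assumes "0 < (r::real)"
  shows "ln r \<le> 2 * ln ((1 + r) / 2)"
proof -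
  have "0 \<le> (1 - r)\<^sup>2" by simp
  then have "r \<le> ((1 + r) / 2)\<^sup>2" by (simp add: power2_eq_square field_simps)
  then have "ln r \<le> ln (((1 + r) / 2)\<^sup>2)" using assms by (subst ln_le_cancel_iff) auto
  also have "\<dots> = 2 * ln ((1 + r) / 2)" using assms by (simp add: ln_realpow)
  finally show ?thesis .
qed

lemma ln_le_hellinger:
  assumes "0 < (y::real)"
  shows "ln y \<le> (y - 1) - (sqrt y - 1)\<^sup>2"
proof -
  have "ln y = 2 * ln (sqrt y)" using assms by (simp add: ln_sqrt)
  also have "\<dots> \<le> 2 * (sqrt y - 1)" using assms by (intro mult_left_mono ln_le_minus_one) auto
  also have "\<dots> = (y - 1) - (sqrt y - 1)\<^sup>2" using assms by (simp add: power2_diff)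
  finally show ?thesis .
qed

text \<open>With s = sqrt y a factor 4 comes from ln y = 2 ln s, and for s < 1 a factor 2 from - ln
  s <= (1 - s) / s and s^2 = y >= 1 / 2. Mixing the estimator with the projection is what provides
  the lower bound 1 / 2.\<close>

lemma ln_square_le_hellinger:
  assumes y: "1 / 2 \<le> (y::real)"
  shows "(ln y)\<^sup>2 \<le> 8 * (sqrt y - 1)\<^sup>2"
proof -
  define s where "s = sqrt y"
  have s: "0 < s" "s\<^sup>2 = y" unfolding s_def using y by auto
  have ln: "ln y = 2 * ln s" unfolding s_def using y by (simp add: ln_sqrt)
  have "(ln s)\<^sup>2 \<le> 2 * (s - 1)\<^sup>2"
  proof (cases "1 \<le> s")
    case True
    then have "(ln s)\<^sup>2 \<le> (s - 1)\<^sup>2"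
      using ln_le_minus_one[of s] by (intro power_mono) auto
    then show ?thesis by (simp add: order_trans[OF _ mult_right_mono[of 1 2]])
  next
    case False
    have "- ln s = ln (1 / s)" using s by (simp add: ln_div)
    also have "\<dots> \<le> 1 / s - 1" using s by (intro ln_le_minus_one) simp
    also have "\<dots> = (1 - s) / s" using s by (simp add: field_simps)
    finally have le: "- ln s \<le> (1 - s) / s" .
    have "ln s \<le> 0" using False s by simp
    then have "(ln s)\<^sup>2 \<le> ((1 - s) / s)\<^sup>2"
      using le by (subst power2_minus[of "ln s", symmetric], intro power_mono) auto
    also have "\<dots> = (1 - s)\<^sup>2 / y" by (simp add: power_divide s)
    also have "\<dots> \<le> (1 - s)\<^sup>2 / (1 / 2)" using y by (intro divide_left_mono) auto
    also have "\<dots> = 2 * (s - 1)\<^sup>2" by (simp add: power2_commute)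
    finally show ?thesis .
  qed
  then show ?thesis unfolding ln s_def[symmetric] by (simp add: power_mult_distrib)
qed

text \<open>If |d| exceeds \<open>\<eta>\<close>, then |d|^3 exceeds the cube of
  \<open>\<eta>\<close>. The bound trades a maximum over cells for a sum of fourth powers.\<close>

lemma abs_le_fourth_power:
  assumes "0 < (\<eta>::real)"
  shows "\<bar>d\<bar> \<le> \<eta> + d ^ 4 / \<eta> ^ 3"
proof (cases "\<bar>d\<bar> \<le> \<eta>")
  case False
  have "\<bar>d\<bar> * \<eta> ^ 3 \<le> \<bar>d\<bar> * \<bar>d\<bar> ^ 3" using False assms by (intro mult_left_mono power_mono) auto
  also have "\<dots> = d ^ 4" by (simp add: power_numeral_reduce flip: abs_mult)
  finally have "\<bar>d\<bar> \<le> d ^ 4 / \<eta> ^ 3" using assms by (simp add: le_divide_eq)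
  then show ?thesis using assms by simp
qed (use assms in \<open>simp add: add_increasing2\<close>)

text \<open>\<open>k\<close> is a quarter of the binary logarithm of \<open>n\<close>, rounded up.
  The cells of the last scale 4 k have mass at most 1 / n, and 2 <= n makes \<open>k\<close>
  positive, so that there is a finer scale to chain through.\<close>

lemma dyadic_scale:
  assumes n: "2 \<le> n"
  obtains k :: nat where "1 \<le> k" "2 ^ k \<le> 2 * real n powr (1/4)" "real n powr (1/4) \<le> 2 ^ k"
    "real n \<le> 2 ^ (k + 3 * k)" "real (3 * k) \<le> 3 * (ln n / ln 2 / 4 + 1)"
proof
  define z where "z = ln (real n) / ln 2 / 4"
  define k where "k = nat \<lceil>z\<rceil>"
  have z: "0 < z" unfolding z_def using n by simp
  have k: "z \<le> k" "k \<le> z + 1" unfolding k_def using z by linarith+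
  have nz: "real n powr (1/4) = 2 powr z" unfolding powr_def z_def using n by simp
  have pk: "2 ^ k = (2::real) powr k" by (simp add: powr_realpow)
  show "1 \<le> k" unfolding k_def using z by simp linarith
  have "2 powr k \<le> (2::real) powr (z + 1)" using k by (intro powr_mono) auto
  then show "2 ^ k \<le> 2 * real n powr (1/4)" unfolding pk nz by (simp add: powr_add mult.commute)
  show le: "real n powr (1/4) \<le> 2 ^ k" unfolding pk nz using k by (intro powr_mono) auto
  have "real n = (real n powr (1/4)) ^ 4" using n by (simp add: powr_power)
  also have "\<dots> \<le> (2 ^ k) ^ 4" using le by (intro power_mono) auto
  also have "\<dots> = 2 ^ (k + 3 * k)" by (simp flip: power_mult add: mult.commute)
  finally show "real n \<le> 2 ^ (k + 3 * k)" .
  show "real (3 * k) \<le> 3 * (ln n / ln 2 / 4 + 1)" using k unfolding z_def by simp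
qed

text \<open>The bound of \<open>prob_excess_le\<close> below for sample size \<open>x = n\<close>, with scales \<open>2 ^ k \<approx> n powr (1/4)\<close> and
  \<open>r = 3 * k\<close>, truncation level \<open>e = 1 / n\<^sup>2\<close> and \<open>\<eta> = n powr (-17/32)\<close>; any exponent strictly
  between \<open>-7/12\<close> and \<open>-1/2\<close> would do for \<open>\<eta>\<close>.\<close>

definition excess_rate :: "real \<Rightarrow> real \<Rightarrow> real \<Rightarrow> real \<Rightarrow> real" where
  "excess_rate C b d x = x * ((C + b) * (1 / x\<^sup>2)) + sqrt x * (2 * (2 * (2 * x powr (1/4)) / x
      + (ln (x\<^sup>2 + C + 1 / x\<^sup>2) - ln (1 / (2 * x\<^sup>2))) * (4 * (3 * (ln x / ln 2 / 4 + 1)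
        * (x powr (-17/32) + (3 / x powr (1/4) / x\<^sup>2 + 1 / x ^ 3) / (x powr (-17/32)) ^ 3))
      + 2 * (x powr (-17/32) + (3 / x powr (1/4) / x\<^sup>2 + 1 / x ^ 3) / (x powr (-17/32)) ^ 3 + 1 / x)))) / d"

lemma excess_rate_tendsto:
  assumes "0 \<le> C" "0 < b" "0 < d"
  shows "(excess_rate C b d \<longlongrightarrow> 0) at_top"
  unfolding excess_rate_def[abs_def] using assms by real_asymp

section \<open>Bounded slope and bounded support\<close>

locale bounded_hull = concave_hull \<mu> + continuous_distribution \<mu> for \<mu> +
  fixes C b :: real
  assumes g_le: "\<And>x. g x \<le> C" and b: "0 < b" and cdf_b: "cdf \<mu> b = 1"
begin

lemma C_nonneg: "0 \<le> C" using g_nonneg[of 0] g_le[of 0] by linarith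

lemma g_beyond: assumes "b < x" shows "g x = 0"
proof -
  have "1 \<le> H b" using F_le_H[of b] b cdf_b by simp
  then have "H x - H b \<le> 0" using H_le_1[of x] assms b by simp
  then have "(H x - H b) / (x - b) \<le> 0" using assms by (simp add: divide_le_0_iff)
  then have "g x \<le> 0" using g_le_slope[of b x] assms b by linarith
  then show ?thesis using g_nonneg[of x] by simp
qed

lemma measure_below: assumes "0 < e" shows "measure \<mu> {..<e} \<le> C * e"
proof -
  have "measure \<mu> {..<e} \<le> F e" unfolding cdf_def by (intro finite_measure_mono) auto
  also have "\<dots> \<le> H e" using F_le_H assms by simp
  also have "\<dots> = measure \<nu> {0<..e}" using measure_\<nu>_Ioc assms by simp
  also have "\<dots> \<le> C * e"
  proof -
    have "emeasure \<nu> {0<..e} = (\<integral>\<^sup>+x. ennreal (g x) * indicator {0<..e} x \<partial>lborel)"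
      by (simp add: emeasure_density)
    also have "\<dots> \<le> (\<integral>\<^sup>+x. ennreal C * indicator {0<..e} x \<partial>lborel)"
      by (intro nn_integral_mono mult_right_mono ennreal_leI g_le) simp
    also have "\<dots> = ennreal (C * e)"
      using assms C_nonneg by (simp add: nn_integral_cmult_indicator ennreal_mult)
    finally show ?thesis using assms C_nonneg by (simp add: N.emeasure_eq_measure)
  qed
  finally show ?thesis .
qed

text \<open>By equality in law the mass may be computed under \<open>\<nu>\<close>, where the set
  carries a density below \<open>e\<close> that vanishes beyond \<open>b\<close>.\<close>

lemma measure_g_below: assumes "0 < e" shows "measure \<mu> {x. g x < e} \<le> b * e"
proof -
  have "measure \<mu> {x. g x < e} = measure \<nu> {x. g x < e}" using measure_comp_g[of "{..<e}"] by simp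
  also have "\<dots> \<le> b * e"
  proof -
    have "emeasure \<nu> {x. g x < e} = (\<integral>\<^sup>+x. ennreal (g x) * indicator {x. g x < e} x \<partial>lborel)"
      by (simp add: emeasure_density)
    also have "\<dots> \<le> (\<integral>\<^sup>+x. ennreal e * indicator {0<..b} x \<partial>lborel)"
      using g_beyond g_nonpos
      by (intro nn_integral_mono) (auto intro!: ennreal_leI simp: not_le split: split_indicator)
    also have "\<dots> = ennreal (b * e)"
      using assms b by (simp add: nn_integral_cmult_indicator ennreal_mult mult.commute)
    finally show ?thesis using assms b by (simp add: N.emeasure_eq_measure)
  qed
  finally show ?thesis .
qed

text \<open>Passing to \<open>\<nu>\<close> turns the integrand into g (ln g)^2, which is bounded
  for slopes between 0 and \<open>C\<close> and vanishes off the bounded support.\<close>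

lemma integrable_ln_g_power2: "integrable \<mu> (\<lambda>x. (ln (g x))\<^sup>2)"
proof -
  have bd: "g x * (ln (g x))\<^sup>2 \<le> 4 + C ^ 3" for x
  proof -
    consider "g x = 0" | "0 < g x" "g x \<le> 1" | "1 < g x" using g_nonneg[of x] by linarith
    then show ?thesis
    proof cases
      case 1
      then show ?thesis using C_nonneg by simp
    next
      case 2
      \<comment> \<open>In terms of the square root the integrand is 4 (s ln s)^2, and |s ln s| is
        at most 1 for s <= 1.\<close>
      define s where "s = sqrt (g x)"
      have s: "0 < s" "s \<le> 1" "g x = s\<^sup>2" unfolding s_def using 2 by auto
      have "- ln s = ln (1 / s)" using s by (simp add: ln_div)
      also have "\<dots> \<le> 1 / s" using ln_le_minus_one[of "1 / s"] s by simp
      finally have "s * (- ln s) \<le> 1" using s by (simp add: field_simps)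
      moreover have "0 \<le> s * (- ln s)" using s by (simp add: mult_nonneg_nonpos)
      ultimately have "(s * (- ln s))\<^sup>2 \<le> 1" by (intro power_le_one)
      moreover have "g x * (ln (g x))\<^sup>2 = 4 * (s * (- ln s))\<^sup>2"
        using s(1) unfolding s(3) by (simp add: ln_realpow power_mult_distrib)
      ultimately have "g x * (ln (g x))\<^sup>2 \<le> 4" by simp
      then show ?thesis using C_nonneg by (simp add: add_increasing2)
    next
      case 3
      have "(ln (g x))\<^sup>2 \<le> (g x)\<^sup>2" using 3 ln_le_minus_one[of "g x"] by (intro power_mono) auto
      then have "g x * (ln (g x))\<^sup>2 \<le> g x * (g x)\<^sup>2" using 3 by (intro mult_left_mono) auto
      also have "\<dots> = (g x) ^ 3" by (simp add: power3_eq_cube power2_eq_square)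
      also have "\<dots> \<le> C ^ 3" using g_le g_nonneg by (intro power_mono)
      finally show ?thesis by simp
    qed
  qed
  have "integrable lborel (\<lambda>x. g x * (ln (g x))\<^sup>2)"
  proof (rule Bochner_Integration.integrable_bound)
    show "integrable lborel (\<lambda>x. (4 + C ^ 3) * indicator {0<..b} x)" using b by simp
    have "norm (g x * (ln (g x))\<^sup>2) \<le> norm ((4 + C ^ 3) * indicator {0<..b} x)" for x
      using bd[of x] g_nonneg[of x] g_beyond[of x] g_nonpos[of x] C_nonneg
      by (cases "x \<in> {0<..b}") (auto simp: not_le)
    then show "AE x in lborel. norm (g x * (ln (g x))\<^sup>2) \<le> norm ((4 + C ^ 3) * indicator {0<..b} x)"
      by simp
  qed measurable
  then have "integrable \<nu> (\<lambda>x. (ln (g x))\<^sup>2)"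
    using g_nonneg by (subst integrable_density) auto
  then show ?thesis using integral_comp_g(2)[of "\<lambda>y. (ln y)\<^sup>2"] by simp
qed

text \<open>The comparison function \<open>h = u - v = ln ((ghat + g') / (2 * g'))\<close>, with \<open>g' = max g e\<close>,
  is a difference of bounded decreasing functions; the terms in the Hellinger-type distance
  \<open>D\<close> cancel, so that only the oscillation of the empirical process remains.\<close>

lemma max_loglik_excess:
  assumes n: "0 < n" and e: "0 < e"
    and xe: "\<And>i. i < n \<Longrightarrow> e \<le> x i" and ge: "\<And>i. i < n \<Longrightarrow> e \<le> g (x i)"
    and m: "\<And>l j. k < l \<Longrightarrow> l \<le> k + r \<Longrightarrow> j < 2 ^ l \<Longrightarrow> \<bar>dev (empirical x n) l j\<bar> \<le> m l" and r: "0 < r"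
  defines "L \<equiv> (\<Sum>i<n. ln (g (x i))) / n"
  shows "L \<le> max_loglik x n"
    and "max_loglik x n \<le> L + 2 * (2 * 2 ^ k * (\<Sum>j<2 ^ k. (dev (empirical x n) k j)\<^sup>2)
      + (ln (1 / e + C + e) - ln (e / 2)) * (4 * (\<Sum>l\<in>{k<..k + r}. m l) + 2 * (m (k + r) + 1 / 2 ^ (k + r))))"
proof -
  have pos: "0 < x i" if "i < n" for i using xe[OF that] e by simp
  interpret E: concave_hull "empirical x n" by (rule concave_hull_empirical[OF n pos])
  let ?E = "empirical x n"
  have gp: "0 < g (x i)" if "i < n" for i using ge[OF that] e by simp
  have hp: "0 < E.g (x i)" if "i < n" for i by (rule ghat_pos[OF n pos that])
  have "(\<Sum>i<n. ln (g (x i))) \<le> (\<Sum>i<n. ln (E.g (x i)))"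
    by (rule ghat_maximal(1)[OF n pos decreasing_density_g gp])
  then show "L \<le> max_loglik x n" unfolding L_def max_loglik_def by (simp add: divide_right_mono)
  \<comment> \<open>No observation lies below \<open>e\<close>, so the line through the origin with
    slope 1 / e majorizes the empirical distribution function and thereby bounds the hull
    slope.\<close>
  have hb: "E.g t \<le> 1 / e" if t: "0 < t" for t
  proof -
    have maj: "E.majorant (\<lambda>t. t / e)"
    proof (intro conjI allI impI)
      show "concave_on {0..} (\<lambda>t. t / e)" using e by (intro concave_on_cdiv) (auto simp: concave_on_ident)
      fix s :: real assume s: "0 \<le> s"
      show "cdf ?E s \<le> s / e"
      proof (cases "s < e")
        case True
        then have "cdf ?E s = 0"
          unfolding cdf_def using n xe by (fastforce simp: measure_empirical indicator_def intro!: sum.neutral)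
        then show ?thesis using s e by simp
      next
        case False
        then have "1 \<le> s / e" using e by simp
        then show ?thesis using E.cdf_bounded_prob[of s] by linarith
      qed
    qed
    have "E.g t \<le> (E.H t - E.H 0) / t" using t E.g_le_slope[of 0 t] by simp
    also have "\<dots> \<le> (t / e) / t" using t E.H_le[OF maj, of t] E.H_nonneg[of 0] by (intro divide_right_mono) auto
    finally show ?thesis using t by simp
  qed
  define g' where "g' t = max (g t) e" for t
  have g': "0 < g' t" "e \<le> g' t" "g' t \<le> C + e" for t
    unfolding g'_def using e g_le[of t] C_nonneg by (auto simp: less_max_iff_disj)
  have [measurable]: "g' \<in> borel_measurable borel" unfolding g'_def by measurable
  have g'x: "g' (x i) = g (x i)" if "i < n" for i unfolding g'_def using ge[OF that] by simp
  have g'dec: "g' t \<le> g' s" if "0 < s" "s \<le> t" for s t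
    unfolding g'_def using g_antimono[OF that] by (intro max.mono) auto
  define \<alpha> where "\<alpha> = ln (e / 2)"
  define \<beta> where "\<beta> = ln (1 / e + C + e)"
  \<comment> \<open>Chaining asks for monotonicity on the whole line, but hull slopes are set to 0
    at nonpositive points. Upper bounds of the functions are put there instead, on a null set of
    both measures.\<close>
  define u where "u t = (if t \<le> 0 then ln ((1 / e + C + e) / 2) else ln ((E.g t + g' t) / 2))" for t
  define v where "v t = (if t \<le> 0 then ln (C + e) else ln (g' t))" for t
  have ce: "0 < C + e" "0 < 1 / e" using C_nonneg e by auto
  have half: "(1 / e + C + e) / 2 \<le> 1 / e + C + e" "0 < (1 / e + C + e) / 2"
  proof -
    have "a / 2 \<le> a" "0 < a / 2" if "0 < a" for a :: real using that by simp_all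
    from this[of "1 / e + C + e"] show "(1 / e + C + e) / 2 \<le> 1 / e + C + e" "0 < (1 / e + C + e) / 2"
      using add_pos_pos[OF ce(2,1)] by (simp_all add: add.assoc)
  qed
  have sum_b: "e / 2 \<le> (E.g t + g' t) / 2" "(E.g t + g' t) / 2 \<le> (1 / e + C + e) / 2" if "0 < t" for t
    using E.g_nonneg[of t] hb[OF that] g'[of t] by auto
  have u: "antimono u" "\<And>t. \<alpha> \<le> u t" "\<And>t. u t \<le> \<beta>"
  proof -
    have "u t \<le> u s" if "s \<le> t" for s t
    proof (cases "t \<le> 0")
      case False
      have p: "0 < (E.g t + g' t) / 2" using sum_b(1)[of t] False e by linarith
      show ?thesis
      proof (cases "s \<le> 0")
        case True
        then show ?thesis using False sum_b[of t] p by (simp add: u_def)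
      next
        case s: False
        have "(E.g t + g' t) / 2 \<le> (E.g s + g' s) / 2"
          using s that E.g_antimono[of s t] g'dec[of s t] by simp
        then show ?thesis using False s p unfolding u_def by simp
      qed
    qed (use that in \<open>simp add: u_def\<close>)
    then show "antimono u" by (auto simp: antimono_def)
    show "\<alpha> \<le> u t" for t
    proof (cases "t \<le> 0")
      case True
      have "e / 2 \<le> (1 / e + C + e) / 2" using C_nonneg ce by simp
      then show ?thesis unfolding u_def \<alpha>_def using True e by simp
    next
      case False
      then show ?thesis unfolding u_def \<alpha>_def using sum_b(1)[of t] e by simp
    qed
    show "u t \<le> \<beta>" for t
    proof (cases "t \<le> 0")
      case True
      then show ?thesis unfolding u_def \<beta>_def using half by (subst if_P) (auto intro!: ln_mono)
    next
      case False
      then have "0 < (E.g t + g' t) / 2" "(E.g t + g' t) / 2 \<le> 1 / e + C + e"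
        using less_le_trans[OF half_gt_zero[OF e] sum_b(1)[of t]] order_trans[OF sum_b(2)[of t] half(1)]
        by simp_all
      then show ?thesis unfolding u_def \<beta>_def using False by simp
    qed
  qed
  have v: "antimono v" "\<And>t. \<alpha> \<le> v t" "\<And>t. v t \<le> \<beta>"
  proof -
    have "v t \<le> v s" if "s \<le> t" for s t
      using that g'(1)[of t] g'(3)[of t] g'dec[of s t] g'(1)[of s] unfolding v_def by auto
    then show "antimono v" by (auto simp: antimono_def)
    show "\<alpha> \<le> v t" for t
    proof -
      have "e / 2 \<le> C + e" "e / 2 \<le> g' t" using e C_nonneg g'(2)[of t] by linarith+
      then show ?thesis unfolding v_def \<alpha>_def using e by simp
    qed
    show "v t \<le> \<beta>" for t
    proof -
      have "C + e \<le> 1 / e + C + e" "g' t \<le> 1 / e + C + e" using g'(3)[of t] ce by linarith+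
      then show ?thesis unfolding v_def \<beta>_def using ce g'(1)[of t] by simp
    qed
  qed
  define y where "y t = (E.g t + g' t) / (2 * g' t)" for t
  have y_eq: "y t = 1 / 2 + (E.g t / g' t) / 2" for t
    using g'(1)[of t] unfolding y_def by (simp add: field_simps)
  have y_half: "1 / 2 \<le> y t" for t unfolding y_eq using g'(1)[of t] E.g_nonneg[of t] by simp
  have uv: "u t - v t = ln (y t)" if "0 < t" for t
  proof -
    have "0 < E.g t + g' t" using g'(1)[of t] E.g_nonneg[of t] by linarith
    then show ?thesis unfolding u_def v_def y_def using that g'(1)[of t] by (simp add: ln_div ln_mult)
  qed
  have ratio_b: "E.g t / g' t \<le> 1 / e / e" if "0 < t" for t
    using hb[OF that] g'(2)[of t] e E.g_nonneg[of t] by (intro frac_le) auto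
  have ratio_int: "integrable \<mu> (\<lambda>t. E.g t / g' t)"
  proof (rule integrable_const_bound[of _ "1 / e / e"])
    show "AE t in \<mu>. norm (E.g t / g' t) \<le> 1 / e / e"
      using AE_pos(1) by eventually_elim (use ratio_b g'(1) E.g_nonneg in \<open>auto simp: abs_of_nonneg less_imp_le\<close>)
  qed simp
  \<comment> \<open>The ratio inequality for the hull of the true distribution, with the estimator
    in the role of the decreasing density.\<close>
  have "ennreal (\<integral>t. E.g t / g' t \<partial>\<mu>) = (\<integral>\<^sup>+t. ennreal (E.g t / g' t) \<partial>\<mu>)"
    using g'(1) E.g_nonneg by (intro nn_integral_eq_integral[symmetric] ratio_int) (simp add: less_imp_le)
  also have "\<dots> \<le> 1"
    unfolding g'_def by (rule nn_integral_ratio_le_1[OF E.decreasing_density_g e])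
  finally have ratio_le: "(\<integral>t. E.g t / g' t \<partial>\<mu>) \<le> 1" by simp
  have y_int: "integrable \<mu> y" unfolding y_eq using ratio_int by (intro Bochner_Integration.integrable_add integrable_divide) auto
  have y_le: "(\<integral>t. y t \<partial>\<mu>) \<le> 1"
  proof -
    have "(\<integral>t. y t \<partial>\<mu>) = 1 / 2 + (\<integral>t. E.g t / g' t \<partial>\<mu>) / 2"
      unfolding y_eq using ratio_int prob_space by (simp del: divide_divide_eq_left)
    then show ?thesis using ratio_le by simp
  qed
  \<comment> \<open>\<open>q\<close> is the integrand of the distance D. From ln y <= (y - 1) - q
    and (ln y)^2 <= 8 q, the mean of \<open>h\<close> contributes at most - D and one eighth of its
    second moment at most + D.\<close>
  define q where "q t = (sqrt (y t) - 1)\<^sup>2" for t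
  have [measurable]: "y \<in> borel_measurable borel" unfolding y_def by measurable
  have [measurable]: "q \<in> borel_measurable borel" unfolding q_def by measurable
  have q_int: "integrable \<mu> q"
  proof (rule Bochner_Integration.integrable_bound[of _ "\<lambda>t. y t + 1"])
    show "integrable \<mu> (\<lambda>t. y t + 1)" using y_int by simp
    have "norm (q t) \<le> norm (y t + 1)" for t
    proof -
      have "q t = y t + 1 - 2 * sqrt (y t)"
        using y_half[of t] by (simp add: q_def power2_diff)
      moreover have "0 \<le> q t" "0 \<le> sqrt (y t)" using y_half[of t] by (simp_all add: q_def)
      ultimately show ?thesis by simp
    qed
    then show "AE t in \<mu>. norm (q t) \<le> norm (y t + 1)" by simp
  qed simp
  have iu: "integrable \<mu> u" "integrable \<mu> v"
    by (rule antimono_integrable[OF real_distribution_axioms u])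
      (rule antimono_integrable[OF real_distribution_axioms v])
  note [measurable] = borel_measurable_integrable[OF iu(1)] borel_measurable_integrable[OF iu(2)]
  have "(\<integral>t. u t - v t \<partial>\<mu>) \<le> (\<integral>t. (y t - 1) - q t \<partial>\<mu>)"
  proof (rule integral_mono_AE)
    show "AE t in \<mu>. u t - v t \<le> (y t - 1) - q t"
      using AE_pos(1)
    proof eventually_elim
      case (elim t)
      have "0 < y t" using y_half[of t] by linarith
      then show ?case using ln_le_hellinger[of "y t"] uv[OF elim] unfolding q_def by simp
    qed
  qed (use iu y_int q_int in auto)
  also have "\<dots> = (\<integral>t. y t \<partial>\<mu>) - 1 - (\<integral>t. q t \<partial>\<mu>)"
    using y_int q_int prob_space by simp
  finally have h_mean: "(\<integral>t. u t - v t \<partial>\<mu>) \<le> - (\<integral>t. q t \<partial>\<mu>)" using y_le by simp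
  have "(\<integral>t. (u t - v t)\<^sup>2 \<partial>\<mu>) \<le> (\<integral>t. 8 * q t \<partial>\<mu>)"
  proof (rule integral_mono_AE')
    show "AE t in \<mu>. (u t - v t)\<^sup>2 \<le> 8 * q t"
      using AE_pos(1)
      by eventually_elim (use ln_square_le_hellinger[OF y_half] uv in \<open>auto simp: q_def\<close>)
  qed (use q_int in simp, simp add: q_def)
  then have h_sq: "(\<integral>t. (u t - v t)\<^sup>2 \<partial>\<mu>) / 8 \<le> (\<integral>t. q t \<partial>\<mu>)" by simp
  have mu: "u \<in> borel_measurable borel" "v \<in> borel_measurable borel"
    using borel_measurable_integrable[OF iu(1)] borel_measurable_integrable[OF iu(2)] by simp_all
  have "max_loglik x n - L = (\<Sum>i<n. ln (E.g (x i)) - ln (g (x i))) / n"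
    unfolding L_def max_loglik_def by (simp add: sum_subtractf diff_divide_distrib)
  also have "\<dots> \<le> (\<Sum>i<n. 2 * (u (x i) - v (x i))) / n"
  proof (intro divide_right_mono sum_mono)
    fix i assume "i \<in> {..<n}"
    then have i: "i < n" by simp
    have "ln (E.g (x i)) - ln (g (x i)) = ln (E.g (x i) / g (x i))"
      using hp[OF i] gp[OF i] by (simp add: ln_div)
    also have "\<dots> \<le> 2 * ln ((1 + E.g (x i) / g (x i)) / 2)"
      using hp[OF i] gp[OF i] by (intro ln_le_twice_ln_mean) simp
    also have "(1 + E.g (x i) / g (x i)) / 2 = y (x i)"
      unfolding y_eq g'x[OF i] by (simp add: add_divide_distrib)
    finally show "ln (E.g (x i)) - ln (g (x i)) \<le> 2 * (u (x i) - v (x i))"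
      using uv[OF pos[OF i]] by simp
  qed simp
  also have "\<dots> = 2 * (\<integral>t. u t - v t \<partial>?E)"
    using integral_empirical[OF n, of "\<lambda>t. u t - v t" x] mu by (simp add: sum_distrib_left)
  finally have 1: "max_loglik x n - L \<le> 2 * (\<integral>t. u t - v t \<partial>?E)" .
  have "(\<integral>t. u t - v t \<partial>?E) - (\<integral>t. u t - v t \<partial>\<mu>)
    \<le> (\<integral>t. (u t - v t)\<^sup>2 \<partial>\<mu>) / 8 + 2 * 2 ^ k * (\<Sum>j<2 ^ k. (dev ?E k j)\<^sup>2)
      + (\<beta> - \<alpha>) * (4 * (\<Sum>l\<in>{k<..k + r}. m l) + 2 * (m (k + r) + 1 / 2 ^ (k + r)))"
    by (rule chaining[OF real_distribution_empirical u v m r])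
  then have "(\<integral>t. u t - v t \<partial>?E) \<le> 2 * 2 ^ k * (\<Sum>j<2 ^ k. (dev ?E k j)\<^sup>2)
      + (\<beta> - \<alpha>) * (4 * (\<Sum>l\<in>{k<..k + r}. m l) + 2 * (m (k + r) + 1 / 2 ^ (k + r)))"
    using h_mean h_sq by linarith
  moreover have "a \<le> c + 2 * q" if "a - c \<le> 2 * p" "p \<le> q" for a c p q :: real using that by linarith
  ultimately show "max_loglik x n \<le> L + 2 * (2 * 2 ^ k * (\<Sum>j<2 ^ k. (dev ?E k j)\<^sup>2)
      + (ln (1 / e + C + e) - ln (e / 2)) * (4 * (\<Sum>l\<in>{k<..k + r}. m l) + 2 * (m (k + r) + 1 / 2 ^ (k + r))))"
    unfolding \<alpha>_def[symmetric] \<beta>_def[symmetric] using 1 by blast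
qed

text \<open>A simultaneous bound for all deviations of scale \<open>l\<close>. It uses a sum where a
  maximum would be natural, so that its expectation is explicit from fourth moments.\<close>

definition fluctuation :: "(nat \<Rightarrow> real) \<Rightarrow> nat \<Rightarrow> real \<Rightarrow> nat \<Rightarrow> real" where
  "fluctuation x n \<eta> l = \<eta> + (\<Sum>j<2 ^ l. (dev (empirical x n) l j) ^ 4) / \<eta> ^ 3"

lemma dev_le_fluctuation:
  assumes "0 < \<eta>" "j < 2 ^ l"
  shows "\<bar>dev (empirical x n) l j\<bar> \<le> fluctuation x n \<eta> l"
proof -
  have "(dev (empirical x n) l j) ^ 4 \<le> (\<Sum>j<2 ^ l. (dev (empirical x n) l j) ^ 4)"
    using assms(2) by (intro member_le_sum) auto
  then have "(dev (empirical x n) l j) ^ 4 / \<eta> ^ 3 \<le> (\<Sum>j<2 ^ l. (dev (empirical x n) l j) ^ 4) / \<eta> ^ 3"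
    using assms(1) by (intro divide_right_mono) auto
  then show ?thesis
    unfolding fluctuation_def using abs_le_fourth_power[OF assms(1), of "dev (empirical x n) l j"] by linarith
qed

section \<open>Expectation and probability bounds for an i.i.d. sample\<close>

context
  fixes M :: "'a measure" and X :: "nat \<Rightarrow> 'a \<Rightarrow> real"
  assumes M: "prob_space M" and indep: "prob_space.indep_vars M (\<lambda>_. borel) X UNIV"
    and law: "\<And>i. distr M borel (X i) = \<mu>"
begin

interpretation M: prob_space M by (rule M)

lemma X_measurable [measurable]: "X i \<in> borel_measurable M"
  using indep unfolding M.indep_vars_def2 by auto

lemma prob_X: assumes [measurable]: "A \<in> sets borel" shows "M.prob {\<omega>\<in>space M. X i \<omega> \<in> A} = measure \<mu> A"
  unfolding law[of i, symmetric] by (simp add: measure_distr vimage_def Int_def conj_commute)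

lemma dev_moments:
  assumes n: "0 < n" and j: "j < 2 ^ l"
  shows "M.expectation (\<lambda>\<omega>. (dev (empirical (\<lambda>i. X i \<omega>) n) l j)\<^sup>2) \<le> 1 / 2 ^ l / n"
    and "M.expectation (\<lambda>\<omega>. (dev (empirical (\<lambda>i. X i \<omega>) n) l j) ^ 4) \<le> 3 * (1 / 2 ^ l)\<^sup>2 / (real n)\<^sup>2 + 1 / 2 ^ l / real n ^ 3"
    and "integrable M (\<lambda>\<omega>. (dev (empirical (\<lambda>i. X i \<omega>) n) l j) ^ a)"
proof -
  have A: "Cell l j \<in> sets borel" by measurable
  note m = M.empirical_moments[OF indep law n A, unfolded measure_Cell[OF j]]
  show "M.expectation (\<lambda>\<omega>. (dev (empirical (\<lambda>i. X i \<omega>) n) l j)\<^sup>2) \<le> 1 / 2 ^ l / n" by (rule m(1))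
  show "M.expectation (\<lambda>\<omega>. (dev (empirical (\<lambda>i. X i \<omega>) n) l j) ^ 4) \<le> 3 * (1 / 2 ^ l)\<^sup>2 / (real n)\<^sup>2 + 1 / 2 ^ l / real n ^ 3"
    by (rule m(2))
  show "integrable M (\<lambda>\<omega>. (dev (empirical (\<lambda>i. X i \<omega>) n) l j) ^ a)"
    using m(3,4) by (intro M.integrable_bounded[of _ 1] borel_measurable_power)
      (auto simp: power_abs intro!: power_le_one)
qed

lemma sum_dev_square:
  assumes n: "0 < n"
  shows "M.expectation (\<lambda>\<omega>. \<Sum>j<2 ^ l. (dev (empirical (\<lambda>i. X i \<omega>) n) l j)\<^sup>2) \<le> 1 / n"
    and "integrable M (\<lambda>\<omega>. \<Sum>j<2 ^ l. (dev (empirical (\<lambda>i. X i \<omega>) n) l j)\<^sup>2)"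
proof -
  show "integrable M (\<lambda>\<omega>. \<Sum>j<2 ^ l. (dev (empirical (\<lambda>i. X i \<omega>) n) l j)\<^sup>2)"
    using dev_moments(3)[OF n, of _ l 2] by (intro Bochner_Integration.integrable_sum) auto
  have "M.expectation (\<lambda>\<omega>. \<Sum>j<2 ^ l. (dev (empirical (\<lambda>i. X i \<omega>) n) l j)\<^sup>2)
      = (\<Sum>j<2 ^ l. M.expectation (\<lambda>\<omega>. (dev (empirical (\<lambda>i. X i \<omega>) n) l j)\<^sup>2))"
    using dev_moments(3)[OF n, of _ l 2] by (intro Bochner_Integration.integral_sum) auto
  also have "\<dots> \<le> (\<Sum>j<(2::nat) ^ l. 1 / 2 ^ l / n)" using dev_moments(1)[OF n] by (intro sum_mono) auto
  also have "\<dots> = 1 / n" by simp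
  finally show "M.expectation (\<lambda>\<omega>. \<Sum>j<2 ^ l. (dev (empirical (\<lambda>i. X i \<omega>) n) l j)\<^sup>2) \<le> 1 / n" .
qed

lemma fluctuation_mean:
  assumes n: "0 < n" and \<eta>: "0 < \<eta>"
  shows "M.expectation (\<lambda>\<omega>. fluctuation (\<lambda>i. X i \<omega>) n \<eta> l) \<le> \<eta> + (3 / 2 ^ l / (real n)\<^sup>2 + 1 / real n ^ 3) / \<eta> ^ 3"
    and "integrable M (\<lambda>\<omega>. fluctuation (\<lambda>i. X i \<omega>) n \<eta> l)"
proof -
  have i: "integrable M (\<lambda>\<omega>. \<Sum>j<2 ^ l. (dev (empirical (\<lambda>i. X i \<omega>) n) l j) ^ 4)"
    using dev_moments(3)[OF n, of _ l 4] by (intro Bochner_Integration.integrable_sum) auto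
  then show "integrable M (\<lambda>\<omega>. fluctuation (\<lambda>i. X i \<omega>) n \<eta> l)"
    unfolding fluctuation_def by (intro Bochner_Integration.integrable_add integrable_divide) auto
  have "M.expectation (\<lambda>\<omega>. \<Sum>j<2 ^ l. (dev (empirical (\<lambda>i. X i \<omega>) n) l j) ^ 4)
      = (\<Sum>j<2 ^ l. M.expectation (\<lambda>\<omega>. (dev (empirical (\<lambda>i. X i \<omega>) n) l j) ^ 4))"
    using dev_moments(3)[OF n, of _ l 4] by (intro Bochner_Integration.integral_sum) auto
  also have "\<dots> \<le> (\<Sum>j<(2::nat) ^ l. 3 * (1 / 2 ^ l)\<^sup>2 / (real n)\<^sup>2 + 1 / 2 ^ l / real n ^ 3)"
    using dev_moments(2)[OF n] by (intro sum_mono) auto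
  also have "\<dots> = 3 / 2 ^ l / (real n)\<^sup>2 + 1 / real n ^ 3"
    by (simp add: distrib_left power2_eq_square)
  finally have "M.expectation (\<lambda>\<omega>. \<Sum>j<2 ^ l. (dev (empirical (\<lambda>i. X i \<omega>) n) l j) ^ 4) / \<eta> ^ 3
      \<le> (3 / 2 ^ l / (real n)\<^sup>2 + 1 / real n ^ 3) / \<eta> ^ 3"
    using \<eta> by (intro divide_right_mono) auto
  moreover have "M.expectation (\<lambda>\<omega>. fluctuation (\<lambda>i. X i \<omega>) n \<eta> l)
      = \<eta> + M.expectation (\<lambda>\<omega>. \<Sum>j<2 ^ l. (dev (empirical (\<lambda>i. X i \<omega>) n) l j) ^ 4) / \<eta> ^ 3"
    unfolding fluctuation_def using i
    by (subst Bochner_Integration.integral_add) (auto simp: M.prob_space)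
  ultimately show "M.expectation (\<lambda>\<omega>. fluctuation (\<lambda>i. X i \<omega>) n \<eta> l) \<le> \<eta> + (3 / 2 ^ l / (real n)\<^sup>2 + 1 / real n ^ 3) / \<eta> ^ 3"
    by simp
qed

text \<open>Unless some observation lies below \<open>e\<close> or has slope below \<open>e\<close>,
  which has probability at most n (C + b) e, the deterministic bound
  \<open>max_loglik_excess\<close> applies with \<open>fluctuation\<close> as the bound on the
  deviations. Markov's inequality for the resulting random bound \<open>W\<close> gives the second
  term.\<close>

lemma prob_excess_le:
  fixes n k r :: nat and e \<eta> d B :: real
  assumes n: "0 < n" and e: "0 < e" "e < 2" and \<eta>: "0 < \<eta>" and r: "0 < r" and d: "0 < d"
  defines "B \<equiv> \<eta> + (3 / 2 ^ k / (real n)\<^sup>2 + 1 / real n ^ 3) / \<eta> ^ 3"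
  shows "M.prob {\<omega>\<in>space M. d < \<bar>sqrt n * (entropy_functional (grenander (\<lambda>i. X i \<omega>) n) - (\<Sum>i<n. ln (g (X i \<omega>))) / n)\<bar>}
    \<le> n * ((C + b) * e) + sqrt n * (2 * (2 * 2 ^ k / n
      + (ln (1 / e + C + e) - ln (e / 2)) * (4 * (r * B) + 2 * (B + 1 / 2 ^ (k + r))))) / d"
proof -
  define R where "R = ln (1 / e + C + e) - ln (e / 2)"
  have R: "0 \<le> R"
  proof -
    have "e / 2 \<le> 1 / e + C + e" using e C_nonneg by (simp add: add_increasing)
    then show ?thesis unfolding R_def using e by simp
  qed
  define m where "m \<omega> = fluctuation (\<lambda>i. X i \<omega>) n \<eta>" for \<omega>
  define W where "W \<omega> = 2 * (2 * 2 ^ k * (\<Sum>j<2 ^ k. (dev (empirical (\<lambda>i. X i \<omega>) n) k j)\<^sup>2)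
      + R * (4 * (\<Sum>l\<in>{k<..k + r}. m \<omega> l) + 2 * (m \<omega> (k + r) + 1 / 2 ^ (k + r))))" for \<omega>
  note im = fluctuation_mean(2)[OF n \<eta>, folded m_def] and isq = sum_dev_square(2)[OF n, of k]
  have mB: "M.expectation (\<lambda>\<omega>. m \<omega> l) \<le> B" if "k \<le> l" for l
  proof -
    have "3 / 2 ^ l \<le> 3 / (2 ^ k :: real)" using that by (intro divide_left_mono power_increasing) auto
    then have "(3 / 2 ^ l / (real n)\<^sup>2 + 1 / real n ^ 3) / \<eta> ^ 3 \<le> (3 / 2 ^ k / (real n)\<^sup>2 + 1 / real n ^ 3) / \<eta> ^ 3"
      using \<eta> by (intro divide_right_mono add_mono) auto
    then show ?thesis using fluctuation_mean(1)[OF n \<eta>, of l] unfolding B_def m_def by linarith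
  qed
  have iW: "integrable M W" unfolding W_def using im isq by simp
  have W0: "0 \<le> W \<omega>" for \<omega>
    unfolding W_def m_def fluctuation_def using R \<eta>
    by (intro mult_nonneg_nonneg add_nonneg_nonneg sum_nonneg divide_nonneg_nonneg) auto
  have "M.expectation W = 2 * (2 * 2 ^ k * M.expectation (\<lambda>\<omega>. \<Sum>j<2 ^ k. (dev (empirical (\<lambda>i. X i \<omega>) n) k j)\<^sup>2)
      + R * (4 * (\<Sum>l\<in>{k<..k + r}. M.expectation (\<lambda>\<omega>. m \<omega> l)) + 2 * (M.expectation (\<lambda>\<omega>. m \<omega> (k + r)) + 1 / 2 ^ (k + r))))"
    unfolding W_def using im isq by (simp add: M.prob_space)
  also have "\<dots> \<le> 2 * (2 * 2 ^ k * (1 / n) + R * (4 * (\<Sum>l\<in>{k<..k + r}. B) + 2 * (B + 1 / 2 ^ (k + r))))"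
    using sum_dev_square(1)[OF n, of k] mB R
    by (intro mult_left_mono add_mono sum_mono order_refl) auto
  finally have EW: "M.expectation W \<le> 2 * (2 * 2 ^ k / n + R * (4 * (r * B) + 2 * (B + 1 / 2 ^ (k + r))))"
    by simp
  define Z where "Z \<omega> = (\<Sum>i<n. ln (g (X i \<omega>))) / n" for \<omega>
  define A1 where "A1 = (\<Union>i<n. {\<omega>\<in>space M. X i \<omega> \<in> {..<e}} \<union> {\<omega>\<in>space M. X i \<omega> \<in> {y. g y < e}})"
  define A2 where "A2 = {\<omega>\<in>space M. d / sqrt n \<le> W \<omega>}"
  have [measurable]: "W \<in> borel_measurable M" using iW by simp
  have [measurable]: "A1 \<in> sets M" "A2 \<in> sets M" unfolding A1_def A2_def by measurable
  have "{\<omega>\<in>space M. d < \<bar>sqrt n * (entropy_functional (grenander (\<lambda>i. X i \<omega>) n) - Z \<omega>)\<bar>} \<subseteq> A1 \<union> A2"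
  proof
    fix \<omega> assume \<omega>: "\<omega> \<in> {\<omega>\<in>space M. d < \<bar>sqrt n * (entropy_functional (grenander (\<lambda>i. X i \<omega>) n) - Z \<omega>)\<bar>}"
    show "\<omega> \<in> A1 \<union> A2"
    proof (cases "\<omega> \<in> A1")
      case False
      then have xe: "e \<le> X i \<omega>" and ge: "e \<le> g (X i \<omega>)" if "i < n" for i
        using \<omega> that unfolding A1_def by (auto simp: not_less)
      have mm: "\<bar>dev (empirical (\<lambda>i. X i \<omega>) n) l j\<bar> \<le> m \<omega> l" if "j < 2 ^ l" for l j
        unfolding m_def by (rule dev_le_fluctuation[OF \<eta> that])
      have Z: "Z \<omega> \<le> max_loglik (\<lambda>i. X i \<omega>) n" "max_loglik (\<lambda>i. X i \<omega>) n \<le> Z \<omega> + W \<omega>"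
        using max_loglik_excess[of n e "\<lambda>i. X i \<omega>" k r "m \<omega>", OF n e(1) xe ge mm r]
        unfolding Z_def W_def R_def by auto
      have "entropy_functional (grenander (\<lambda>i. X i \<omega>) n) = max_loglik (\<lambda>i. X i \<omega>) n"
        using xe e by (intro entropy_grenander[OF n]) (auto intro: less_le_trans)
      then have "\<bar>sqrt n * (entropy_functional (grenander (\<lambda>i. X i \<omega>) n) - Z \<omega>)\<bar> \<le> sqrt n * W \<omega>"
        using Z by (simp add: abs_mult mult_left_mono)
      then have "d \<le> sqrt n * W \<omega>" using \<omega> by simp
      then have "d / sqrt n \<le> W \<omega>" using n by (simp add: divide_le_eq mult.commute)
      then show ?thesis using \<omega> unfolding A2_def by simp
    qed simp
  qed
  then have "M.prob {\<omega>\<in>space M. d < \<bar>sqrt n * (entropy_functional (grenander (\<lambda>i. X i \<omega>) n) - Z \<omega>)\<bar>} \<le> M.prob (A1 \<union> A2)"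
    by (intro M.finite_measure_mono) auto
  also have "\<dots> \<le> M.prob A1 + M.prob A2" by (intro measure_Un_le) auto
  also have "M.prob A1 \<le> (\<Sum>i<n. M.prob ({\<omega>\<in>space M. X i \<omega> \<in> {..<e}} \<union> {\<omega>\<in>space M. X i \<omega> \<in> {y. g y < e}}))"
    unfolding A1_def by (intro measure_UNION_le) auto
  also have "\<dots> \<le> (\<Sum>i<n. (C + b) * e)"
  proof (rule sum_mono)
    fix i
    have "M.prob ({\<omega>\<in>space M. X i \<omega> \<in> {..<e}} \<union> {\<omega>\<in>space M. X i \<omega> \<in> {y. g y < e}})
        \<le> M.prob {\<omega>\<in>space M. X i \<omega> \<in> {..<e}} + M.prob {\<omega>\<in>space M. X i \<omega> \<in> {y. g y < e}}"
      by (intro measure_Un_le) auto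
    also have "\<dots> = measure \<mu> {..<e} + measure \<mu> {y. g y < e}"
      using prob_X[of "{..<e}" i] prob_X[of "{y. g y < e}" i] by simp
    also have "\<dots> \<le> (C + b) * e"
      using measure_below[OF e(1)] measure_g_below[OF e(1)] by (simp add: distrib_right)
    finally show "M.prob ({\<omega>\<in>space M. X i \<omega> \<in> {..<e}} \<union> {\<omega>\<in>space M. X i \<omega> \<in> {y. g y < e}}) \<le> (C + b) * e" .
  qed
  also have "M.prob A2 \<le> M.expectation W / (d / sqrt n)"
    unfolding A2_def using iW W0 d n by (intro integral_Markov_inequality_measure[where A = "{}"]) auto
  also have "\<dots> \<le> 2 * (2 * 2 ^ k / n + R * (4 * (r * B) + 2 * (B + 1 / 2 ^ (k + r)))) / (d / sqrt n)"
    using EW d by (intro divide_right_mono) auto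
  finally show ?thesis unfolding Z_def R_def by (simp add: mult.commute)
qed

lemma excess_tendsto_0:
  assumes d: "0 < d"
  shows "(\<lambda>n. M.prob {\<omega>\<in>space M. d < \<bar>sqrt n * (entropy_functional (grenander (\<lambda>i. X i \<omega>) n) - (\<Sum>i<n. ln (g (X i \<omega>))) / n)\<bar>}) \<longlonglongrightarrow> 0"
proof (rule tendsto_sandwich[of "\<lambda>_. 0" _ _ "\<lambda>n. excess_rate C b d (real n)"])
  show "(\<lambda>n. excess_rate C b d (real n)) \<longlonglongrightarrow> 0"
    by (rule filterlim_compose[OF excess_rate_tendsto[OF C_nonneg b d] filterlim_real_sequentially])
  show "\<forall>\<^sub>F n in sequentially. M.prob {\<omega>\<in>space M. d < \<bar>sqrt n * (entropy_functional (grenander (\<lambda>i. X i \<omega>) n) - (\<Sum>i<n. ln (g (X i \<omega>))) / n)\<bar>} \<le> excess_rate C b d (real n)"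
    using eventually_ge_at_top[of 2]
  proof eventually_elim
    case (elim n)
    obtain k :: nat where k: "1 \<le> k" "2 ^ k \<le> 2 * real n powr (1/4)" "real n powr (1/4) \<le> 2 ^ k"
      "real n \<le> 2 ^ (k + 3 * k)" "real (3 * k) \<le> 3 * (ln n / ln 2 / 4 + 1)"
      by (rule dyadic_scale[OF elim])
    define x where "x = real n"
    have x: "2 \<le> x" using elim by (simp add: x_def)
    define e where "e = 1 / x\<^sup>2"
    define \<eta> where "\<eta> = x powr (-17/32)"
    define B where "B = \<eta> + (3 / 2 ^ k / x\<^sup>2 + 1 / x ^ 3) / \<eta> ^ 3"
    define B' where "B' = \<eta> + (3 / x powr (1/4) / x\<^sup>2 + 1 / x ^ 3) / \<eta> ^ 3"
    define R where "R = ln (x\<^sup>2 + C + 1 / x\<^sup>2) - ln (1 / (2 * x\<^sup>2))"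
    have "1 \<le> x\<^sup>2" using x by (simp add: one_le_power)
    then have e: "0 < e" "e < 2" unfolding e_def by (auto simp: divide_simps)
    have inv_e: "1 / e = x\<^sup>2" "e / 2 = 1 / (2 * x\<^sup>2)" unfolding e_def by simp_all
    have \<eta>: "0 < \<eta>" unfolding \<eta>_def using x by simp
    have R0: "0 \<le> R"
    proof -
      have x2: "0 < x\<^sup>2" using x by simp
      have "1 / (2 * x\<^sup>2) \<le> 1 / x\<^sup>2" using x2 by (intro divide_left_mono) auto
      also have "\<dots> \<le> x\<^sup>2 + C + 1 / x\<^sup>2" using C_nonneg x2 by simp
      finally have le: "1 / (2 * x\<^sup>2) \<le> x\<^sup>2 + C + 1 / x\<^sup>2" .
      have pos: "0 < 1 / (2 * x\<^sup>2)" using x2 by (intro divide_pos_pos mult_pos_pos) auto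
      have "ln (1 / (2 * x\<^sup>2)) \<le> ln (x\<^sup>2 + C + 1 / x\<^sup>2)"
        using le by (subst ln_le_cancel_iff[OF pos less_le_trans[OF pos le]])
      then show ?thesis unfolding R_def by (rule diff_ge_0_iff_ge[THEN iffD2])
    qed
    have B0: "0 \<le> B" unfolding B_def using \<eta> x by (intro add_nonneg_nonneg divide_nonneg_nonneg) auto
    have BB: "B \<le> B'"
    proof -
      have "3 / 2 ^ k \<le> 3 / x powr (1/4)"
        using k(3) x unfolding x_def[symmetric] by (intro divide_left_mono) auto
      then show ?thesis unfolding B_def B'_def using \<eta> x by (intro add_mono divide_right_mono) auto
    qed
    have "M.prob {\<omega>\<in>space M. d < \<bar>sqrt n * (entropy_functional (grenander (\<lambda>i. X i \<omega>) n) - (\<Sum>i<n. ln (g (X i \<omega>))) / n)\<bar>}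
      \<le> x * ((C + b) * e) + sqrt x * (2 * (2 * 2 ^ k / x
      + (ln (1 / e + C + e) - ln (e / 2)) * (4 * (real (3 * k) * B) + 2 * (B + 1 / 2 ^ (k + 3 * k))))) / d"
      unfolding B_def x_def by (rule prob_excess_le) (use elim e \<eta> k(1) d in auto)
    also have "\<dots> = x * ((C + b) * (1 / x\<^sup>2)) + sqrt x * (2 * (2 * 2 ^ k / x
      + R * (4 * (real (3 * k) * B) + 2 * (B + 1 / 2 ^ (k + 3 * k))))) / d"
      unfolding R_def inv_e unfolding e_def ..
    also have "\<dots> \<le> x * ((C + b) * (1 / x\<^sup>2)) + sqrt x * (2 * (2 * (2 * x powr (1/4)) / x
      + R * (4 * (3 * (ln x / ln 2 / 4 + 1) * B') + 2 * (B' + 1 / x)))) / d"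
    proof (intro add_left_mono divide_right_mono mult_left_mono add_mono mult_mono)
      show "2 ^ k \<le> 2 * x powr (1/4)" using k(2) unfolding x_def .
      show "real (3 * k) \<le> 3 * (ln x / ln 2 / 4 + 1)" using k(5) unfolding x_def .
      show "1 / 2 ^ (k + 3 * k) \<le> 1 / x" using k(4) x unfolding x_def[symmetric] by (intro divide_left_mono) auto
      have "0 \<le> ln x" using x by simp
      then show "0 \<le> 3 * (ln x / ln 2 / 4 + 1)" by (intro mult_nonneg_nonneg add_nonneg_nonneg) auto
    qed (use BB B0 R0 x d in auto)
    also have "\<dots> = excess_rate C b d (real n)" unfolding excess_rate_def R_def B'_def \<eta>_def x_def ..
    finally show ?case .
  qed
qed auto

section \<open>The central limit theorem for the empirical mean of the log-slope\<close>

lemma sum_ln_g_clt: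
  defines "m \<equiv> (\<integral>x. ln (g x) \<partial>\<mu>)" and "s2 \<equiv> (\<integral>x. (ln (g x) - (\<integral>x. ln (g x) \<partial>\<mu>))\<^sup>2 \<partial>\<mu>)"
  shows "weak_conv_m (\<lambda>n. distr M borel (\<lambda>\<omega>. sqrt n * ((\<Sum>i<n. ln (g (X i \<omega>))) / n - m)))
    (distr std_normal_distribution borel (\<lambda>z. sqrt s2 * z))"
proof -
  define Y where "Y i \<omega> = ln (g (X i \<omega>))" for i \<omega>
  have [measurable]: "Y i \<in> borel_measurable M" for i unfolding Y_def by measurable
  have E: "M.expectation (\<lambda>\<omega>. k (X i \<omega>)) = (\<integral>x. k x \<partial>\<mu>)" if [measurable]: "k \<in> borel_measurable borel" for k :: "real \<Rightarrow> real" and i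
    unfolding law[of i, symmetric] by (subst integral_distr) auto
  have mean: "M.expectation (Y i) = m" for i unfolding Y_def m_def by (rule E) measurable
  have var: "M.variance (Y i) = s2" for i
    unfolding mean unfolding Y_def s2_def m_def[symmetric] by (rule E) measurable
  have sq: "integrable M (\<lambda>\<omega>. (Y i \<omega>)\<^sup>2)" for i
  proof -
    have "integrable (distr M borel (X i)) (\<lambda>x. (ln (g x))\<^sup>2)" unfolding law by (rule integrable_ln_g_power2)
    then show ?thesis unfolding Y_def by (subst (asm) integrable_distr_eq) auto
  qed
  have int: "integrable M (Y i)" for i by (rule M.square_integrable_imp_integrable[OF _ sq]) simp
  have s2: "0 \<le> s2" unfolding s2_def by simp
  define T where "T n \<omega> = (\<Sum>i<n. Y i \<omega> - m)" for n :: nat and \<omega>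
  have [measurable]: "T n \<in> borel_measurable M" for n unfolding T_def by measurable
  have A: "sqrt n * ((\<Sum>i<n. ln (g (X i \<omega>))) / n - m) = T n \<omega> / sqrt n" for n \<omega>
  proof (cases "n = 0")
    case False
    then have "(\<Sum>i<n. ln (g (X i \<omega>))) / n - m = T n \<omega> / n"
      unfolding T_def Y_def by (simp add: sum_subtractf field_simps)
    moreover have "sqrt n * (T n \<omega> / n) = T n \<omega> / sqrt n"
      using False real_sqrt_mult_self[of "real n"] by (simp add: field_simps del: real_sqrt_mult_self)
    ultimately show ?thesis by simp
  qed simp
  have N: "real_distribution std_normal_distribution"
    using real_dist_normal_dist .
  interpret G: real_distribution std_normal_distribution by (rule N)
  show ?thesis
    unfolding A
  proof (rule levy_continuity)
    fix t :: real
    show "(\<lambda>n. char (distr M borel (\<lambda>\<omega>. T n \<omega> / sqrt n)) t) \<longlonglongrightarrow> char (distr std_normal_distribution borel (\<lambda>z. sqrt s2 * z)) t"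
    \<comment> \<open>The central limit theorem needs a positive variance. The variance is 0 when
      the projection is uniform, for instance; then the centred sums vanish almost surely and the
      limit is the point mass at 0.\<close>
    proof (cases "s2 = 0")
      case True
      have "AE \<omega> in M. Y i \<omega> - m = 0" for i
      proof -
        have "integrable M (\<lambda>\<omega>. (Y i \<omega> - m)\<^sup>2)" using sq int by (simp add: power2_diff)
        then have "AE \<omega> in M. (Y i \<omega> - m)\<^sup>2 = 0"
          using var[of i] True unfolding mean by (subst integral_nonneg_eq_0_iff_AE[symmetric]) auto
        then show ?thesis by simp
      qed
      then have "AE \<omega> in M. \<forall>i. Y i \<omega> - m = 0" by (simp add: AE_all_countable)
      then have 0: "AE \<omega> in M. T n \<omega> = 0" for n by eventually_elim (simp add: T_def)
      have "char (distr M borel (\<lambda>\<omega>. T n \<omega> / sqrt n)) t = 1" for n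
      proof -
        have "char (distr M borel (\<lambda>\<omega>. T n \<omega> / sqrt n)) t = M.expectation (\<lambda>\<omega>. iexp (t * (T n \<omega> / sqrt n)))"
          unfolding char_def by (simp add: integral_distr)
        also have "\<dots> = M.expectation (\<lambda>\<omega>. 1)" using 0[of n] by (intro integral_cong_AE) auto
        finally show ?thesis by (simp add: M.prob_space)
      qed
      moreover have "char (distr std_normal_distribution borel (\<lambda>z. sqrt s2 * z)) t = 1"
        unfolding char_def True using G.prob_space by (simp add: integral_distr del: distr_const)
      ultimately show ?thesis by simp
    next
      case False
      define \<sigma> where "\<sigma> = sqrt s2"
      have \<sigma>: "0 < \<sigma>" "\<sigma>\<^sup>2 = s2" unfolding \<sigma>_def using False s2 by auto
      have "weak_conv_m (\<lambda>n. distr M borel (\<lambda>\<omega>. (\<Sum>i<n. Y i \<omega> - m) / sqrt (n * \<sigma>\<^sup>2))) std_normal_distribution"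
      proof (rule M.central_limit_theorem[where \<mu> = "distr \<mu> borel (\<lambda>x. ln (g x))"])
        show "M.indep_vars (\<lambda>i. borel) Y UNIV"
          unfolding Y_def by (rule M.indep_vars_compose2[OF indep]) measurable
        show "distr M borel (Y i) = distr \<mu> borel (\<lambda>x. ln (g x))" for i
        proof -
          have "distr (distr M borel (X i)) borel (\<lambda>x. ln (g x)) = distr M borel (Y i)"
            unfolding Y_def by (subst distr_distr) (auto simp: comp_def)
          then show ?thesis unfolding law ..
        qed
      qed (use mean \<sigma> sq var in auto)
      \<comment> \<open>Evaluating the characteristic functions at t * \<sigma> undoes the
        normalization by the standard deviation.\<close>
      then have "(\<lambda>n. char (distr M borel (\<lambda>\<omega>. (\<Sum>i<n. Y i \<omega> - m) / sqrt (n * \<sigma>\<^sup>2))) (t * \<sigma>))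
          \<longlonglongrightarrow> char std_normal_distribution (t * \<sigma>)"
        by (rule levy_continuity1[rotated 2]) (auto intro: N)
      moreover have "char (distr M borel (\<lambda>\<omega>. (\<Sum>i<n. Y i \<omega> - m) / sqrt (n * \<sigma>\<^sup>2))) (t * \<sigma>)
          = char (distr M borel (\<lambda>\<omega>. T n \<omega> / sqrt n)) t" for n
      proof -
        have "t * \<sigma> * (T n \<omega> / sqrt (n * \<sigma>\<^sup>2)) = t * (T n \<omega> / sqrt n)" for \<omega>
          using \<sigma>(1) by (simp add: real_sqrt_mult)
        moreover have "char (distr M borel Z) s = M.expectation (\<lambda>\<omega>. iexp (s * Z \<omega>))"
          if [measurable]: "Z \<in> borel_measurable M" for Z s
          unfolding char_def by (simp add: integral_distr)
        moreover have "(\<lambda>\<omega>. T n \<omega> / sqrt (n * \<sigma>\<^sup>2)) \<in> borel_measurable M" "(\<lambda>\<omega>. T n \<omega> / sqrt n) \<in> borel_measurable M"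
          by measurable
        ultimately show ?thesis unfolding T_def[symmetric] by (simp only:)
      qed
      moreover have "char std_normal_distribution (t * \<sigma>) = char (distr std_normal_distribution borel (\<lambda>z. sqrt s2 * z)) t"
        unfolding char_def \<sigma>_def by (simp add: integral_distr mult.assoc)
      ultimately show ?thesis by simp
    qed
  qed (auto intro!: G.real_distribution_distr)
qed

lemma entropy_grenander_clt:
  "weak_conv_m (\<lambda>n. distr M borel (\<lambda>\<omega>. sqrt n * (entropy_functional (grenander (\<lambda>i. X i \<omega>) n) - entropy_functional g)))
    (distr std_normal_distribution borel (\<lambda>z. sqrt (\<integral>x. (ln (g x) - (\<integral>x. ln (g x) \<partial>\<mu>))\<^sup>2 \<partial>\<mu>) * z))"
proof (rule M.weak_conv_m_add_negligible[OF sum_ln_g_clt])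
  interpret G: real_distribution std_normal_distribution by (rule real_dist_normal_dist)
  show "real_distribution (distr std_normal_distribution borel
      (\<lambda>z. sqrt (\<integral>x. (ln (g x) - (\<integral>x. ln (g x) \<partial>\<mu>))\<^sup>2 \<partial>\<mu>) * z))"
    by (auto intro!: G.real_distribution_distr)
  show "(\<lambda>\<omega>. sqrt n * ((\<Sum>i<n. ln (g (X i \<omega>))) / n - (\<integral>x. ln (g x) \<partial>\<mu>))) \<in> borel_measurable M" for n
    by measurable
  show "(\<lambda>\<omega>. sqrt n * (entropy_functional (grenander (\<lambda>i. X i \<omega>) n) - entropy_functional g)) \<in> borel_measurable M" for n
    using entropy_grenander_measurable[of X M n] by (auto intro: X_measurable)
  fix d :: real assume "0 < d"
  then show "(\<lambda>n. M.prob {\<omega>\<in>space M. d < \<bar>sqrt n * (entropy_functional (grenander (\<lambda>i. X i \<omega>) n) - entropy_functional g)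
      - sqrt n * ((\<Sum>i<n. ln (g (X i \<omega>))) / n - (\<integral>x. ln (g x) \<partial>\<mu>))\<bar>}) \<longlonglongrightarrow> 0"
    using excess_tendsto_0 unfolding entropy_g by (simp flip: right_diff_distrib)
qed

end

end

section \<open>The central limit theorem for the entropy\<close>

lemma real_distribution_law_of_density:
  assumes "halfline_density f"
  shows "real_distribution (law_of_density f)"
proof -
  have [measurable]: "f \<in> borel_measurable borel" and 1: "(\<integral>\<^sup>+x. ennreal (f x) \<partial>lborel) = 1"
    using assms unfolding halfline_density_def by auto
  have "prob_space (law_of_density f)"
    unfolding law_of_density_def by (rule prob_spaceI) (simp add: emeasure_density 1)
  then show ?thesis
    by (simp add: real_distribution_def real_distribution_axioms_def law_of_density_def)
qed

lemma continuous_distribution_law_of_density: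
  assumes "halfline_density f"
  shows "continuous_distribution (law_of_density f)"
proof -
  interpret real_distribution "law_of_density f" by (rule real_distribution_law_of_density[OF assms])
  have [measurable]: "f \<in> borel_measurable borel" using assms unfolding halfline_density_def by auto
  have "emeasure (law_of_density f) {x} = 0" for x
  proof -
    have "emeasure (law_of_density f) {x} = (\<integral>\<^sup>+y. ennreal (f y) * indicator {x} y \<partial>lborel)"
      unfolding law_of_density_def by (simp add: emeasure_density)
    also have "\<dots> = (\<integral>\<^sup>+y. 0 \<partial>(lborel :: real measure))"
    proof (rule nn_integral_cong_AE)
      show "AE y in lborel. ennreal (f y) * indicator {x} y = 0"
        using AE_lborel_singleton[of x] by eventually_elim simp
    qed
    finally show ?thesis by simp
  qed
  then have "isCont (cdf (law_of_density f)) x" for x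
    unfolding isCont_cdf by (simp add: measure_def)
  then show ?thesis
    by unfold_locales (simp add: continuous_on_eq_continuous_at)
qed

lemma concave_hull_law_of_density:
  assumes f: "halfline_density f"
  shows "concave_hull (law_of_density f)"
proof -
  interpret continuous_distribution "law_of_density f" by (rule continuous_distribution_law_of_density[OF f])
  let ?F = "cdf (law_of_density f)"
  have [measurable]: "f \<in> borel_measurable borel" and neg: "\<And>x. x < 0 \<Longrightarrow> f x = 0"
    using f unfolding halfline_density_def by auto
  have "emeasure (law_of_density f) {..0} = (\<integral>\<^sup>+x. ennreal (f x) * indicator {..0} x \<partial>lborel)"
    unfolding law_of_density_def by (simp add: emeasure_density)
  also have "\<dots> = (\<integral>\<^sup>+x. 0 \<partial>(lborel :: real measure))"
    using AE_lborel_singleton[of "0 :: real"]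
    by (intro nn_integral_cong_AE) (auto simp: neg split: split_indicator)
  finally have F0: "?F 0 = 0" by (simp add: cdf_def measure_def)
  show ?thesis
  proof
    show "?F 0 = 0" by (rule F0)
    fix a :: real assume a: "0 < a"
    \<comment> \<open>Beyond 1 / a the line exceeds 1, so the difference is at most its value 0 at
      the origin; a maximum over the compact interval is a maximum over the half-line.\<close>
    have "continuous_on {0..1 / a} (\<lambda>x. ?F x - a * x)"
      using continuous_on_subset[OF continuous_cdf] by (intro continuous_intros) auto
    then obtain \<tau> where \<tau>: "\<tau> \<in> {0..1 / a}" "\<And>x. x \<in> {0..1 / a} \<Longrightarrow> ?F x - a * x \<le> ?F \<tau> - a * \<tau>"
      using continuous_attains_sup[of "{0..1 / a}" "\<lambda>x. ?F x - a * x"] a by auto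
    have "?F x - a * x \<le> ?F \<tau> - a * \<tau>" if x: "0 \<le> x" for x
    proof (cases "x \<le> 1 / a")
      case False
      then have "1 \<le> a * x" using a by (simp add: field_simps)
      then have "?F x - a * x \<le> 0" using cdf_bounded_prob[of x] by linarith
      also have "0 \<le> ?F \<tau> - a * \<tau>" using \<tau>(2)[of 0] a F0 by simp
      finally show ?thesis .
    qed (use \<tau>(2)[of x] x in auto)
    then show "\<exists>\<tau>\<ge>0. \<forall>x\<ge>0. ?F x - a * x \<le> ?F \<tau> - a * \<tau>" using \<tau>(1) by auto
  qed
qed

lemma decreasing_projection_eq:
  assumes "halfline_density f"
  shows "decreasing_projection f = concave_hull.g (law_of_density f)"
  by (rule ext) (simp only: decreasing_projection_def
    concave_hull.g_def[OF concave_hull_law_of_density[OF assms]]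
    concave_hull.H_def[OF concave_hull_law_of_density[OF assms]])

theorem theorem4p1:
  fixes M :: "'a measure" and X :: "nat \<Rightarrow> 'a \<Rightarrow> real"
    and f0 :: "real \<Rightarrow> real" and c0 :: real
  assumes "prob_space M"
    and "halfline_density f0"
    and "prob_space.indep_vars M (\<lambda>_. borel) X UNIV"
    and "\<And>i. distributed M lborel (X i) (\<lambda>x. ennreal (f0 x))"
    and "bounded (decreasing_projection f0 ` {0<..})"
    and "\<exists>b. AE x in lborel. b < x \<longrightarrow> f0 x = 0"
    and "AE x in lborel. 0 < x \<longrightarrow> f0 x / decreasing_projection f0 x \<le> c0\<^sup>2"
  shows "variance_under f0 (\<lambda>x. ln (decreasing_projection f0 x)) =
           variance_under (decreasing_projection f0) (\<lambda>x. ln (decreasing_projection f0 x)) \<and>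
         weak_conv_m
           (\<lambda>n. distr M borel (\<lambda>\<omega>. sqrt (real n) *
              (entropy_functional (grenander (\<lambda>i. X i \<omega>) n)
                - entropy_functional (decreasing_projection f0))))
           (distr std_normal_distribution borel
              (\<lambda>z. sqrt (variance_under f0 (\<lambda>x. ln (decreasing_projection f0 x))) * z))"
proof -
  note f0 = assms(2)
  have [measurable]: "f0 \<in> borel_measurable borel" and f0_int: "(\<integral>\<^sup>+x. ennreal (f0 x) \<partial>lborel) = 1"
    using f0 unfolding halfline_density_def by auto
  let ?\<mu> = "law_of_density f0"
  interpret concave_hull ?\<mu> by (rule concave_hull_law_of_density[OF f0])
  interpret continuous_distribution ?\<mu> by (rule continuous_distribution_law_of_density[OF f0])
  have proj: "decreasing_projection f0 = g" by (rule decreasing_projection_eq[OF f0])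
  obtain C where C: "\<And>x. 0 < x \<Longrightarrow> g x \<le> C"
    using assms(5) unfolding proj bounded_iff by (force simp: abs_le_iff)
  obtain b0 where b0: "AE x in lborel. b0 < x \<longrightarrow> f0 x = 0" using assms(6) by blast
  \<comment> \<open>The maximum with 1 makes the right end point positive, as
    \<open>bounded_hull\<close> demands.\<close>
  define b where "b = max b0 1"
  have "emeasure ?\<mu> {..b} = (\<integral>\<^sup>+x. ennreal (f0 x) * indicator {..b} x \<partial>lborel)"
    unfolding law_of_density_def by (simp add: emeasure_density)
  also have "\<dots> = (\<integral>\<^sup>+x. ennreal (f0 x) \<partial>lborel)"
    using b0 by (intro nn_integral_cong_AE) (auto simp: b_def split: split_indicator elim!: eventually_mono)
  finally have b: "F b = 1" unfolding cdf_def measure_def f0_int by simp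
  \<comment> \<open>\<open>C\<close> bounds the slope on the positive half-line only; elsewhere the
    slope is 0.\<close>
  interpret bounded_hull ?\<mu> "max C 0" b
  proof
    show "g x \<le> max C 0" for x using C[of x] g_nonpos[of x] by (cases "0 < x") auto
  qed (use b in \<open>auto simp: b_def\<close>)
  have law: "distr M borel (X i) = ?\<mu>" for i
  proof -
    have "distr M borel (X i) = distr M lborel (X i)" by (rule distr_cong) auto
    also have "\<dots> = ?\<mu>" using assms(4)[of i] unfolding distributed_def law_of_density_def by simp
    finally show ?thesis .
  qed
  have "variance_under f0 (\<lambda>x. ln (g x)) = variance_under g (\<lambda>x. ln (g x))"
    using integral_comp_g(1)[of ln] integral_comp_g(1)[of "\<lambda>y. (ln y - (\<integral>x. ln (g x) \<partial>?\<mu>))\<^sup>2"]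
    unfolding variance_under_def law_of_density_def[of g] by simp
  moreover have "variance_under f0 (\<lambda>x. ln (g x)) = (\<integral>x. (ln (g x) - (\<integral>x. ln (g x) \<partial>?\<mu>))\<^sup>2 \<partial>?\<mu>)"
    unfolding variance_under_def ..
  ultimately show ?thesis
    unfolding proj using entropy_grenander_clt[OF assms(1,3) law] by simp
qed

end
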